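(* Let $\Gamma$ be a planar $3$-connected graph, let $\mathbb{X}^2$ be $\mathbb{E}^2=\mathbb{R}^2$, $\mathbb{S}^2$ or $\mathbb{H}^2$, and let $(\Gamma,p)$ be a framework in $\mathbb{X}^2$ such that for every face $\alpha\in\Gamma_2$ the points $\{p_i\mid i\in\alpha\}$ are not collinear (do not lie on one geodesic line, respectively great circle, of $\mathbb{X}^2$). Then the following conditions are equivalent: 1. $(\Gamma,p)$ has a self-stress that is non-zero on all edges. 2. $(\Gamma,p)$ has a reciprocal diagram. 3. $(\Gamma,p)$ has a polyhedral lift. (The notions of reciprocal diagram and polyhedral lift in each of the three geometries are those given in the context.)
   Context: Graphs: A graph is $3$-connected if it is connected, has at least $4$ vertices and remains connected after removal of any two vertices. $\Gamma$ is finite and simple, with vertex set $\Gamma_0$, edge set $\Gamma_1$. For a planar $3$-connected $\Gamma$ the set of faces $\Gamma_2$ is well defined: a face is a component of the complement of an embedding of $\Gamma$ in the 2-sphere, identified with the cycle (set) of vertices on its boundary; $i\in\alpha$ means vertex $i$ lies on the boundary of face $\alpha$ (then $(\alpha,i)$ is an incident pair). The dual graph $\Gamma^*$ has vertex set $\Gamma_2$, two faces being joined if they share an edge; if $ij\in\Gamma_1$ separates the faces $\alpha,\beta$, then $(\alpha\beta,ij)$ is a dual pair. Spaces: $\mathbb{S}^2=\{x\in\mathbb{R}^3\mid\langle x,x\rangle=1\}$ (Euclidean scalar product); $\mathbb{H}^2=\{x\in\mathbb{R}^3\mid\langle x,x\rangle=-1,x_0>0\}$, $\langle x,y\rangle=-x_0y_0+x_1y_1+x_2y_2$.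 A framework $(\Gamma,p)$ in $\mathbb{X}^2$ is a map $p\colon\Gamma_0\to\mathbb{X}^2$ with $p_i\neq p_j$ for all $ij\in\Gamma_1$, and for $\mathbb{X}=\mathbb{S}$ also $p_i\ne-p_j$ for all $ij\in\Gamma_1$; frameworks $(\Gamma^*,m)$ are defined in the same way. Self-stress: a map $w\colon\Gamma_1\to\mathbb{R}$, $w_{ij}=w_{ji}$, with $\sum_{j:ij\in\Gamma_1}w_{ij}\operatorname{dist}(p_i,p_j)e_{ij}=0$ for all $i\in\Gamma_0$, where $e_{ij}\in T_{p_i}\mathbb{X}^2$ is the unit vector at $p_i$ pointing along the minimizing geodesic to $p_j$. In $\mathbb{R}^2$: $\sum_jw_{ij}(p_j-p_i)=0$ for all $i$. Reciprocal diagram: (Euclidean) a framework $(\Gamma^*,m)$ in $\mathbb{R}^2$ with $m_\beta-m_\alpha\perp p_j-p_i$ for every dual pair $(\alpha\beta,ij)$. (Spherical; "weak reciprocal diagram") a framework $(\Gamma^*,m)$ in $\mathbb{S}^2$ such that for every dual pair $(\alpha\beta,ij)$ the geodesics (great circles) $p_ip_j$ and $m_\alpha m_\beta$ are perpendicular, and for every incident pair $(\alpha,i)$ the distance between $m_\alpha$ and $p_i$ is different from $\pi/2$. (Hyperbolic) a framework $(\Gamma^*,m)$ in $\mathbb{H}^2$ such that for every dual pair $(\alpha\beta,ij)$ the geodesics $m_\alpha m_\beta$ and $p_ip_j$ are perpendicular. In the last two cases perpendicularity is equivalent to $\langle m_\alpha,p_i\rangle\langle m_\beta,p_j\rangle-\langle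 m_\alpha,p_j\rangle\langle m_\beta,p_i\rangle=0$. Polyhedral lift: a map $\tilde p\colon\Gamma_0\to\mathbb{R}^3$ such that for every face $\alpha$ the points $\{\tilde p_i\mid i\in\alpha\}$ are coplanar, the planes of adjacent faces differ from each other, and moreover: (Euclidean; "vertical polyhedral lift") $\mathrm{pr}_\perp\circ\tilde p=p$, where $\mathrm{pr}_\perp\colon\mathbb{R}^3\to\mathbb{R}^2$ is the orthogonal projection; (Spherical; "weak polyhedral lift") $\tilde p_i=a_ip_i$ with $a_i\in\mathbb{R}$, $a_i\ne0$ for every $i$; (Hyperbolic) $\tilde p_i=a_ip_i$ with $a_i>0$ for every $i$, and the plane containing $\{\tilde p_i\mid i\in\alpha\}$ is space-like (with respect to the Minkowski product) for every face $\alpha$. *)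

theory Defs
  imports "HOL-Analysis.Analysis" "Graph_Theory.Digraph_Component"
begin

section \<open>Planar 3-connected graphs, their faces and duals\<close>

text \<open>
  A finite simple graph is a \<^locale>\<open>pair_graph\<close>: the edge \<open>ij\<close> is present in \<open>parcs G\<close> as the two
  pairs \<open>(i, j)\<close> and \<open>(j, i)\<close>. The constant \<open>connected\<close> exists both for topological spaces and
  for graphs, so both uses are qualified.
\<close>

definition three_connected :: "'a pair_pre_digraph \<Rightarrow> bool" where
  "three_connected G \<longleftrightarrow>
     Digraph_Component.connected (with_proj G) \<and>
     card (pverts G) \<ge> 4 \<and>
     (\<forall>u\<in>pverts G. \<forall>v\<in>pverts G. u \<noteq> v \<longrightarrow>
        Digraph_Component.connected (with_proj G \<restriction> (pverts G - {u, v})))"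

abbreviation S2 :: "(real^3) set" where
  "S2 \<equiv> sphere 0 1"

text \<open>
  An embedding of \<open>G\<close> in the 2-sphere: \<open>\<phi>\<close> places the vertices and \<open>\<gamma> i j\<close> is a simple curve from
  \<open>\<phi> i\<close> to \<open>\<phi> j\<close> realising the edge \<open>ij\<close>. The curves \<open>\<gamma> i j\<close> and \<open>\<gamma> j i\<close> have the same image.
\<close>

definition sphere_embedding ::
    "'a pair_pre_digraph \<Rightarrow> ('a \<Rightarrow> real^3) \<Rightarrow> ('a \<Rightarrow> 'a \<Rightarrow> real \<Rightarrow> real^3) \<Rightarrow> bool" where
  "sphere_embedding G \<phi> \<gamma> \<longleftrightarrow>
     \<phi> ` pverts G \<subseteq> S2 \<and> inj_on \<phi> (pverts G) \<and>
     (\<forall>(i, j)\<in>parcs G.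
        Path_Connected.arc (\<gamma> i j) \<and> path_image (\<gamma> i j) \<subseteq> S2 \<and>
        pathstart (\<gamma> i j) = \<phi> i \<and> pathfinish (\<gamma> i j) = \<phi> j \<and>
        path_image (\<gamma> j i) = path_image (\<gamma> i j) \<and>
        path_image (\<gamma> i j) \<inter> \<phi> ` pverts G = {\<phi> i, \<phi> j}) \<and>
     (\<forall>(i, j)\<in>parcs G. \<forall>(k, l)\<in>parcs G. {i, j} \<noteq> {k, l} \<longrightarrow>
        path_image (\<gamma> i j) \<inter> path_image (\<gamma> k l) \<subseteq> \<phi> ` pverts G)"

definition drawing ::
    "'a pair_pre_digraph \<Rightarrow> ('a \<Rightarrow> real^3) \<Rightarrow> ('a \<Rightarrow> 'a \<Rightarrow> real \<Rightarrow> real^3) \<Rightarrow> (real^3) set" where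
  "drawing G \<phi> \<gamma> = \<phi> ` pverts G \<union> (\<Union>(i, j)\<in>parcs G. path_image (\<gamma> i j))"

definition faces ::
    "'a pair_pre_digraph \<Rightarrow> ('a \<Rightarrow> real^3) \<Rightarrow> ('a \<Rightarrow> 'a \<Rightarrow> real \<Rightarrow> real^3) \<Rightarrow> (real^3) set set" where
  "faces G \<phi> \<gamma> = components (S2 - drawing G \<phi> \<gamma>)"

text \<open>The boundary of a face is taken relative to the sphere, not in \<open>real^3\<close>.\<close>

definition face_boundary :: "(real^3) set \<Rightarrow> (real^3) set" where
  "face_boundary \<alpha> = (top_of_set S2) frontier_of \<alpha>"

definition face_verts ::
    "'a pair_pre_digraph \<Rightarrow> ('a \<Rightarrow> real^3) \<Rightarrow> (real^3) set \<Rightarrow> 'a set" where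
  "face_verts G \<phi> \<alpha> = {i \<in> pverts G. \<phi> i \<in> face_boundary \<alpha>}"

definition dual_pair ::
    "'a pair_pre_digraph \<Rightarrow> ('a \<Rightarrow> real^3) \<Rightarrow> ('a \<Rightarrow> 'a \<Rightarrow> real \<Rightarrow> real^3) \<Rightarrow>
     (real^3) set \<Rightarrow> (real^3) set \<Rightarrow> 'a \<Rightarrow> 'a \<Rightarrow> bool" where
  "dual_pair G \<phi> \<gamma> \<alpha> \<beta> i j \<longleftrightarrow>
     \<alpha> \<in> faces G \<phi> \<gamma> \<and> \<beta> \<in> faces G \<phi> \<gamma> \<and> \<alpha> \<noteq> \<beta> \<and> (i, j) \<in> parcs G \<and>
     path_image (\<gamma> i j) \<subseteq> face_boundary \<alpha> \<and> path_image (\<gamma> i j) \<subseteq> face_boundary \<beta>"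

definition dual_graph ::
    "'a pair_pre_digraph \<Rightarrow> ('a \<Rightarrow> real^3) \<Rightarrow> ('a \<Rightarrow> 'a \<Rightarrow> real \<Rightarrow> real^3) \<Rightarrow>
     (real^3) set pair_pre_digraph" where
  "dual_graph G \<phi> \<gamma> =
     \<lparr> pverts = faces G \<phi> \<gamma>, parcs = {(\<alpha>, \<beta>). \<exists>i j. dual_pair G \<phi> \<gamma> \<alpha> \<beta> i j} \<rparr>"


section \<open>The sphere and the hyperbolic plane\<close>

text \<open>The coordinates \<open>x\<^sub>0, x\<^sub>1, x\<^sub>2\<close> are \<open>x $ 1, x $ 2, x $ 3\<close>; \<open>x\<^sub>0\<close> is the time-like one.\<close>

definition mink :: "real^3 \<Rightarrow> real^3 \<Rightarrow> real" where
  "mink x y = - (x $ 1 * y $ 1) + x $ 2 * y $ 2 + x $ 3 * y $ 3"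

definition H2 :: "(real^3) set" where
  "H2 = {x. mink x x = -1 \<and> x $ 1 > 0}"

definition dist_S :: "real^3 \<Rightarrow> real^3 \<Rightarrow> real" where
  "dist_S x y = arccos (x \<bullet> y)"

definition dist_H :: "real^3 \<Rightarrow> real^3 \<Rightarrow> real" where
  "dist_H x y = arcosh (- mink x y)"

text \<open>
  The unit speed geodesics starting at \<open>x\<close> are \<open>t \<mapsto> cos t x + sin t e\<close> in the sphere and
  \<open>t \<mapsto> cosh t x + sinh t e\<close> in the hyperbolic plane, where \<open>e\<close> is a unit tangent vector at \<open>x\<close>.
  A minimizing one reaches \<open>y\<close> at time \<open>dist(x, y)\<close>. The direction \<open>e\<close> is thus determined
  by \<open>y\<close> if \<open>y \<noteq> x\<close> and, in the sphere, \<open>y \<noteq> - x\<close>.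
\<close>

definition dir_S :: "real^3 \<Rightarrow> real^3 \<Rightarrow> real^3" where
  "dir_S x y = (THE e. x \<bullet> e = 0 \<and> e \<bullet> e = 1 \<and>
     y = cos (dist_S x y) *\<^sub>R x + sin (dist_S x y) *\<^sub>R e)"

definition dir_H :: "real^3 \<Rightarrow> real^3 \<Rightarrow> real^3" where
  "dir_H x y = (THE e. mink x e = 0 \<and> mink e e = 1 \<and>
     y = cosh (dist_H x y) *\<^sub>R x + sinh (dist_H x y) *\<^sub>R e)"

text \<open>
  The geodesics of \<open>X = S2\<close> and \<open>X = H2\<close> are the non-empty intersections of \<open>X\<close> with
  2-dimensional linear subspaces.
\<close>

definition on_geodesic :: "(real^3) set \<Rightarrow> (real^3) set \<Rightarrow> bool" where
  "on_geodesic X A \<longleftrightarrow> (\<exists>W. subspace W \<and> dim W = 2 \<and> A \<subseteq> X \<inter> W)"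

text \<open>
  The geodesics \<open>xy\<close> and \<open>ab\<close> of \<open>X\<close> are perpendicular: they have a common point \<open>z\<close>, at which
  tangent vectors \<open>u\<close> of \<open>xy\<close> and \<open>v\<close> of \<open>ab\<close> are orthogonal. Here \<open>B\<close> is the scalar product
  defining \<open>X\<close>; the tangent space of \<open>X\<close> at \<open>z\<close> is the \<open>B\<close>-orthogonal complement of \<open>z\<close>.
\<close>

definition perp_geodesics ::
    "(real^3 \<Rightarrow> real^3 \<Rightarrow> real) \<Rightarrow> (real^3) set \<Rightarrow>
     real^3 \<Rightarrow> real^3 \<Rightarrow> real^3 \<Rightarrow> real^3 \<Rightarrow> bool" where
  "perp_geodesics B X x y a b \<longleftrightarrow>
     (\<exists>z u v. z \<in> X \<inter> span {x, y} \<inter> span {a, b} \<and>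
        u \<in> span {x, y} \<and> u \<noteq> 0 \<and> B z u = 0 \<and>
        v \<in> span {a, b} \<and> v \<noteq> 0 \<and> B z v = 0 \<and> B u v = 0)"


section \<open>Frameworks and self-stresses\<close>

definition framework_E :: "'v pair_pre_digraph \<Rightarrow> ('v \<Rightarrow> real^2) \<Rightarrow> bool" where
  "framework_E G p \<longleftrightarrow> (\<forall>(i, j)\<in>parcs G. p i \<noteq> p j)"

definition framework_S :: "'v pair_pre_digraph \<Rightarrow> ('v \<Rightarrow> real^3) \<Rightarrow> bool" where
  "framework_S G p \<longleftrightarrow>
     (\<forall>i\<in>pverts G. p i \<in> S2) \<and> (\<forall>(i, j)\<in>parcs G. p i \<noteq> p j \<and> p i \<noteq> - p j)"

definition framework_H :: "'v pair_pre_digraph \<Rightarrow> ('v \<Rightarrow> real^3) \<Rightarrow> bool" where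
  "framework_H G p \<longleftrightarrow> (\<forall>i\<in>pverts G. p i \<in> H2) \<and> (\<forall>(i, j)\<in>parcs G. p i \<noteq> p j)"

definition symmetric_weights :: "'v pair_pre_digraph \<Rightarrow> ('v \<Rightarrow> 'v \<Rightarrow> real) \<Rightarrow> bool" where
  "symmetric_weights G w \<longleftrightarrow> (\<forall>(i, j)\<in>parcs G. w i j = w j i)"

definition self_stress_E ::
    "'v pair_pre_digraph \<Rightarrow> ('v \<Rightarrow> real^2) \<Rightarrow> ('v \<Rightarrow> 'v \<Rightarrow> real) \<Rightarrow> bool" where
  "self_stress_E G p w \<longleftrightarrow> symmetric_weights G w \<and>
     (\<forall>i\<in>pverts G. (\<Sum>j | (i, j) \<in> parcs G. w i j *\<^sub>R (p j - p i)) = 0)"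

definition self_stress_S ::
    "'v pair_pre_digraph \<Rightarrow> ('v \<Rightarrow> real^3) \<Rightarrow> ('v \<Rightarrow> 'v \<Rightarrow> real) \<Rightarrow> bool" where
  "self_stress_S G p w \<longleftrightarrow> symmetric_weights G w \<and>
     (\<forall>i\<in>pverts G.
        (\<Sum>j | (i, j) \<in> parcs G. (w i j * dist_S (p i) (p j)) *\<^sub>R dir_S (p i) (p j)) = 0)"

definition self_stress_H ::
    "'v pair_pre_digraph \<Rightarrow> ('v \<Rightarrow> real^3) \<Rightarrow> ('v \<Rightarrow> 'v \<Rightarrow> real) \<Rightarrow> bool" where
  "self_stress_H G p w \<longleftrightarrow> symmetric_weights G w \<and>
     (\<forall>i\<in>pverts G.
        (\<Sum>j | (i, j) \<in> parcs G. (w i j * dist_H (p i) (p j)) *\<^sub>R dir_H (p i) (p j)) = 0)"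

definition nonzero_on_edges :: "'v pair_pre_digraph \<Rightarrow> ('v \<Rightarrow> 'v \<Rightarrow> real) \<Rightarrow> bool" where
  "nonzero_on_edges G w \<longleftrightarrow> (\<forall>(i, j)\<in>parcs G. w i j \<noteq> 0)"


section \<open>Reciprocal diagrams\<close>

definition reciprocal_E ::
    "'a pair_pre_digraph \<Rightarrow> ('a \<Rightarrow> real^3) \<Rightarrow> ('a \<Rightarrow> 'a \<Rightarrow> real \<Rightarrow> real^3) \<Rightarrow>
     ('a \<Rightarrow> real^2) \<Rightarrow> ((real^3) set \<Rightarrow> real^2) \<Rightarrow> bool" where
  "reciprocal_E G \<phi> \<gamma> p m \<longleftrightarrow>
     framework_E (dual_graph G \<phi> \<gamma>) m \<and>
     (\<forall>\<alpha> \<beta> i j. dual_pair G \<phi> \<gamma> \<alpha> \<beta> i j \<longrightarrow> orthogonal (m \<beta> - m \<alpha>) (p j - p i))"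

definition reciprocal_S ::
    "'a pair_pre_digraph \<Rightarrow> ('a \<Rightarrow> real^3) \<Rightarrow> ('a \<Rightarrow> 'a \<Rightarrow> real \<Rightarrow> real^3) \<Rightarrow>
     ('a \<Rightarrow> real^3) \<Rightarrow> ((real^3) set \<Rightarrow> real^3) \<Rightarrow> bool" where
  "reciprocal_S G \<phi> \<gamma> p m \<longleftrightarrow>
     framework_S (dual_graph G \<phi> \<gamma>) m \<and>
     (\<forall>\<alpha> \<beta> i j. dual_pair G \<phi> \<gamma> \<alpha> \<beta> i j \<longrightarrow>
        perp_geodesics (\<bullet>) S2 (p i) (p j) (m \<alpha>) (m \<beta>)) \<and>
     (\<forall>\<alpha>\<in>faces G \<phi> \<gamma>. \<forall>i\<in>face_verts G \<phi> \<alpha>. dist_S (m \<alpha>) (p i) \<noteq> pi / 2)"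

definition reciprocal_H ::
    "'a pair_pre_digraph \<Rightarrow> ('a \<Rightarrow> real^3) \<Rightarrow> ('a \<Rightarrow> 'a \<Rightarrow> real \<Rightarrow> real^3) \<Rightarrow>
     ('a \<Rightarrow> real^3) \<Rightarrow> ((real^3) set \<Rightarrow> real^3) \<Rightarrow> bool" where
  "reciprocal_H G \<phi> \<gamma> p m \<longleftrightarrow>
     framework_H (dual_graph G \<phi> \<gamma>) m \<and>
     (\<forall>\<alpha> \<beta> i j. dual_pair G \<phi> \<gamma> \<alpha> \<beta> i j \<longrightarrow>
        perp_geodesics mink H2 (p i) (p j) (m \<alpha>) (m \<beta>))"


section \<open>Polyhedral lifts\<close>

text \<open>
  The plane of the face \<open>\<alpha>\<close> is \<open>affine hull (q ` face_verts G \<phi> \<alpha>)\<close>. If the points \<open>p i\<close>, \<open>i \<in> \<alpha>\<close>,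
  do not lie on one geodesic, then for each of the three kinds of lifts \<open>q\<close> below the points
  \<open>q i\<close>, \<open>i \<in> \<alpha>\<close>, are not collinear, so that this affine hull is indeed a plane.
\<close>

definition face_plane ::
    "'a pair_pre_digraph \<Rightarrow> ('a \<Rightarrow> real^3) \<Rightarrow> ('a \<Rightarrow> real^3) \<Rightarrow> (real^3) set \<Rightarrow> (real^3) set" where
  "face_plane G \<phi> q \<alpha> = affine hull (q ` face_verts G \<phi> \<alpha>)"

definition polyhedral ::
    "'a pair_pre_digraph \<Rightarrow> ('a \<Rightarrow> real^3) \<Rightarrow> ('a \<Rightarrow> 'a \<Rightarrow> real \<Rightarrow> real^3) \<Rightarrow>
     ('a \<Rightarrow> real^3) \<Rightarrow> bool" where
  "polyhedral G \<phi> \<gamma> q \<longleftrightarrow>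
     (\<forall>\<alpha>\<in>faces G \<phi> \<gamma>. coplanar (q ` face_verts G \<phi> \<alpha>)) \<and>
     (\<forall>(\<alpha>, \<beta>)\<in>parcs (dual_graph G \<phi> \<gamma>). face_plane G \<phi> q \<alpha> \<noteq> face_plane G \<phi> q \<beta>)"

definition pr_perp :: "real^3 \<Rightarrow> real^2" where
  "pr_perp x = vector [x $ 1, x $ 2]"

definition space_like :: "(real^3) set \<Rightarrow> bool" where
  "space_like P \<longleftrightarrow> (\<forall>x\<in>P. \<forall>y\<in>P. x \<noteq> y \<longrightarrow> mink (x - y) (x - y) > 0)"

definition polyhedral_lift_E ::
    "'a pair_pre_digraph \<Rightarrow> ('a \<Rightarrow> real^3) \<Rightarrow> ('a \<Rightarrow> 'a \<Rightarrow> real \<Rightarrow> real^3) \<Rightarrow>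
     ('a \<Rightarrow> real^2) \<Rightarrow> ('a \<Rightarrow> real^3) \<Rightarrow> bool" where
  "polyhedral_lift_E G \<phi> \<gamma> p q \<longleftrightarrow>
     polyhedral G \<phi> \<gamma> q \<and> (\<forall>i\<in>pverts G. pr_perp (q i) = p i)"

definition polyhedral_lift_S ::
    "'a pair_pre_digraph \<Rightarrow> ('a \<Rightarrow> real^3) \<Rightarrow> ('a \<Rightarrow> 'a \<Rightarrow> real \<Rightarrow> real^3) \<Rightarrow>
     ('a \<Rightarrow> real^3) \<Rightarrow> ('a \<Rightarrow> real^3) \<Rightarrow> bool" where
  "polyhedral_lift_S G \<phi> \<gamma> p q \<longleftrightarrow>
     polyhedral G \<phi> \<gamma> q \<and> (\<forall>i\<in>pverts G. \<exists>a. a \<noteq> 0 \<and> q i = a *\<^sub>R p i)"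

definition polyhedral_lift_H ::
    "'a pair_pre_digraph \<Rightarrow> ('a \<Rightarrow> real^3) \<Rightarrow> ('a \<Rightarrow> 'a \<Rightarrow> real \<Rightarrow> real^3) \<Rightarrow>
     ('a \<Rightarrow> real^3) \<Rightarrow> ('a \<Rightarrow> real^3) \<Rightarrow> bool" where
  "polyhedral_lift_H G \<phi> \<gamma> p q \<longleftrightarrow>
     polyhedral G \<phi> \<gamma> q \<and> (\<forall>i\<in>pverts G. \<exists>a. a > 0 \<and> q i = a *\<^sub>R p i) \<and>
     (\<forall>\<alpha>\<in>faces G \<phi> \<gamma>. space_like (face_plane G \<phi> q \<alpha>))"

end

theory Submission
  imports Defs "HOL-Complex_Analysis.Winding_Numbers"
begin

text \<open>
  All three planes are treated projectively. A vertex \<open>i\<close> is represented by a vector \<open>P i\<close> of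
  \<open>real^3\<close>: by its homogeneous coordinates \<open>(p i, 1)\<close> in the Euclidean case, by \<open>p i\<close> itself on the
  sphere and in the hyperbolic plane. Each of the three conditions of the theorem is equivalent
  to the existence of covectors of the faces: vectors \<open>M \<alpha>\<close> such that for the two faces
  \<open>\<alpha>\<close>, \<open>\<beta>\<close> at an edge \<open>ij\<close> the difference \<open>M \<alpha> - M \<beta>\<close> is nonzero and orthogonal to
  \<open>P i\<close> and \<open>P j\<close>, hence a nonzero multiple of \<open>P i \<times> P j\<close>.

  \<^item> Stresses. Multiplied by a factor that depends on the length of the edges, and crossed with
    \<open>P i\<close>, a self-stress becomes a system of weights with \<open>\<Sum> j. w i j * (P i \<times> P j) = 0\<close> at
    every vertex. These are the differences of covectors across the edges
    (\<open>equilibrium_iff_covectors\<close>).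
  \<^item> Lifts. The number \<open>M \<alpha> \<bullet> P i\<close> is the same for all faces \<open>\<alpha>\<close> at \<open>i\<close>
    (\<open>covectors_heights\<close>). In the Euclidean case it is the height of the lifted vertex, otherwise
    its reciprocal is, up to sign, the factor by which \<open>p i\<close> is stretched, and \<open>M \<alpha>\<close> is the plane of the
    face \<open>\<alpha>\<close>.
  \<^item> Reciprocal diagrams. The point \<open>m \<alpha>\<close> consists of the first two coordinates of \<open>M \<alpha>\<close>,
    or it is the normalized vector whose scalar product with \<open>x\<close> is proportional to
    \<open>M \<alpha> \<bullet> x\<close>. Conversely, in the curved cases \<open>m \<alpha>\<close> determines \<open>M \<alpha>\<close> up to a factor, and
    perpendicularity of \<open>m \<alpha> m \<beta>\<close> to \<open>p i p j\<close> says that the factors of \<open>\<alpha>\<close> and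
    \<open>\<beta>\<close> can be matched along the edge \<open>ij\<close> (\<open>covectors_of_directions\<close>).

  What connects these is that the sphere has no first cohomology. An antisymmetric function on the
  oriented edges whose sum (or product) at every vertex is trivial consists of the differences of a
  function on the faces, and every function on the faces has differences of trivial sum at every
  vertex; moreover the faces at a vertex are linked by crossing the edges at it. The locale
  \<open>face_structure\<close> collects these facts.

  The edges are arbitrary arcs, so these facts come from winding numbers instead of
  cyclic orders of edges. Every edge lies on a cycle, hence on a Jordan curve, and by
  Janiszewski's theorem the edge has exactly two sides. As a function on the complement of the
  drawing, the winding number of the edge jumps by one between these sides, which distinguishes
  left from right (\<open>ex_arc_sides\<close>). A combination of winding numbers of the edges changes
  within a face only through the end points of the edges, so that, for coefficients balanced at
  every vertex, it is constant on faces (\<open>exactness\<close>). Conversely, differences across the edges at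
  a vertex \<open>v\<close> that do not cancel would give a continuous logarithm of a power of
  \<open>z - v\<close> on a punctured disc around \<open>v\<close> (\<open>sides_balanced\<close>).
\<close>

hide_const (open) Digraph_Component.connected

section \<open>The two sides of an arc\<close>

lemma continuous_integer_valued_constant:
  fixes F :: "'a::topological_space \<Rightarrow> complex"
  assumes "connected S" "continuous_on S F" "\<And>x. x \<in> S \<Longrightarrow> F x \<in> \<int>"
  shows "F constant_on S"
proof (rule continuous_discrete_range_constant[OF assms(1,2)])
  fix x assume "x \<in> S"
  have "1 \<le> norm (F y - F x)" if "y \<in> S" "F y \<noteq> F x" for y
  proof -
    have "F x \<in> \<int>" "F y \<in> \<int>" using assms(3) that(1) \<open>x \<in> S\<close> by auto
    then obtain m n :: int where "F x = of_int m" "F y = of_int n"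
      by (meson Ints_cases)
    then show ?thesis
      using that(2) by (simp flip: of_int_diff)
  qed
  then show "\<exists>e>0. \<forall>y. y \<in> S \<and> F y \<noteq> F x \<longrightarrow> e \<le> norm (F y - F x)"
    by (intro exI[of _ 1]) auto
qed

lemma arc_midpoint:
  assumes "arc g"
  shows "g (1/2) \<in> path_image g - {pathstart g, pathfinish g}"
proof -
  have "inj_on g {0..1}" using assms by (simp add: arc_def)
  then have "g (1/2) \<noteq> g 0" "g (1/2) \<noteq> g 1" by (auto dest: inj_onD)
  then show ?thesis by (auto simp: path_image_def pathstart_def pathfinish_def)
qed

text \<open>
  The arc \<open>g\<close> separates the component of \<open>- K\<close> in which its inner points lie into \<open>A\<close>, on
  the left of \<open>g\<close>, and \<open>B\<close>, on its right. The function \<open>c\<close> is the part of the winding number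
  of \<open>g\<close> that is continuous across the arc; the remaining part is the indicator function of \<open>A\<close>.
  Inside the neighbourhood \<open>U\<close> of the open arc there is nothing but \<open>A\<close>, \<open>B\<close> and the arc.
\<close>

definition arc_sides ::
    "complex set \<Rightarrow> (real \<Rightarrow> complex) \<Rightarrow> complex set \<Rightarrow> complex set \<Rightarrow> complex set \<Rightarrow> (complex \<Rightarrow> complex) \<Rightarrow> bool" where
  "arc_sides K g A B U c \<longleftrightarrow>
     A \<in> components (- (K \<union> path_image g)) \<and> B \<in> components (- (K \<union> path_image g)) \<and> A \<inter> B = {} \<and>
     path_image g \<subseteq> closure A \<and> path_image g \<subseteq> closure B \<and>
     open U \<and> path_image g - {pathstart g, pathfinish g} \<subseteq> U \<and> U \<inter> K = {} \<and> U - path_image g = A \<union> B \<and>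
     continuous_on U c \<and> (\<forall>z\<in>A. winding_number g z = c z + 1) \<and> (\<forall>z\<in>B. winding_number g z = c z)"

lemma arc_sides_reversepath:
  assumes "path g" "arc_sides K g A B U c"
  shows "arc_sides K (reversepath g) B A U (\<lambda>z. - c z - 1)"
proof -
  have "winding_number (reversepath g) z = - winding_number g z" if "z \<in> A \<union> B" for z
    using assms that unfolding arc_sides_def by (intro winding_number_reversepath) blast+
  moreover have "continuous_on U (\<lambda>z. - c z - 1)"
    using assms(2) unfolding arc_sides_def by (intro continuous_intros) auto
  ultimately show ?thesis
    using assms(2) unfolding arc_sides_def by (simp add: Int_commute Un_commute insert_commute)
qed

text \<open>
  An arc \<open>r\<close> in \<open>K\<close> closes \<open>g\<close> to a Jordan curve \<open>C\<close>. The sides of \<open>g\<close> are the parts of the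
  inside and of the outside of \<open>C\<close> in the component \<open>U\<close> of \<open>- K\<close> that contains the open arc.
  Points of \<open>U\<close> that are not separated by \<open>C\<close> are not separated by \<open>K \<union> C\<close> either: this is
  Janiszewski's theorem, as \<open>C \<inter> K\<close> is the connected set \<open>r\<close>. The winding number of \<open>g\<close> is
  that of \<open>C\<close> minus that of \<open>r\<close>, and the latter is continuous at the inner points of \<open>g\<close>.
\<close>

lemma ex_arc_sides:
  fixes K :: "complex set" and g :: "real \<Rightarrow> complex"
  assumes "compact K" "arc g" and gK: "path_image g \<inter> K = {pathstart g, pathfinish g}"
    and joined: "path_component K (pathfinish g) (pathstart g)"
  shows "\<exists>A B U c. arc_sides K g A B U c"
proof -
  let ?a = "pathstart g" and ?b = "pathfinish g"
  let ?e = "path_image g - {?a, ?b}"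
  have ab: "?a \<noteq> ?b" and pg: "path g"
    using \<open>arc g\<close> by (metis arc_distinct_ends, simp add: arc_imp_path)
  obtain p where p: "path p" "path_image p \<subseteq> K" "pathstart p = ?b" "pathfinish p = ?a"
    using joined unfolding path_component_def by auto
  obtain r where r: "arc r" "path_image r \<subseteq> path_image p" "pathstart r = ?b" "pathfinish r = ?a"
    using path_contains_arc[OF p(1,3,4)] ab by auto
  have rK: "path_image r \<subseteq> K" and pr: "path r" using r p arc_imp_path by auto
  let ?C = "g +++ r"
  have sC: "simple_path ?C"
    by (rule simple_path_join_loop) (use assms r rK gK in auto)
  have cC: "pathfinish ?C = pathstart ?C" using r by simp
  have iC: "path_image ?C = path_image g \<union> path_image r"
    using r by (simp add: path_image_join)
  note J = Jordan_inside_outside[OF sC cC]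
  let ?I = "inside (path_image ?C)" and ?O = "outside (path_image ?C)"
  let ?D = "K \<union> path_image g"
  have "?e = g ` {0<..<1}"
  proof -
    have "inj_on g {0..1}" using \<open>arc g\<close> by (simp add: arc_def)
    have "{0..1} - {0,1} = {0<..<1::real}" by auto
    then have "g ` {0<..<1} = g ` {0..1} - g ` {0,1}"
      using inj_on_image_set_diff[OF \<open>inj_on g {0..1}\<close>, of "{0..1}" "{0,1}"] by auto
    then show ?thesis by (auto simp: path_image_def pathstart_def pathfinish_def)
  qed
  moreover have "continuous_on {0<..<1} g"
    using pg unfolding path_def by (rule continuous_on_subset) auto
  ultimately have cone: "connected ?e" and "?e \<noteq> {}"
    by (auto intro!: connected_continuous_image)
  then obtain x0 where x0: "x0 \<in> ?e" by blast
  have gcl: "path_image g = closure ?e"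
  proof -
    have 1: "?e = g ` {0<..<1}" by fact
    have "g ` closure {0<..<1} \<subseteq> closure (g ` {0<..<1})"
      by (rule image_closure_subset) (use pg in \<open>auto simp: path_def closure_subset\<close>)
    moreover have "closure ?e \<subseteq> path_image g"
      by (rule closure_minimal) (use pg in \<open>auto simp: closed_path_image\<close>)
    ultimately show ?thesis unfolding 1 by (auto simp: path_image_def)
  qed
  define U where "U = connected_component_set (- K) x0"
  have opU: "open U"
    unfolding U_def using \<open>compact K\<close> by (intro open_connected_component) (simp add: compact_imp_closed open_Compl)
  have eK: "?e \<subseteq> - K" using gK by blast
  have eU: "?e \<subseteq> U"
    unfolding U_def by (rule connected_component_maximal) (use x0 cone eK in auto)
  have UK: "U \<inter> K = {}" unfolding U_def using connected_component_subset by blast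
  have sep: "connected_component (- ?D) y z"
    if "y \<in> U" "z \<in> U" "connected_component (- path_image ?C) y z" for y z
  proof -
    have "connected_component (- (path_image ?C \<union> K)) y z"
    proof (rule Janiszewski)
      show "compact (path_image ?C)" using sC by (simp add: compact_simple_path_image)
      show "closed K" using \<open>compact K\<close> by (simp add: compact_imp_closed)
      have "path_image g \<inter> K \<subseteq> path_image r"
        unfolding gK using pathstart_in_path_image[of r] pathfinish_in_path_image[of r] r by simp
      then have "path_image ?C \<inter> K = path_image r"
        using iC rK by blast
      then show "connected (path_image ?C \<inter> K)"
        using pr by (simp add: connected_path_image)
      show "connected_component (- K) y z"
        using that(1,2) unfolding U_def
        by (metis connected_component_eq connected_component_idemp mem_Collect_eq connected_component_eq_eq connected_component_in)
    qed (use that in auto)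
    moreover have "path_image ?C \<union> K = ?D" using iC rK by auto
    ultimately show ?thesis by simp
  qed
  have side: "S \<inter> U \<in> components (- ?D) \<and> path_image g \<subseteq> closure (S \<inter> U)"
    if S: "S = ?I \<or> S = ?O" for S
  proof -
    have oS: "open S" "connected S" "S \<noteq> {}" "frontier S = path_image ?C" "S \<inter> path_image ?C = {}"
      using J S inside_no_overlap[of "path_image ?C"] outside_no_overlap[of "path_image ?C"] by blast+
    have Sc: "connected_component (- path_image ?C) y z" if "y \<in> S" "z \<in> S" for y z
      unfolding connected_component_def using oS that by (intro exI[of _ S]) auto
    have cl: "?e \<subseteq> closure (S \<inter> U)"
    proof -
      have "?e \<subseteq> closure S" using oS(4) iC by (auto simp: frontier_def)
      then have "?e \<subseteq> U \<inter> closure S" using eU by auto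
      also have "\<dots> \<subseteq> closure (U \<inter> S)" using open_Int_closure_subset[OF opU] by blast
      finally show ?thesis by (simp add: Int_commute)
    qed
    then have gcl': "path_image g \<subseteq> closure (S \<inter> U)"
      using gcl closure_minimal by (metis closed_closure)
    have "S \<inter> U \<noteq> {}" using cl x0 by auto
    then obtain y where y: "y \<in> S" "y \<in> U" by blast
    have yD: "y \<in> - ?D" using y oS iC UK by auto
    have "S \<inter> U = connected_component_set (- ?D) y"
    proof
      show "S \<inter> U \<subseteq> connected_component_set (- ?D) y"
        using sep Sc y by blast
      show "connected_component_set (- ?D) y \<subseteq> S \<inter> U"
      proof
        fix z assume "z \<in> connected_component_set (- ?D) y"
        then have z: "connected_component (- ?D) y z" by simp
        have "connected_component (- K) y z" using z by (rule connected_component_of_subset) auto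
        then have "z \<in> U" using y(2) unfolding U_def
          by (metis connected_component_trans mem_Collect_eq)
        have "connected_component (- path_image ?C) y z"
          using z by (rule connected_component_of_subset) (use iC rK in auto)
        then obtain T where T: "connected T" "T \<subseteq> - path_image ?C" "y \<in> T" "z \<in> T"
          unfolding connected_component_def by auto
        have "T \<inter> frontier S = {}" using T oS by auto
        then have "z \<in> S" using connected_Int_frontier[OF T(1), of S] T y by blast
        then show "z \<in> S \<inter> U" using \<open>z \<in> U\<close> by blast
      qed
    qed
    then have "S \<inter> U \<in> components (- ?D)" using yD by (auto simp: components_def)
    then show ?thesis using gcl' by blast
  qed
  have IO: "?I \<union> ?O = - (path_image g \<union> path_image r)"
    using J unfolding iC by blast
  have "(?I \<inter> U) \<union> (?O \<inter> U) = (?I \<union> ?O) \<inter> U" by blast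
  also have "\<dots> = U - path_image g" unfolding IO using UK rK by blast
  finally have un: "(?I \<inter> U) \<union> (?O \<inter> U) = U - path_image g" "(?O \<inter> U) \<union> (?I \<inter> U) = U - path_image g"
    by (simp_all add: Un_commute)
  have dj: "(?I \<inter> U) \<inter> (?O \<inter> U) = {}" "(?O \<inter> U) \<inter> (?I \<inter> U) = {}"
    using inside_Int_outside[of "path_image ?C"] by blast+
  have contr: "continuous_on U (winding_number r)"
    by (rule continuous_on_subset[OF continuous_on_winding_number[OF pr]]) (use UK rK in auto)
  have wC: "winding_number g z = winding_number ?C z - winding_number r z" if "z \<in> U - path_image g" for z
    using winding_number_join[OF pg _ pr, of z] r that UK rK by fastforce
  have wO: "winding_number ?C z = 0" if "z \<in> ?O" for z
    by (rule winding_number_zero_in_outside[OF simple_path_imp_path[OF sC] cC that])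
  have wn: "\<exists>A B U c. arc_sides K g A B U c"
    if ST: "S = ?I \<and> T = ?O \<or> S = ?O \<and> T = ?I"
      and k: "\<And>z. z \<in> S \<Longrightarrow> winding_number ?C z = k + 1" "\<And>z. z \<in> T \<Longrightarrow> winding_number ?C z = k" for S T k
  proof -
    have split: "(S \<inter> U) \<union> (T \<inter> U) = U - path_image g" "(S \<inter> U) \<inter> (T \<inter> U) = {}"
      using ST un dj by auto
    have S: "S \<inter> U \<in> components (- ?D)" "path_image g \<subseteq> closure (S \<inter> U)"
      and T: "T \<inter> U \<in> components (- ?D)" "path_image g \<subseteq> closure (T \<inter> U)"
      using side[of S] side[of T] ST by blast+
    have "\<forall>z\<in>S \<inter> U. winding_number g z = k - winding_number r z + 1"
      "\<forall>z\<in>T \<inter> U. winding_number g z = k - winding_number r z"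
    proof -
      have "S \<inter> U \<subseteq> U - path_image g" "T \<inter> U \<subseteq> U - path_image g" using split(1) by blast+
      then have "winding_number g z = winding_number ?C z - winding_number r z" if "z \<in> S \<inter> U \<union> T \<inter> U" for z
        using wC that by blast
      then show "\<forall>z\<in>S \<inter> U. winding_number g z = k - winding_number r z + 1"
        "\<forall>z\<in>T \<inter> U. winding_number g z = k - winding_number r z" using k by auto
    qed
    moreover have "continuous_on U (\<lambda>z. k - winding_number r z)" by (intro continuous_intros contr)
    ultimately have "arc_sides K g (S \<inter> U) (T \<inter> U) U (\<lambda>z. k - winding_number r z)"
      unfolding arc_sides_def using opU eU UK split S T by simp
    then show ?thesis by blast
  qed
  show ?thesis
  proof (rule simple_closed_path_winding_number_inside[OF sC])
    assume w: "\<And>z. z \<in> ?I \<Longrightarrow> winding_number ?C z = 1"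
    show ?thesis by (rule wn[of ?I ?O 0]) (use w wO in auto)
  next
    assume w: "\<And>z. z \<in> ?I \<Longrightarrow> winding_number ?C z = -1"
    show ?thesis by (rule wn[of ?O ?I "- 1"]) (use w wO in auto)
  qed
qed

text \<open>
  Both sides are continuous in \<open>w\<close>, vanish for \<open>w = z\<close>, and have the same exponential. While \<open>z\<close>
  moves without meeting \<open>g\<close>, the winding number thus changes by an amount that only depends on
  the end points of \<open>g\<close>.
\<close>

lemma winding_number_local_change:
  assumes "path g" and disj: "ball z r \<inter> path_image g = {}" and w: "w \<in> ball z r"
  shows "2 * pi * \<i> * (winding_number g w - winding_number g z) =
    Ln ((pathfinish g - w) / (pathfinish g - z)) - Ln ((pathstart g - w) / (pathstart g - z))"
proof -
  let ?a = "pathstart g" and ?b = "pathfinish g"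
  have r: "0 < r" using w by (metis ball_empty empty_iff not_le)
  have nz: "z \<notin> path_image g" using disj r by (metis centre_in_ball disjoint_iff)
  have ab: "?a \<in> path_image g" "?b \<in> path_image g" by auto
  \<comment> \<open>the quotients stay in the right half plane, where the logarithm is continuous\<close>
  have half: "0 < Re ((v - u) / (v - z)) \<and> v - u \<noteq> 0 \<and> v - z \<noteq> 0"
    if "v \<in> path_image g" "u \<in> ball z r" for v u
  proof -
    have "v \<notin> ball z r" using disj that by auto
    then have "norm (u - z) < norm (v - z)" using that by (simp add: dist_norm norm_minus_commute)
    then have "norm ((u - z) / (v - z)) < 1" "v - z \<noteq> 0"
      using le_less_trans[OF norm_ge_zero] by (fastforce simp: norm_divide divide_less_eq_1)+
    moreover have "(v - u) / (v - z) = 1 - (u - z) / (v - z)" using \<open>v - z \<noteq> 0\<close> by (simp add: field_simps)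
    moreover have "Re ((u - z) / (v - z)) \<le> norm ((u - z) / (v - z))" by (rule complex_Re_le_cmod)
    ultimately show ?thesis using that disj by auto
  qed
  define F where "F u = winding_number g u - winding_number g z -
     (Ln ((?b - u) / (?b - z)) - Ln ((?a - u) / (?a - z))) / (2 * pi * \<i>)" for u
  have cF: "continuous_on (ball z r) F"
    unfolding F_def
  proof (intro continuous_intros)
    show "continuous_on (ball z r) (winding_number g)"
      by (rule continuous_on_subset[OF continuous_on_winding_number[OF assms(1)]]) (use disj in auto)
  qed (use half ab in \<open>force simp: complex_nonpos_Reals_iff\<close>)+
  have "F u \<in> \<int>" if u: "u \<in> ball z r" for u
  proof -
    have un: "u \<notin> path_image g" using disj u by auto
    have h: "?b - u \<noteq> 0" "?b - z \<noteq> 0" "?a - u \<noteq> 0" "?a - z \<noteq> 0" using half ab u by auto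
    have "2 * pi * \<i> * F u = 2 * pi * \<i> * winding_number g u - 2 * pi * \<i> * winding_number g z
        - (Ln ((?b - u) / (?b - z)) - Ln ((?a - u) / (?a - z)))"
      by (simp add: F_def field_simps)
    then have "exp (2 * pi * \<i> * F u) = exp (2 * pi * \<i> * winding_number g u) / exp (2 * pi * \<i> * winding_number g z)
        / (((?b - u) / (?b - z)) / ((?a - u) / (?a - z)))"
      using h by (simp add: exp_diff)
    also have "exp (2 * pi * \<i> * winding_number g u) = (?b - u) / (?a - u)"
      using winding_number_exp_2pi[OF assms(1) un] h by (simp add: field_simps)
    also have "exp (2 * pi * \<i> * winding_number g z) = (?b - z) / (?a - z)"
      using winding_number_exp_2pi[OF assms(1) nz] h by (simp add: field_simps)
    also have "(?b - u) / (?a - u) / ((?b - z) / (?a - z)) / (((?b - u) / (?b - z)) / ((?a - u) / (?a - z))) = 1"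
      using h by (simp del: right_minus_eq eq_iff_diff_eq_0)
    finally have "exp (2 * pi * \<i> * F u) = 1" .
    then obtain n :: int where "Re (2 * pi * \<i> * F u) = 0" "Im (2 * pi * \<i> * F u) = of_int (2 * n) * pi"
      unfolding exp_eq_1 by auto
    then have "F u = of_int n" by (simp add: complex_eq_iff)
    then show ?thesis by simp
  qed
  then have "F constant_on ball z r"
    by (intro continuous_integer_valued_constant cF) auto
  then have "F w = F z" using w r unfolding constant_on_def by (metis centre_in_ball)
  also have "\<dots> = 0" using half[OF ab(1), of z] half[OF ab(2), of z] r by (simp add: F_def)
  finally show ?thesis unfolding F_def by (simp add: field_simps)
qed

section \<open>Plane graphs in which every edge lies on a cycle\<close>

text \<open>
  The drawing from which the open edge \<open>ij\<close> is erased. The pair \<open>(j, i)\<close> has to be left out as well,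
  since it is drawn on the same curve.
\<close>

definition drawn_except ::
    "'a set \<Rightarrow> ('a \<times> 'a) set \<Rightarrow> ('a \<Rightarrow> 'b) \<Rightarrow> ('a \<Rightarrow> 'a \<Rightarrow> real \<Rightarrow> 'b) \<Rightarrow> 'a \<Rightarrow> 'a \<Rightarrow> 'b::topological_space set" where
  "drawn_except V E v d i j = v ` V \<union> (\<Union>(k, l)\<in>{(k, l) \<in> E. {k, l} \<noteq> {i, j}}. path_image (d k l))"

text \<open>
  The curve of \<open>(j, i)\<close> is the reversed curve of \<open>(i, j)\<close>, which makes winding numbers
  antisymmetric in \<open>i\<close> and \<open>j\<close>. The assumption \<open>bridgeless\<close> says that every edge lies on a
  cycle.
\<close>

locale plane_graph =
  fixes V :: "'a set" and E :: "('a \<times> 'a) set"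
    and v :: "'a \<Rightarrow> complex" and d :: "'a \<Rightarrow> 'a \<Rightarrow> real \<Rightarrow> complex"
  assumes finite_V: "finite V"
    and E_subset: "E \<subseteq> V \<times> V"
    and E_irrefl: "(i, i) \<notin> E"
    and E_sym: "(i, j) \<in> E \<Longrightarrow> (j, i) \<in> E"
    and inj_v: "inj_on v V"
    and arc_d: "(i, j) \<in> E \<Longrightarrow> arc (d i j)"
    and start_d: "(i, j) \<in> E \<Longrightarrow> pathstart (d i j) = v i"
    and finish_d: "(i, j) \<in> E \<Longrightarrow> pathfinish (d i j) = v j"
    and rev_d: "(i, j) \<in> E \<Longrightarrow> d j i = reversepath (d i j)"
    and d_meets_v: "(i, j) \<in> E \<Longrightarrow> path_image (d i j) \<inter> v ` V = {v i, v j}"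
    and d_meets_d: "(i, j) \<in> E \<Longrightarrow> (k, l) \<in> E \<Longrightarrow> {i, j} \<noteq> {k, l} \<Longrightarrow>
      path_image (d i j) \<inter> path_image (d k l) \<subseteq> v ` V"
    and bridgeless: "(i, j) \<in> E \<Longrightarrow> path_component (drawn_except V E v d i j) (v j) (v i)"
    and has_edge: "i \<in> V \<Longrightarrow> \<exists>j. (i, j) \<in> E"
begin

definition D :: "complex set" where
  "D = v ` V \<union> (\<Union>(k, l)\<in>E. path_image (d k l))"

abbreviation K :: "'a \<Rightarrow> 'a \<Rightarrow> complex set" where
  "K \<equiv> drawn_except V E v d"

lemma finite_E: "finite E"
  using finite_V E_subset by (meson finite_SigmaI finite_subset)

lemma E_V: "(i, j) \<in> E \<Longrightarrow> i \<in> V" "(i, j) \<in> E \<Longrightarrow> j \<in> V"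
  using E_subset by auto

lemma path_d: "(i, j) \<in> E \<Longrightarrow> path (d i j)"
  using arc_d arc_imp_path by blast

lemma image_rev: "(i, j) \<in> E \<Longrightarrow> path_image (d j i) = path_image (d i j)"
  using rev_d by simp

lemma D_split: "(i, j) \<in> E \<Longrightarrow> D = K i j \<union> path_image (d i j)"
  unfolding D_def drawn_except_def using image_rev by (fastforce simp: doubleton_eq_iff)

lemma compact_K: "compact (K i j)"
proof -
  have fin: "finite {(k, l) \<in> E. {k, l} \<noteq> {i, j}}" using finite_E by (rule rev_finite_subset) auto
  have "compact (\<Union>(k, l)\<in>{(k, l) \<in> E. {k, l} \<noteq> {i, j}}. path_image (d k l))"
    by (rule compact_UN[OF fin]) (auto intro!: compact_path_image path_d)
  then show ?thesis unfolding drawn_except_def using finite_V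
    by (intro compact_Un) (auto intro: finite_imp_compact)
qed

lemma compact_D: "compact D"
  unfolding D_def using finite_V finite_E
  by (intro compact_Un compact_UN) (auto intro!: finite_imp_compact compact_path_image path_d)

lemma open_co_D: "open (- D)"
  using compact_D by (simp add: compact_imp_closed open_Compl)

lemma path_image_D: "(i, j) \<in> E \<Longrightarrow> path_image (d i j) \<subseteq> D"
  unfolding D_def by auto

lemma d_meets_K: "(i, j) \<in> E \<Longrightarrow> path_image (d i j) \<inter> K i j = {v i, v j}"
  unfolding drawn_except_def using d_meets_v[of i j] d_meets_d[of i j] by fastforce

text \<open>
  The sides are chosen for one orientation of each edge and swapped for the other one.
\<close>

lemma ex_sides:
  obtains L W c where "\<And>i j. (i, j) \<in> E \<Longrightarrow> arc_sides (K i j) (d i j) (L i j) (L j i) (W i j) (c i j)"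
proof -
  obtain f :: "'a \<Rightarrow> nat" where f: "inj_on f V" using finite_imp_inj_to_nat_seg[OF finite_V] by blast
  have "\<exists>S. case S of (A, B, U, c) \<Rightarrow> arc_sides (K i j) (d i j) A B U c" if ij: "(i, j) \<in> E" for i j
  proof -
    have "\<exists>A B U c. arc_sides (K i j) (d i j) A B U c"
      by (rule ex_arc_sides[OF compact_K arc_d[OF ij]])
        (use d_meets_K[OF ij] start_d[OF ij] finish_d[OF ij] bridgeless[OF ij] in simp_all)
    then show ?thesis by auto
  qed
  then obtain S where S: "\<And>i j. (i, j) \<in> E \<Longrightarrow> case S i j of (A, B, U, c) \<Rightarrow> arc_sides (K i j) (d i j) A B U c"
    by metis
  define L where "L i j = (if f i < f j then fst (S i j) else fst (snd (S j i)))" for i j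
  define W where "W i j = (if f i < f j then fst (snd (snd (S i j))) else fst (snd (snd (S j i))))" for i j
  define c where "c i j = (if f i < f j then snd (snd (snd (S i j))) else (\<lambda>z. - snd (snd (snd (S j i))) z - 1))" for i j
  have "arc_sides (K i j) (d i j) (L i j) (L j i) (W i j) (c i j)" if ij: "(i, j) \<in> E" for i j
  proof -
    have "f i \<noteq> f j" using f ij E_irrefl E_V by (metis inj_onD)
    moreover have "K j i = K i j" unfolding drawn_except_def by (simp add: insert_commute)
    moreover have "arc_sides (K j i) (reversepath (d j i)) (fst (snd (S j i))) (fst (S j i)) (fst (snd (snd (S j i))))
        (\<lambda>z. - snd (snd (snd (S j i))) z - 1)"
      using arc_sides_reversepath[OF path_d[OF E_sym[OF ij]]] S[OF E_sym[OF ij]] by (auto split: prod.splits)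
    ultimately show ?thesis
      using S[OF ij] rev_d[OF E_sym[OF ij]] by (auto simp: L_def W_def c_def split: prod.splits)
  qed
  then show thesis by (rule that)
qed

lemma open_component: "A \<in> components (- D) \<Longrightarrow> open A"
  using open_components open_co_D by blast

lemma component_subset: "A \<in> components (- D) \<Longrightarrow> A \<subseteq> - D"
  using in_components_subset by blast

lemma component_eq: "A \<in> components (- D) \<Longrightarrow> z \<in> A \<Longrightarrow> connected_component_set (- D) z = A"
  by (metis (no_types, lifting) componentsE connected_component_eq)

lemma component_of: "z \<notin> D \<Longrightarrow> connected_component_set (- D) z \<in> components (- D) \<and> z \<in> connected_component_set (- D) z"
  by (simp add: componentsI connected_component_refl)

lemma components_meet: "A \<in> components (- D) \<Longrightarrow> B \<in> components (- D) \<Longrightarrow> z \<in> A \<Longrightarrow> z \<in> B \<Longrightarrow> A = B"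
  using component_eq by metis

lemma continuous_on_componentwise:
  assumes "\<And>A. A \<in> components (- D) \<Longrightarrow> f constant_on A"
  shows "continuous_on (- D) (\<lambda>z. f z :: complex)"
proof (rule continuous_at_imp_continuous_on, rule ballI)
  fix z assume "z \<in> - D"
  then have z: "connected_component_set (- D) z \<in> components (- D)" "z \<in> connected_component_set (- D) z"
    using component_of by auto
  obtain y where "\<And>x. x \<in> connected_component_set (- D) z \<Longrightarrow> f x = y"
    using assms[OF z(1)] unfolding constant_on_def by auto
  then have "continuous_on (connected_component_set (- D) z) f"
    by (intro continuous_on_eq[OF continuous_on_const[of _ y]]) auto
  then show "isCont f z" using continuous_on_eq_continuous_at[OF open_component[OF z(1)], of f] z(2) by blast
qed

end

text \<open>
  \<open>L i j\<close> is the face to the left of the edge from \<open>i\<close> to \<open>j\<close>, hence \<open>L j i\<close> is the face to its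
  right.
\<close>

locale sided_plane_graph = plane_graph +
  fixes L W :: "'a \<Rightarrow> 'a \<Rightarrow> complex set" and c :: "'a \<Rightarrow> 'a \<Rightarrow> complex \<Rightarrow> complex"
  assumes sides: "(i, j) \<in> E \<Longrightarrow> arc_sides (K i j) (d i j) (L i j) (L j i) (W i j) (c i j)"
begin

lemma L_component: "(i, j) \<in> E \<Longrightarrow> L i j \<in> components (- D)"
  using sides[of i j] D_split[of i j] unfolding arc_sides_def by simp

lemma L_closure: "(i, j) \<in> E \<Longrightarrow> path_image (d i j) \<subseteq> closure (L i j)"
  using sides unfolding arc_sides_def by blast

lemma L_neq:
  assumes "(i, j) \<in> E"
  shows "L i j \<noteq> L j i"
proof -
  have "L i j \<inter> L j i = {}" using sides[OF assms] unfolding arc_sides_def by blast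
  then show ?thesis using in_components_nonempty[OF L_component[OF assms]] by auto
qed

lemma side_nbhd:
  assumes "(i, j) \<in> E"
  shows "open (W i j)" "path_image (d i j) - {v i, v j} \<subseteq> W i j" "W i j \<inter> K i j = {}" "W i j - D = L i j \<union> L j i"
    "continuous_on (W i j) (c i j)"
  using sides[OF assms] D_split[OF assms] start_d[OF assms] finish_d[OF assms] unfolding arc_sides_def by blast+

lemma winding_number_sides:
  assumes "(i, j) \<in> E"
  shows "z \<in> L i j \<Longrightarrow> winding_number (d i j) z = c i j z + 1" "z \<in> L j i \<Longrightarrow> winding_number (d i j) z = c i j z"
  using sides[OF assms] unfolding arc_sides_def by blast+

lemma component_at_open_edge:
  assumes "(i, j) \<in> E" "A \<in> components (- D)" "x \<in> path_image (d i j) - {v i, v j}" "x \<in> closure A"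
  shows "A = L i j \<or> A = L j i"
proof -
  have "x \<in> W i j" using side_nbhd(2)[OF assms(1)] assms(3) by blast
  then obtain z where z: "z \<in> W i j" "z \<in> A"
    using assms(4) open_Int_closure_eq_empty[OF side_nbhd(1)[OF assms(1)], of A] by blast
  then have "z \<in> L i j \<union> L j i" using side_nbhd(4)[OF assms(1)] component_subset[OF assms(2)] by blast
  then show ?thesis using components_meet[OF assms(2)] L_component assms(1) E_sym z by blast
qed

text \<open>
  Arguments about a vertex are local: near \<open>v i\<close> the drawing consists of the edges at \<open>i\<close> only. A
  function on the complement of the drawing that is continued by \<open>g j\<close> across the edge \<open>ij\<close>, for
  every \<open>j\<close>, is therefore continuous on a punctured disc around \<open>v i\<close>.
\<close>

lemma extend_near_vertex:
  assumes i: "i \<in> V" and e0: "0 < e0" and f: "continuous_on (- D) f"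
    and g: "\<And>j. (i, j) \<in> E \<Longrightarrow> continuous_on (W i j) (g j)"
    and fg: "\<And>j z. (i, j) \<in> E \<Longrightarrow> z \<in> L i j \<union> L j i \<Longrightarrow> f z = g j z"
  obtains e F where "0 < e" "e < e0" "continuous_on (ball (v i) e - {v i}) F"
    "\<And>z. z \<in> ball (v i) e - D \<Longrightarrow> F z = (f z :: complex)"
    "\<And>z. z \<in> ball (v i) e - {v i} \<Longrightarrow> z \<in> D \<Longrightarrow>
       \<exists>j. (i, j) \<in> E \<and> z \<in> path_image (d i j) - {v i, v j} \<and> F z = g j z"
proof -
  define R where "R = v ` (V - {i}) \<union> (\<Union>(k, l)\<in>{(k, l) \<in> E. k \<noteq> i \<and> l \<noteq> i}. path_image (d k l))"
  have fin: "finite {(k, l) \<in> E. k \<noteq> i \<and> l \<noteq> i}" using finite_E by (rule rev_finite_subset) auto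
  have "compact (\<Union>(k, l)\<in>{(k, l) \<in> E. k \<noteq> i \<and> l \<noteq> i}. path_image (d k l))"
    by (rule compact_UN[OF fin]) (auto intro!: compact_path_image path_d)
  then have "compact R" unfolding R_def using finite_V
    by (intro compact_Un) (auto intro: finite_imp_compact)
  have "v i \<notin> path_image (d k l)" if "(k, l) \<in> E" "k \<noteq> i" "l \<noteq> i" for k l
  proof
    assume "v i \<in> path_image (d k l)"
    then have "v i \<in> {v k, v l}" using d_meets_v[OF that(1)] i by blast
    then show False using that inj_onD[OF inj_v] i E_V by blast
  qed
  moreover have "v i \<notin> v ` (V - {i})" using i inj_v by (auto dest: inj_onD)
  ultimately have "v i \<notin> R" unfolding R_def by blast
  then obtain e1 where e1: "0 < e1" "ball (v i) e1 \<subseteq> - R"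
    using \<open>compact R\<close> by (meson ComplI compact_imp_closed open_Compl open_contains_ball)
  define e where "e = min e1 (e0 / 2)"
  have e: "0 < e" "e < e0" and eR: "ball (v i) e \<subseteq> - R" using e1 e0 by (auto simp: e_def)
  let ?S = "ball (v i) e - {v i}"
  \<comment> \<open>the edge on which a point of the punctured disc lies\<close>
  define idx where "idx z = (SOME j. (i, j) \<in> E \<and> z \<in> path_image (d i j))" for z
  define F where "F z = (if z \<in> D then g (idx z) z else f z)" for z
  have onD: "\<exists>j. (i, j) \<in> E \<and> z \<in> path_image (d i j) - {v i, v j}" if z: "z \<in> ?S" "z \<in> D" for z
  proof -
    have "z \<notin> R" using z eR by auto
    then have nv: "z \<notin> v ` V" using z by (auto simp: R_def)
    then obtain k l where kl: "(k, l) \<in> E" "z \<in> path_image (d k l)" using z(2) unfolding D_def by auto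
    then have "k = i \<or> l = i" using \<open>z \<notin> R\<close> by (auto simp: R_def)
    then obtain j where "(i, j) \<in> E" "z \<in> path_image (d i j)" using kl E_sym image_rev by metis
    then show ?thesis using nv E_V by blast
  qed
  have idx: "idx z = j" if "(i, j) \<in> E" "z \<in> path_image (d i j) - {v i, v j}" for z j
  proof -
    have "(i, idx z) \<in> E \<and> z \<in> path_image (d i (idx z))"
      unfolding idx_def by (rule someI[of _ j]) (use that in auto)
    moreover have "z \<notin> v ` V" using that d_meets_v by blast
    ultimately have "{i, j} = {i, idx z}" using d_meets_d[OF that(1), of i "idx z"] that(2) by blast
    then show ?thesis by (metis doubleton_eq_iff)
  qed
  have "isCont F z0" if z0: "z0 \<in> ?S" for z0
  proof (cases "z0 \<in> D")
    case False
    have "continuous_on (- D) F" by (rule continuous_on_eq[OF f]) (simp add: F_def)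
    then show ?thesis using continuous_on_eq_continuous_at[OF open_co_D] False by blast
  next
    case True
    then obtain j where j: "(i, j) \<in> E" "z0 \<in> path_image (d i j) - {v i, v j}" using onD z0 by blast
    define T where "T = W i j - K i j"
    have "open T" unfolding T_def using side_nbhd(1)[OF j(1)] compact_K by (simp add: open_Diff compact_imp_closed)
    have "z0 \<in> T" using j side_nbhd(2)[OF j(1)] d_meets_K[OF j(1)] unfolding T_def by blast
    have "g j z = F z" if z: "z \<in> T" for z
    proof (cases "z \<in> D")
      case True
      then have zp: "z \<in> path_image (d i j)" using z D_split[OF j(1)] by (auto simp: T_def)
      moreover have "z \<notin> {v i, v j}" using z E_V[OF j(1)] by (auto simp: T_def drawn_except_def)
      ultimately show ?thesis using idx[OF j(1), of z] True by (auto simp: F_def)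
    next
      case False
      then have "z \<in> L i j \<union> L j i" using side_nbhd(4)[OF j(1)] z by (auto simp: T_def)
      then show ?thesis using fg[OF j(1)] False by (simp add: F_def)
    qed
    moreover have "continuous_on T (g j)"
      by (rule continuous_on_subset[OF g[OF j(1)]]) (auto simp: T_def)
    ultimately have "continuous_on T F" using continuous_on_eq by blast
    then show ?thesis using continuous_on_eq_continuous_at[OF \<open>open T\<close>, of F] \<open>z0 \<in> T\<close> by blast
  qed
  then have "continuous_on ?S F" by (simp add: continuous_at_imp_continuous_on)
  then show thesis
    by (rule that[OF e]) (use onD idx in \<open>fastforce simp: F_def\<close>)+
qed

text \<open>
  The indicator function of \<open>P\<close> does not change across the edges at \<open>i\<close>, so it is constant on a
  punctured disc around \<open>v i\<close>, which is connected. This takes the place of the cyclic order of the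
  faces at a vertex.
\<close>

lemma components_at_vertex_linked:
  assumes i: "i \<in> V" and P: "\<And>j. (i, j) \<in> E \<Longrightarrow> L i j \<in> P \<longleftrightarrow> L j i \<in> P"
    and A: "A \<in> components (- D)" "v i \<in> closure A" and B: "B \<in> components (- D)" "v i \<in> closure B"
  shows "A \<in> P \<longleftrightarrow> B \<in> P"
proof -
  define f where "f z = (if connected_component_set (- D) z \<in> P then 1 else 0 :: complex)" for z
  have fA: "f z = (if A \<in> P then 1 else 0)" if "z \<in> A" "A \<in> components (- D)" for z A
    using component_eq[OF that(2,1)] by (simp add: f_def)
  have contf: "continuous_on (- D) f"
    by (rule continuous_on_componentwise) (use fA in \<open>auto simp: constant_on_def\<close>)
  define g :: "'a \<Rightarrow> complex \<Rightarrow> complex" where "g j z = (if L i j \<in> P then 1 else 0)" for j z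
  have contg: "continuous_on (W i j) (g j)" for j by (simp add: g_def)
  have fg: "f z = g j z" if "(i, j) \<in> E" "z \<in> L i j \<union> L j i" for j z
    using that fA L_component E_sym P unfolding g_def by (metis Un_iff)
  obtain e F where e: "0 < e" and F: "continuous_on (ball (v i) e - {v i}) F"
    "\<And>z. z \<in> ball (v i) e - D \<Longrightarrow> F z = f z"
    "\<And>z. z \<in> ball (v i) e - {v i} \<Longrightarrow> z \<in> D \<Longrightarrow>
       \<exists>j. (i, j) \<in> E \<and> z \<in> path_image (d i j) - {v i, v j} \<and> F z = g j z"
  proof (rule extend_near_vertex[OF i zero_less_one contf contg fg])
    fix e F assume "0 < e" "e < 1" "continuous_on (ball (v i) e - {v i}) F"
      "\<And>z. z \<in> ball (v i) e - D \<Longrightarrow> F z = f z"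
      "\<And>z. z \<in> ball (v i) e - {v i} \<Longrightarrow> z \<in> D \<Longrightarrow>
         \<exists>j. (i, j) \<in> E \<and> z \<in> path_image (d i j) - {v i, v j} \<and> F z = g j z"
    then show thesis by (intro that)
  qed
  have "F ` (ball (v i) e - {v i}) \<subseteq> {0, 1}"
  proof
    fix y assume "y \<in> F ` (ball (v i) e - {v i})"
    then obtain z where z: "z \<in> ball (v i) e - {v i}" "y = F z" by blast
    show "y \<in> {0, 1}"
    proof (cases "z \<in> D")
      case True then show ?thesis using F(3)[OF z(1)] z(2) by (auto simp: g_def)
    next
      case False then show ?thesis using F(2)[of z] z by (auto simp: f_def)
    qed
  qed
  then have "F constant_on (ball (v i) e - {v i})"
    by (intro continuous_finite_range_constant F(1) connected_punctured_ball) (auto intro: finite_subset)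
  then obtain y where y: "\<And>z. z \<in> ball (v i) e - {v i} \<Longrightarrow> F z = y" unfolding constant_on_def by auto
  have near: "y = (if A' \<in> P then 1 else 0)" if AD: "A' \<in> components (- D)" "v i \<in> closure A'" for A'
  proof -
    obtain z where z: "z \<in> A'" "z \<in> ball (v i) e"
      using AD(2) e by (metis closure_approachable dist_commute mem_ball)
    then have "z \<notin> D" using component_subset[OF AD(1)] by blast
    then have "z \<noteq> v i" using i by (auto simp: D_def)
    then have "F z = y" "F z = f z" using y F(2) z \<open>z \<notin> D\<close> by blast+
    then show ?thesis using fA[OF z(1) AD(1)] by simp
  qed
  show ?thesis using near[OF A] near[OF B] by (auto split: if_splits)
qed

text \<open>
  A boundary point of the face is an inner point of an edge, and the face is one of the sides of
  that edge, or it is a vertex, and then the face is linked with the sides of the edges at it.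
\<close>

lemma component_is_side:
  assumes "A \<in> components (- D)" "V \<noteq> {}"
  shows "\<exists>(i, j)\<in>E. A = L i j"
proof -
  have "A \<noteq> UNIV" using component_subset[OF assms(1)] assms(2) by (auto simp: D_def)
  then have "frontier A \<noteq> {}" using in_components_nonempty[OF assms(1)] by (simp add: frontier_eq_empty)
  then obtain x where x: "x \<in> closure A" "x \<notin> A" using open_component[OF assms(1)] by (auto simp: frontier_def interior_open)
  have "x \<in> D"
  proof (rule ccontr)
    assume "x \<notin> D"
    then have c: "connected_component_set (- D) x \<in> components (- D)" "x \<in> connected_component_set (- D) x"
      using component_of by auto
    then obtain z where "z \<in> connected_component_set (- D) x" "z \<in> A"
      using open_component[OF c(1)] x(1) open_Int_closure_eq_empty[of "connected_component_set (- D) x" A] by blast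
    then show False using components_meet[OF assms(1) c(1)] c(2) x(2) by blast
  qed
  show ?thesis
  proof (cases "x \<in> v ` V")
    case True
    then obtain i where i: "i \<in> V" "x = v i" by auto
    obtain j where j: "(i, j) \<in> E" using has_edge[OF i(1)] by auto
    have vi: "v i \<in> closure (L i j)" using L_closure[OF j] start_d[OF j] pathstart_in_path_image by fastforce
    show ?thesis
    proof (rule ccontr)
      assume n: "\<not> ?thesis"
      then have "A \<in> {A} \<longleftrightarrow> L i j \<in> {A}"
        using components_at_vertex_linked[of i "{A}" A "L i j"] i vi L_component[OF j] assms(1) x E_sym by blast
      then show False using n j by auto
    qed
  next
    case False
    then obtain i j where ij: "(i, j) \<in> E" "x \<in> path_image (d i j)" using \<open>x \<in> D\<close> by (auto simp: D_def)
    then have "x \<in> path_image (d i j) - {v i, v j}" using False E_V by blast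
    then show ?thesis using component_at_open_edge[OF ij(1) assms(1)] x(1) ij(1) E_sym by blast
  qed
qed

end

section \<open>Boundaries of faces are balanced at every vertex\<close>

text \<open>
  While \<open>z\<close> runs around \<open>a\<close>, the number \<open>(a - z) powi n\<close> turns \<open>n\<close> times around zero.
\<close>

lemma no_log_of_power:
  fixes Q :: "complex \<Rightarrow> complex"
  assumes "0 < e" and Q: "continuous_on (ball a e - {a}) Q"
    and eq: "\<And>z. z \<in> ball a e - {a} \<Longrightarrow> exp (Q z) = (a - z) powi n"
  shows "n = 0"
proof -
  define r where "r = e / 2"
  have r: "0 < r" "r < e" using assms(1) by (auto simp: r_def)
  define p where "p t = a + r * exp (2 * pi * \<i> * of_real t)" for t :: real
  have pin: "p t \<in> ball a e - {a}" for t
    using r by (auto simp: p_def dist_norm norm_mult)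
  define H where "H t = (Q (p t) - 2 * pi * \<i> * n * t - Q (p 0)) / (2 * pi * \<i>)" for t :: real
  have "continuous_on {0..1} p" unfolding p_def by (intro continuous_intros)
  then have "continuous_on {0..1} (\<lambda>t. Q (p t))"
    by (rule continuous_on_compose2[OF Q]) (use pin in auto)
  then have cH: "continuous_on {0..1} H" unfolding H_def by (intro continuous_intros) auto
  have ep: "exp (Q (p t)) = (- of_real r) powi n * exp (2 * pi * \<i> * n * t)" for t
  proof -
    have "exp (Q (p t)) = (- of_real r * exp (2 * pi * \<i> * of_real t)) powi n"
      using eq[OF pin] by (simp add: p_def)
    also have "\<dots> = (- of_real r) powi n * exp (2 * pi * \<i> * of_real t) powi n"
      by (rule power_int_mult_distrib)
    also have "exp (2 * pi * \<i> * of_real t) powi n = exp (2 * pi * \<i> * n * t)"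
      by (simp add: exp_power_int mult_ac)
    finally show ?thesis .
  qed
  have "H t \<in> \<int>" for t
  proof -
    have "exp (2 * pi * \<i> * H t) = exp (Q (p t) - 2 * pi * \<i> * n * t - Q (p 0))"
      by (simp add: H_def)
    also have "\<dots> = 1" using r ep[of t] ep[of 0] by (simp add: exp_diff)
    finally obtain k :: int where "Re (2 * pi * \<i> * H t) = 0" "Im (2 * pi * \<i> * H t) = of_int (2 * k) * pi"
      unfolding exp_eq_1 by auto
    then have "H t = of_int k" by (simp add: complex_eq_iff)
    then show ?thesis by simp
  qed
  then have "H constant_on {0..1}"
    by (intro continuous_integer_valued_constant cH) auto
  then have "H 1 = H 0" unfolding constant_on_def by auto
  moreover have "p 1 = p 0" by (simp add: p_def)
  ultimately show "n = 0" by (simp add: H_def)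
qed

context sided_plane_graph
begin

lemma finite_nbrs: "finite {j. (i, j) \<in> E}"
proof -
  have "{j. (i, j) \<in> E} \<subseteq> V" using E_subset by auto
  then show ?thesis using finite_V finite_subset by blast
qed

lemma exp_winding_number_edge:
  assumes "(i, j) \<in> E" "z \<notin> D"
  shows "exp (2 * pi * \<i> * winding_number (d i j) z) = (v j - z) / (v i - z)" "v i - z \<noteq> 0" "v j - z \<noteq> 0"
proof -
  have n: "v i \<noteq> z" "v j \<noteq> z" using assms E_V[OF assms(1)] by (auto simp: D_def)
  then show "v i - z \<noteq> 0" "v j - z \<noteq> 0" by auto
  have "z \<notin> path_image (d i j)" using assms path_image_D by auto
  from winding_number_exp_2pi[OF path_d[OF assms(1)] this]
  show "exp (2 * pi * \<i> * winding_number (d i j) z) = (v j - z) / (v i - z)"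
    using n start_d[OF assms(1)] finish_d[OF assms(1)] by (simp add: field_simps)
qed

lemma continuous_on_winding_number_edge:
  assumes "(i, j) \<in> E" "S \<inter> path_image (d i j) = {}"
  shows "continuous_on S (winding_number (d i j))"
  by (rule continuous_on_subset[OF continuous_on_winding_number[OF path_d[OF assms(1)]]]) (use assms in auto)

text \<open>
  Subtract from the indicator function of \<open>A\<close> the winding numbers of the edges at \<open>i\<close>, each with
  the coefficient \<open>s j\<close> by which the indicator function changes across the \<open>j\<close>th edge. The
  difference does not change across these edges, so it extends continuously to a punctured disc
  around \<open>v i\<close>. Its exponential is the product of the powers \<open>((v i - z) / (v j - z)) powi s j\<close>.
  Since \<open>v j - z\<close> has a continuous logarithm near \<open>v i\<close>, so has \<open>v i - z\<close> to the power \<open>\<Sum> j. s j\<close>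
  on the punctured disc, and this sum vanishes.
\<close>

lemma sides_balanced:
  assumes i: "i \<in> V" and A: "A \<in> components (- D)"
  shows "card {j. (i, j) \<in> E \<and> L i j = A} = card {j. (i, j) \<in> E \<and> L j i = A}"
proof -
  let ?N = "{j. (i, j) \<in> E}"
  define s :: "'a \<Rightarrow> int" where "s j = of_bool (L i j = A) - of_bool (L j i = A)" for j
  define f where "f z = of_bool (z \<in> A) - (\<Sum>j\<in>?N. of_int (s j) * winding_number (d i j) z)" for z
  have inA: "z \<in> A \<longleftrightarrow> B = A" if "z \<in> B" "B \<in> components (- D)" for z B
    using components_meet[OF A that(2) _ that(1)] that by auto
  have "continuous_on (- D) (\<lambda>z. of_bool (z \<in> A) :: complex)"
    by (rule continuous_on_componentwise) (use inA in \<open>auto simp: constant_on_def\<close>)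
  then have contf: "continuous_on (- D) f"
    unfolding f_def using path_image_D
    by (intro continuous_intros continuous_on_winding_number_edge) auto
  define g where "g j z = of_bool (L j i = A) - of_int (s j) * c i j z
      - (\<Sum>k\<in>?N - {j}. of_int (s k) * winding_number (d i k) z)" for j z
  have Wk: "W i j \<inter> path_image (d i k) = {}" if "(i, j) \<in> E" "(i, k) \<in> E" "k \<noteq> j" for j k
  proof -
    have "path_image (d i k) \<subseteq> K i j"
      using that unfolding drawn_except_def by (auto simp: doubleton_eq_iff)
    then show ?thesis using side_nbhd(3) that by blast
  qed
  have contg: "continuous_on (W i j) (g j)" if j: "(i, j) \<in> E" for j
    unfolding g_def using side_nbhd(5)[OF j] Wk[OF j]
    by (intro continuous_intros continuous_on_winding_number_edge) auto
  have fg: "f z = g j z" if j: "(i, j) \<in> E" and z: "z \<in> L i j \<union> L j i" for j z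
  proof -
    have sum: "(\<Sum>k\<in>?N. of_int (s k) * winding_number (d i k) z) = of_int (s j) * winding_number (d i j) z
       + (\<Sum>k\<in>?N - {j}. of_int (s k) * winding_number (d i k) z)"
      using j by (intro sum.remove finite_nbrs) auto
    from z show ?thesis
    proof
      assume zL: "z \<in> L i j"
      then show ?thesis
        using winding_number_sides(1)[OF j zL] inA[OF zL L_component[OF j]]
        unfolding f_def g_def sum by (simp add: s_def algebra_simps)
    next
      assume zL: "z \<in> L j i"
      then show ?thesis
        using winding_number_sides(2)[OF j zL] inA[OF zL L_component[OF E_sym[OF j]]]
        unfolding f_def g_def sum by simp
    qed
  qed
  have "v i \<notin> v ` (V - {i})" using i inj_v by (auto dest: inj_onD)
  moreover have "closed (v ` (V - {i}))" using finite_V by (simp add: finite_imp_closed)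
  ultimately obtain e0 where e0: "0 < e0" "ball (v i) e0 \<subseteq> - v ` (V - {i})"
    by (meson ComplI open_Compl open_contains_ball)
  obtain e F where e: "0 < e" "e < e0" and F: "continuous_on (ball (v i) e - {v i}) F"
    "\<And>z. z \<in> ball (v i) e - D \<Longrightarrow> F z = f z"
    "\<And>z. z \<in> ball (v i) e - {v i} \<Longrightarrow> z \<in> D \<Longrightarrow>
       \<exists>j. (i, j) \<in> E \<and> z \<in> path_image (d i j) - {v i, v j} \<and> F z = g j z"
  proof (rule extend_near_vertex[OF i e0(1) contf contg fg])
    fix e F assume "0 < e" "e < e0" "continuous_on (ball (v i) e - {v i}) F"
      "\<And>z. z \<in> ball (v i) e - D \<Longrightarrow> F z = f z"
      "\<And>z. z \<in> ball (v i) e - {v i} \<Longrightarrow> z \<in> D \<Longrightarrow>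
         \<exists>j. (i, j) \<in> E \<and> z \<in> path_image (d i j) - {v i, v j} \<and> F z = g j z"
    then show thesis by (rule that)
  qed
  let ?S = "ball (v i) e - {v i}"
  have vj: "v j - z \<noteq> 0" if "z \<in> ball (v i) e" "(i, j) \<in> E" for z j
  proof -
    have "z \<in> ball (v i) e0" using that(1) e by auto
    moreover have "v j \<in> v ` (V - {i})" using that(2) E_V E_irrefl by blast
    ultimately show ?thesis using e0(2) by auto
  qed
  have "\<exists>l. continuous_on (ball (v i) e) l \<and> (\<forall>z\<in>ball (v i) e. v j - z = exp (l z))" if j: "(i, j) \<in> E" for j
  proof (rule continuous_logarithm_on_ball[of "v i" e "\<lambda>z. v j - z"])
    show "continuous_on (ball (v i) e) (\<lambda>z. v j - z)" by (intro continuous_intros)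
  qed (use vj j in auto)
  then obtain l where l: "\<And>j. (i, j) \<in> E \<Longrightarrow> continuous_on (ball (v i) e) (l j)"
     "\<And>j z. (i, j) \<in> E \<Longrightarrow> z \<in> ball (v i) e \<Longrightarrow> v j - z = exp (l j z)" by metis
  define Q where "Q z = 2 * pi * \<i> * F z + (\<Sum>j\<in>?N. of_int (s j) * l j z)" for z
  have contQ: "continuous_on ?S Q"
    unfolding Q_def using l(1) by (intro continuous_intros F(1)) (auto intro: continuous_on_subset)
  \<comment> \<open>the indicator function disappears in the exponential, because it is an integer\<close>
  have off: "exp (Q z) * (v i - z) powi - (\<Sum>j\<in>?N. s j) = 1" if z: "z \<in> ball (v i) e - D" for z
  proof -
    have nz: "v i - z \<noteq> 0" using z i by (auto simp: D_def)
    have "exp (2 * pi * \<i> * of_bool (z \<in> A)) = 1" by auto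
    moreover have "2 * pi * \<i> * F z = 2 * pi * \<i> * of_bool (z \<in> A)
        + (\<Sum>j\<in>?N. - of_int (s j) * (2 * pi * \<i> * winding_number (d i j) z))"
      unfolding F(2)[OF z] f_def by (simp add: right_diff_distrib sum_distrib_left sum_negf mult_ac)
    ultimately have "exp (2 * pi * \<i> * F z) = (\<Prod>j\<in>?N. exp (- of_int (s j) * (2 * pi * \<i> * winding_number (d i j) z)))"
      by (simp only: exp_add exp_sum[OF finite_nbrs] mult_1)
    also have "\<dots> = (\<Prod>j\<in>?N. ((v j - z) / (v i - z)) powi - s j)"
    proof (rule prod.cong[OF refl])
      fix j assume "j \<in> ?N"
      then have "exp (2 * pi * \<i> * winding_number (d i j) z) = (v j - z) / (v i - z)"
        using exp_winding_number_edge(1)[of i j z] z by auto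
      then show "exp (- of_int (s j) * (2 * pi * \<i> * winding_number (d i j) z)) = ((v j - z) / (v i - z)) powi - s j"
        using exp_power_int[of "2 * pi * \<i> * winding_number (d i j) z" "- s j"] by simp
    qed
    finally have 1: "exp (2 * pi * \<i> * F z) = (\<Prod>j\<in>?N. ((v j - z) / (v i - z)) powi - s j)" .
    have 2: "exp (\<Sum>j\<in>?N. of_int (s j) * l j z) = (\<Prod>j\<in>?N. (v j - z) powi s j)"
      unfolding exp_sum[OF finite_nbrs]
      by (rule prod.cong[OF refl]) (use l(2) z in \<open>simp add: exp_power_int\<close>)
    have "exp (Q z) = (\<Prod>j\<in>?N. ((v j - z) / (v i - z)) powi - s j * (v j - z) powi s j)"
      unfolding Q_def exp_add 1 2 by (simp add: prod.distrib)
    also have "\<dots> = (\<Prod>j\<in>?N. (v i - z) powi s j)"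
    proof (rule prod.cong[OF refl])
      fix j assume "j \<in> ?N"
      then have "v j - z \<noteq> 0" using vj z by auto
      then show "((v j - z) / (v i - z)) powi - s j * (v j - z) powi s j = (v i - z) powi s j"
        using nz by (simp add: power_int_divide_distrib power_int_minus field_simps del: right_minus_eq)
    qed
    also have "\<dots> = (v i - z) powi (\<Sum>j\<in>?N. s j)"
      using finite_nbrs[of i] nz
      by (induction rule: finite_induct) (auto simp: power_int_add)
    finally show ?thesis using nz by (simp add: power_int_minus field_simps del: right_minus_eq)
  qed
  \<comment> \<open>the identity carries over to the edges, because they lie in the closure of their sides\<close>
  have all: "exp (Q z) * (v i - z) powi - (\<Sum>j\<in>?N. s j) = 1" if z: "z \<in> ?S" for z
  proof -
    let ?G = "\<lambda>z. exp (Q z) * (v i - z) powi - (\<Sum>j\<in>?N. s j)"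
    have "continuous_on ?S ?G" by (intro continuous_intros contQ) auto
    then have "closedin (top_of_set ?S) {z \<in> ?S. ?G z = 1}"
      by (rule continuous_closedin_preimage_constant)
    then obtain C where C: "closed C" "{z \<in> ?S. ?G z = 1} = ?S \<inter> C" by (auto simp: closedin_closed)
    have "z \<in> C"
    proof (cases "z \<in> D")
      case True
      then obtain j where j: "(i, j) \<in> E" "z \<in> path_image (d i j)" using F(3)[OF z] by blast
      have "L i j \<subseteq> - D" by (rule component_subset[OF L_component[OF j(1)]])
      moreover have "v i \<in> D" using i by (auto simp: D_def)
      ultimately have "ball (v i) e \<inter> L i j \<subseteq> {z \<in> ?S. ?G z = 1}" using off by blast
      then have "closure (ball (v i) e \<inter> L i j) \<subseteq> C" using C by (intro closure_minimal) auto
      moreover have "z \<in> closure (ball (v i) e \<inter> L i j)"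
        using z L_closure[OF j(1)] j(2) open_Int_closure_subset[OF open_ball, of "v i" e "L i j"] by blast
      ultimately show ?thesis by blast
    next
      case False
      then have "z \<in> {z \<in> ?S. ?G z = 1}" using off z by blast
      then show ?thesis unfolding C(2) by blast
    qed
    then have "z \<in> {z \<in> ?S. ?G z = 1}" unfolding C(2) using z by blast
    then show ?thesis by blast
  qed
  have "exp (Q z) = (v i - z) powi (\<Sum>j\<in>?N. s j)" if z: "z \<in> ?S" for z
  proof -
    have "v i - z \<noteq> 0" using z by auto
    then show ?thesis using all[OF z] by (simp add: power_int_minus field_simps del: right_minus_eq)
  qed
  then have "(\<Sum>j\<in>?N. s j) = 0" using no_log_of_power[OF e(1) contQ] by blast
  then have "(\<Sum>j\<in>?N. of_bool (L i j = A) :: int) = (\<Sum>j\<in>?N. of_bool (L j i = A))"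
    by (simp add: s_def sum_subtractf)
  moreover have "(\<Sum>j\<in>?N. of_bool (P j) :: int) = int (card {j. (i, j) \<in> E \<and> P j})" for P
    using sum.inter_filter[OF finite_nbrs[of i], of "\<lambda>_. 1 :: int" P] by (simp add: of_bool_def)
  ultimately show ?thesis by simp
qed

text \<open>
  Write \<open>r i j = exp (t i j)\<close> with \<open>t\<close> antisymmetric, so that \<open>\<Sum> j. t i j\<close> is an
  integer multiple \<open>n i\<close> of the period of \<open>exp\<close>. The function
  \<open>S z = exp (\<Sum> t i j * winding_number (d i j) z) * (\<Prod> (v i - z) powi n i)\<close>, with one summand for
  each edge, is constant on the faces: by \<open>winding_number_local_change\<close> the first factor changes
  with \<open>z\<close> like \<open>\<Prod> (v i - z) powi - n i\<close>. Across the edge \<open>ij\<close> it changes by the factor \<open>exp (t i j)\<close>, as the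
  winding number of this edge changes by one and everything else is continuous.
\<close>

lemma exactness:
  fixes r :: "'a \<Rightarrow> 'a \<Rightarrow> complex"
  assumes nz: "\<And>i j. (i, j) \<in> E \<Longrightarrow> r i j \<noteq> 0"
    and anti: "\<And>i j. (i, j) \<in> E \<Longrightarrow> r j i = 1 / r i j"
    and closed: "\<And>i. i \<in> V \<Longrightarrow> (\<Prod>j | (i, j) \<in> E. r i j) = 1"
  obtains s :: "complex set \<Rightarrow> complex" where "\<And>A. A \<in> components (- D) \<Longrightarrow> s A \<noteq> 0"
    "\<And>i j. (i, j) \<in> E \<Longrightarrow> s (L i j) = r i j * s (L j i)"
proof -
  obtain f :: "'a \<Rightarrow> nat" where f: "inj_on f V" using finite_imp_inj_to_nat_seg[OF finite_V] by blast
  define t where "t i j = (if f i < f j then Ln (r i j) else - Ln (r j i))" for i j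
  have f_neq: "f i \<noteq> f j" if "(i, j) \<in> E" for i j using f that E_irrefl E_V by (metis inj_onD)
  have t_anti: "t j i = - t i j" if "(i, j) \<in> E" for i j using f_neq[OF that] by (auto simp: t_def)
  have exp_t: "exp (t i j) = r i j" if "(i, j) \<in> E" for i j
    using nz[OF that] nz[OF E_sym[OF that]] anti[OF that] by (auto simp: t_def exp_minus)
  have "\<exists>n. (\<Sum>j | (i, j) \<in> E. t i j) = 2 * pi * \<i> * of_int n" if "i \<in> V" for i
  proof -
    have "exp (\<Sum>j | (i, j) \<in> E. t i j) = 1"
      unfolding exp_sum[OF finite_nbrs] using closed[OF that] exp_t by simp
    then obtain n :: int where "Re (\<Sum>j | (i, j) \<in> E. t i j) = 0" "Im (\<Sum>j | (i, j) \<in> E. t i j) = of_int (2 * n) * pi"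
      unfolding exp_eq_1 by blast
    then have "(\<Sum>j | (i, j) \<in> E. t i j) = 2 * pi * \<i> * of_int n" by (simp add: complex_eq_iff)
    then show ?thesis by blast
  qed
  then obtain n where n: "\<And>i. i \<in> V \<Longrightarrow> (\<Sum>j | (i, j) \<in> E. t i j) = 2 * pi * \<i> * of_int (n i)" by metis
  \<comment> \<open>both orientations of an edge contribute the same, hence the division by 2\<close>
  define T where "T z = (\<Sum>(i, j)\<in>E. t i j * winding_number (d i j) z) / 2" for z
  define R where "R z = (\<Prod>i\<in>V. (v i - z) powi n i)" for z
  define S where "S z = exp (T z) * R z" for z
  have R_nz: "R z \<noteq> 0" if "z \<notin> D" for z
    using that finite_V by (auto simp: R_def D_def)
  have local: "S w = S z" if ball: "ball z \<epsilon> \<subseteq> - D" and w: "w \<in> ball z \<epsilon>" for w z \<epsilon>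
  proof -
    have zD: "z \<notin> D" "w \<notin> D" using ball w by (auto simp: subset_eq dest: le_less_trans[OF zero_le_dist])
    define l where "l i = Ln ((v i - w) / (v i - z))" for i
    have vn: "v i - w \<noteq> 0" "v i - z \<noteq> 0" if "i \<in> V" for i using zD that by (auto simp: D_def)
    have wn: "2 * pi * \<i> * (winding_number (d i j) w - winding_number (d i j) z) = l j - l i" if "(i, j) \<in> E" for i j
      using winding_number_local_change[OF path_d[OF that], of z \<epsilon> w] ball path_image_D[OF that] w
        start_d[OF that] finish_d[OF that] by (auto simp: l_def)
    have "(SIGMA i:V. {j. (i, j) \<in> E}) = E" using E_V by auto
    then have Sig: "(\<Sum>(i, j)\<in>E. t i j * l i) = (\<Sum>i\<in>V. \<Sum>j | (i, j) \<in> E. t i j * l i)"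
      using sum.Sigma[of V "\<lambda>i. {j. (i, j) \<in> E}" "\<lambda>i j. t i j * l i"] finite_V finite_nbrs by simp
    have inner_sum: "(\<Sum>i\<in>V. \<Sum>j | (i, j) \<in> E. t i j * l i) = (\<Sum>i\<in>V. 2 * pi * \<i> * of_int (n i) * l i)"
      by (rule sum.cong[OF refl]) (use n in \<open>simp flip: sum_distrib_right\<close>)
    have swap: "(\<Sum>(i, j)\<in>E. t i j * l j) = - (\<Sum>(i, j)\<in>E. t i j * l i)"
    proof -
      have "(\<Sum>(i, j)\<in>E. t i j * l j) = (\<Sum>(i, j)\<in>E. t j i * l i)"
        by (rule sum.reindex_bij_witness[of _ "\<lambda>(i, j). (j, i)" "\<lambda>(i, j). (j, i)"]) (auto intro: E_sym)
      also have "\<dots> = (\<Sum>(i, j)\<in>E. - (t i j * l i))"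
        by (rule sum.cong[OF refl]) (use t_anti in auto)
      finally show ?thesis by (simp add: sum_negf case_prod_unfold)
    qed
    have "2 * pi * \<i> * (T w - T z) = (\<Sum>(i, j)\<in>E. t i j * (2 * pi * \<i> * (winding_number (d i j) w - winding_number (d i j) z))) / 2"
      by (simp add: T_def case_prod_unfold sum_distrib_left sum_subtractf algebra_simps diff_divide_distrib)
    also have "\<dots> = (\<Sum>(i, j)\<in>E. t i j * (l j - l i)) / 2"
      by (intro arg_cong[where f = "\<lambda>x. x / 2"] sum.cong[OF refl]) (use wn in auto)
    also have "\<dots> = - (\<Sum>(i, j)\<in>E. t i j * l i)"
      using swap by (simp add: right_diff_distrib case_prod_unfold sum_subtractf)
    also have "\<dots> = - (\<Sum>i\<in>V. \<Sum>j | (i, j) \<in> E. t i j * l i)"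
      by (simp only: Sig)
    also have "\<dots> = - (\<Sum>i\<in>V. 2 * pi * \<i> * of_int (n i) * l i)"
      by (simp only: inner_sum)
    also have "\<dots> = 2 * pi * \<i> * (- (\<Sum>i\<in>V. of_int (n i) * l i))"
      by (simp add: sum_distrib_left mult_ac)
    finally have "2 * pi * \<i> * (T w - T z) = 2 * pi * \<i> * (- (\<Sum>i\<in>V. of_int (n i) * l i))" .
    then have "T w - T z = - (\<Sum>i\<in>V. of_int (n i) * l i)"
      by (subst (asm) mult_cancel_left) simp
    then have "exp (T w) = exp (T z) * exp (- (\<Sum>i\<in>V. of_int (n i) * l i))"
      by (metis exp_add add_diff_cancel_left' diff_add_cancel add.commute)
    moreover have "R w = R z * exp (\<Sum>i\<in>V. of_int (n i) * l i)"
      unfolding R_def exp_sum[OF finite_V] prod.distrib[symmetric]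
    proof (rule prod.cong[OF refl])
      fix i assume i: "i \<in> V"
      have "exp (of_int (n i) * l i) = ((v i - w) / (v i - z)) powi n i"
        using vn[OF i] exp_power_int[of "l i" "n i"] by (simp add: l_def)
      then show "(v i - w) powi n i = (v i - z) powi n i * exp (of_int (n i) * l i)"
        using vn[OF i] by (simp add: power_int_divide_distrib)
    qed
    ultimately show ?thesis by (simp add: S_def exp_minus)
  qed
  have const: "\<exists>y. \<forall>z\<in>A. S z = y" if A: "A \<in> components (- D)" for A
  proof -
    have "S constant_on A"
    proof (rule locally_constant_imp_constant)
      show "connected A" using A in_components_connected by blast
      fix a assume "a \<in> A"
      then obtain e where e: "0 < e" "ball a e \<subseteq> A" using open_component[OF A] open_contains_ball by blast
      then have "openin (top_of_set A) (ball a e)" by (simp add: open_subset)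
      moreover have "\<forall>x\<in>ball a e. S x = S a" using local[of a e] e component_subset[OF A] by blast
      moreover have "a \<in> ball a e" using e(1) by simp
      ultimately show "\<exists>T. openin (top_of_set A) T \<and> a \<in> T \<and> (\<forall>x\<in>T. S x = S a)"
        by blast
    qed
    then show ?thesis unfolding constant_on_def by auto
  qed
  then obtain s where s: "\<And>A z. A \<in> components (- D) \<Longrightarrow> z \<in> A \<Longrightarrow> S z = s A" by metis
  show thesis
  proof (rule that)
    fix A assume A: "A \<in> components (- D)"
    then obtain z where z: "z \<in> A" using in_components_nonempty by blast
    then have "S z \<noteq> 0" using R_nz component_subset[OF A] by (auto simp: S_def)
    then show "s A \<noteq> 0" using s[OF A z] by simp
  next
    fix i j assume ij: "(i, j) \<in> E"
    note U = side_nbhd[OF ij] and wn = winding_number_sides[OF ij]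
    let ?U = "W i j"
    define E' where "E' = E - {(i, j), (j, i)}"
    \<comment> \<open>the continuation of \<open>S\<close> from the right side of the edge across the edge\<close>
    define q where "q z = exp (t i j * c i j z + (\<Sum>(k, l)\<in>E'. t k l * winding_number (d k l) z) / 2) * R z" for z
    have E'K: "path_image (d k l) \<subseteq> K i j" if "(k, l) \<in> E'" for k l
      using that unfolding E'_def drawn_except_def by (auto simp: doubleton_eq_iff)
    have "continuous_on ?U (winding_number (d (fst e) (snd e)))" if "e \<in> E'" for e
      using continuous_on_winding_number_edge[of "fst e" "snd e" ?U] E'K[of "fst e" "snd e"] that U(3)
      by (auto simp: E'_def)
    moreover have "v k \<notin> ?U" if "k \<in> V" for k
      using U(3) that by (auto simp: drawn_except_def)
    ultimately have contq: "continuous_on ?U q"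
      unfolding q_def R_def case_prod_unfold by (intro continuous_intros U(5)) auto
    have Tsplit: "T z = t i j * winding_number (d i j) z + (\<Sum>(k, l)\<in>E'. t k l * winding_number (d k l) z) / 2"
      if z: "z \<notin> D" for z
    proof -
      have "winding_number (d j i) z = - winding_number (d i j) z"
        using winding_number_reversepath[OF path_d[OF ij], of z] rev_d[OF ij] path_image_D[OF ij] z by auto
      then have e2: "t j i * winding_number (d j i) z = t i j * winding_number (d i j) z"
        using t_anti[OF ij] by simp
      have "i \<noteq> j" using ij E_irrefl by auto
      have "E = insert (i, j) (insert (j, i) E')" using ij E_sym by (auto simp: E'_def)
      then have "(\<Sum>(k, l)\<in>E. t k l * winding_number (d k l) z) =
        (\<Sum>(k, l)\<in>insert (i, j) (insert (j, i) E'). t k l * winding_number (d k l) z)" by simp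
      also have "\<dots> = t i j * winding_number (d i j) z + (t j i * winding_number (d j i) z +
         (\<Sum>(k, l)\<in>E'. t k l * winding_number (d k l) z))"
        using \<open>i \<noteq> j\<close> finite_E by (simp add: E'_def)
      finally show ?thesis unfolding T_def e2 by (simp add: add_divide_distrib)
    qed
    have LD: "L i j \<subseteq> - D" "L j i \<subseteq> - D" using component_subset L_component ij E_sym by blast+
    have q1: "q z = s (L i j) / r i j" if "z \<in> L i j" for z
    proof -
      have "T z = t i j + (t i j * c i j z + (\<Sum>(k, l)\<in>E'. t k l * winding_number (d k l) z) / 2)"
        using Tsplit[of z] that LD wn(1)[OF that] by (auto simp: algebra_simps)
      then have "S z = r i j * q z" using exp_t[OF ij] by (simp add: S_def q_def exp_add)
      then show ?thesis using s[OF L_component[OF ij] that] nz[OF ij] by (simp add: field_simps)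
    qed
    have q2: "q z = s (L j i)" if "z \<in> L j i" for z
      using Tsplit[of z] that LD wn(2)[OF that] s[OF L_component[OF E_sym[OF ij]] that] by (auto simp: S_def q_def)
    have lim: "q x = y" if x: "x \<in> ?U" "x \<in> closure A" and A: "A \<subseteq> ?U" "\<And>z. z \<in> A \<Longrightarrow> q z = y" for x A y
    proof -
      have "closedin (top_of_set ?U) {z \<in> ?U. q z = y}"
        by (rule continuous_closedin_preimage_constant[OF contq])
      then obtain C where C: "closed C" "{z \<in> ?U. q z = y} = ?U \<inter> C" by (auto simp: closedin_closed)
      then have "A \<subseteq> C" using A by blast
      then have "x \<in> C" using C(1) x(2) closure_minimal by blast
      then show ?thesis using C x by blast
    qed
    have "d i j (1/2) \<in> path_image (d i j) - {v i, v j}"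
      using arc_midpoint[OF arc_d[OF ij]] start_d[OF ij] finish_d[OF ij] by simp
    then obtain x where x: "x \<in> path_image (d i j)" "x \<in> ?U" using U(2) by blast
    have "x \<in> closure (L i j)" "x \<in> closure (L j i)"
      using x L_closure[OF ij] L_closure[OF E_sym[OF ij]] image_rev[OF ij] by auto
    then have "q x = s (L i j) / r i j" "q x = s (L j i)"
      using lim[OF x(2)] q1 q2 U(4) by blast+
    then show "s (L i j) = r i j * s (L j i)" using nz[OF ij] by (simp add: field_simps)
  qed
qed

end

section \<open>Paths in 3-connected graphs\<close>

context
  fixes G :: "'a pair_pre_digraph"
  assumes pg: "pair_graph G"
begin

interpretation pair_graph G by (rule pg)

lemma pair_graph_simple:
  "finite (pverts G)" "parcs G \<subseteq> pverts G \<times> pverts G" "(i, i) \<notin> parcs G"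
  "(i, j) \<in> parcs G \<Longrightarrow> (j, i) \<in> parcs G"
proof -
  show "finite (pverts G)" by (rule pair_finite_verts)
  show "parcs G \<subseteq> pverts G \<times> pverts G" using in_arcsD1 in_arcsD2 by auto
  show "(i, i) \<notin> parcs G" using pair_no_loops by fastforce
  show "(i, j) \<in> parcs G \<Longrightarrow> (j, i) \<in> parcs G"
    using pair_sym_arcs by (auto simp: symmetric_def sym_def)
qed

lemma path_in_induced_subgraph:
  assumes "Digraph_Component.connected (with_proj G \<restriction> S)" "u \<in> S" "w \<in> S"
  shows "(u, w) \<in> (parcs G \<inter> S \<times> S)\<^sup>*"
proof -
  let ?H = "mk_symmetric (with_proj G \<restriction> S)"
  have "pverts ?H = S" by (simp add: mk_symmetric_def)
  have arcs: "parcs ?H \<subseteq> parcs G \<inter> S \<times> S"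
    using pair_graph_simple(4) by (auto simp: mk_symmetric_def)
  have "(u, w) \<in> rtrancl_on S (parcs ?H)"
    using assms \<open>pverts ?H = S\<close> unfolding Digraph_Component.connected_def strongly_connected_def reachable_def
    by simp
  then show ?thesis
  proof (induction rule: rtrancl_on_induct)
    case (step y z)
    then have "(y, z) \<in> parcs G \<inter> S \<times> S" using arcs by auto
    with step(5) show ?case by (rule rtrancl_into_rtrancl)
  qed simp
qed

lemma three_connected_path_avoiding:
  assumes "three_connected G" "a \<in> pverts G" "b \<in> pverts G" "a \<noteq> b"
    "u \<in> pverts G - {a, b}" "w \<in> pverts G - {a, b}"
  shows "(u, w) \<in> (parcs G \<inter> (pverts G - {a, b}) \<times> (pverts G - {a, b}))\<^sup>*"
  using assms by (intro path_in_induced_subgraph) (auto simp: three_connected_def)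

lemma ex_other_vertex:
  assumes "three_connected G" "card A \<le> 3" "finite A"
  obtains b where "b \<in> pverts G" "b \<notin> A"
proof -
  have "\<not> pverts G \<subseteq> A" using card_mono[OF assms(3), of "pverts G"] assms by (auto simp: three_connected_def)
  then show thesis using that by blast
qed

lemma three_connected_neighbour:
  assumes "three_connected G" "i \<in> pverts G" "j \<in> pverts G" "i \<noteq> j"
  shows "\<exists>x. (i, x) \<in> parcs G \<and> x \<noteq> j"
proof -
  obtain b where b: "b \<in> pverts G" "b \<notin> {i, j}"
    by (rule ex_other_vertex[OF assms(1), of "{i, j}"]) (auto simp: card_insert_if)
  obtain c where c: "c \<in> pverts G" "c \<notin> {i, j, b}"
    by (rule ex_other_vertex[OF assms(1), of "{i, j, b}"]) (auto simp: card_insert_if)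
  have "(i, c) \<in> (parcs G \<inter> (pverts G - {j, b}) \<times> (pverts G - {j, b}))\<^sup>*"
    by (rule three_connected_path_avoiding) (use assms b c in auto)
  then show ?thesis using c by (cases rule: converse_rtranclE) auto
qed

text \<open>
  From \<open>i\<close> a first step to a neighbour \<open>x \<noteq> j\<close>, and from there to \<open>j\<close> in the graph without
  \<open>i\<close>.
\<close>

lemma three_connected_bridgeless:
  assumes 3: "three_connected G" and ij: "(i, j) \<in> parcs G"
  shows "(i, j) \<in> (parcs G - {(i, j), (j, i)})\<^sup>*"
proof -
  have V: "i \<in> pverts G" "j \<in> pverts G" "i \<noteq> j" using ij pair_graph_simple(2,3) by auto
  obtain x where x: "(i, x) \<in> parcs G" "x \<noteq> j" using three_connected_neighbour[OF 3 V] by blast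
  have xi: "x \<in> pverts G" "x \<noteq> i" using x pair_graph_simple(2,3) by auto
  obtain b where b: "b \<in> pverts G" "b \<notin> {i, j, x}"
    by (rule ex_other_vertex[OF 3, of "{i, j, x}"]) (auto simp: card_insert_if)
  have "(x, j) \<in> (parcs G \<inter> (pverts G - {i, b}) \<times> (pverts G - {i, b}))\<^sup>*"
    by (rule three_connected_path_avoiding) (use 3 V b x xi in auto)
  then have "(x, j) \<in> (parcs G - {(i, j), (j, i)})\<^sup>*"
    by (rule rtrancl_mono[THEN subsetD, rotated]) auto
  moreover have "(i, x) \<in> parcs G - {(i, j), (j, i)}" using x xi by auto
  ultimately show ?thesis by (rule converse_rtrancl_into_rtrancl[rotated])
qed

end

section \<open>From the sphere to the plane\<close>

lemma punctured_sphere_homeomorphism: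
  assumes "N \<in> S2"
  obtains h k where "homeomorphism (S2 - {N}) (UNIV :: complex set) h k"
proof -
  let ?T = "{x :: real^3. axis 1 1 \<bullet> x = 0}"
  have "(S2 - {N}) homeomorphic ?T"
    by (rule homeomorphic_punctured_sphere_hyperplane) (use assms in \<open>auto simp: axis_eq_0_iff\<close>)
  also have "?T homeomorphic (UNIV :: complex set)"
    by (rule homeomorphic_affine_sets) (auto simp: affine_hyperplane aff_dim_hyperplane axis_eq_0_iff aff_dim_UNIV)
  finally show thesis using that unfolding homeomorphic_def by blast
qed

lemma closure_continuous_image:
  fixes f :: "'b::metric_space \<Rightarrow> 'c::metric_space"
  assumes "continuous_on S f" "x \<in> S" "T \<subseteq> S" "x \<in> closure T"
  shows "f x \<in> closure (f ` T)"
proof -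
  obtain g where g: "\<And>n. g n \<in> T" "g \<longlonglongrightarrow> x" using assms(4) unfolding closure_sequential by auto
  have "(\<lambda>n. f (g n)) \<longlonglongrightarrow> f x"
    by (rule continuous_on_tendsto_compose[OF assms(1) g(2) assms(2)]) (simp add: subsetD[OF assms(3) g(1)])
  then show ?thesis using g(1) unfolding closure_sequential by (intro exI[of _ "\<lambda>n. f (g n)"]) auto
qed

context
  fixes G :: "'a pair_pre_digraph" and \<phi> :: "'a \<Rightarrow> real^3" and \<gamma> :: "'a \<Rightarrow> 'a \<Rightarrow> real \<Rightarrow> real^3"
  assumes pg: "pair_graph G" and 3: "three_connected G" and emb: "sphere_embedding G \<phi> \<gamma>"
begin

lemma embeddingD:
  "\<phi> ` pverts G \<subseteq> S2" "inj_on \<phi> (pverts G)"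
  "(i, j) \<in> parcs G \<Longrightarrow> Path_Connected.arc (\<gamma> i j)"
  "(i, j) \<in> parcs G \<Longrightarrow> path_image (\<gamma> i j) \<subseteq> S2"
  "(i, j) \<in> parcs G \<Longrightarrow> pathstart (\<gamma> i j) = \<phi> i"
  "(i, j) \<in> parcs G \<Longrightarrow> pathfinish (\<gamma> i j) = \<phi> j"
  "(i, j) \<in> parcs G \<Longrightarrow> path_image (\<gamma> j i) = path_image (\<gamma> i j)"
  "(i, j) \<in> parcs G \<Longrightarrow> path_image (\<gamma> i j) \<inter> \<phi> ` pverts G = {\<phi> i, \<phi> j}"
  "(i, j) \<in> parcs G \<Longrightarrow> (k, l) \<in> parcs G \<Longrightarrow> {i, j} \<noteq> {k, l} \<Longrightarrow>
      path_image (\<gamma> i j) \<inter> path_image (\<gamma> k l) \<subseteq> \<phi> ` pverts G"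
proof -
  note e = emb[unfolded sphere_embedding_def]
  show "\<phi> ` pverts G \<subseteq> S2" "inj_on \<phi> (pverts G)" using e by blast+
  note arcs = e[THEN conjunct2, THEN conjunct2, THEN conjunct1, THEN bspec, of "(i, j)", unfolded prod.case]
  show "Path_Connected.arc (\<gamma> i j)" "path_image (\<gamma> i j) \<subseteq> S2" "pathstart (\<gamma> i j) = \<phi> i"
    "pathfinish (\<gamma> i j) = \<phi> j" "path_image (\<gamma> j i) = path_image (\<gamma> i j)"
    "path_image (\<gamma> i j) \<inter> \<phi> ` pverts G = {\<phi> i, \<phi> j}" if "(i, j) \<in> parcs G"
    using arcs[OF that] by blast+
  show "path_image (\<gamma> i j) \<inter> path_image (\<gamma> k l) \<subseteq> \<phi> ` pverts G"
    if "(i, j) \<in> parcs G" "(k, l) \<in> parcs G" "{i, j} \<noteq> {k, l}"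
    using e[THEN conjunct2, THEN conjunct2, THEN conjunct2, THEN bspec, OF that(1), unfolded prod.case,
        THEN bspec, OF that(2), unfolded prod.case] that(3) by blast
qed

lemma finite_parcs: "finite (parcs G)"
  using pair_graph_simple(1,2)[OF pg] by (meson finite_SigmaI finite_subset)

lemma compact_drawing_part:
  assumes "A \<subseteq> parcs G"
  shows "compact (\<phi> ` pverts G \<union> (\<Union>(i, j)\<in>A. path_image (\<gamma> i j)))"
proof -
  have "finite A" using assms finite_parcs finite_subset by blast
  then have "compact (\<Union>(i, j)\<in>A. path_image (\<gamma> i j))"
    using assms embeddingD(3) by (auto intro!: compact_UN compact_arc_image)
  then show ?thesis using pair_graph_simple(1)[OF pg]
    by (intro compact_Un) (auto intro: finite_imp_compact)
qed

lemma drawing_subset: "drawing G \<phi> \<gamma> \<subseteq> S2"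
  unfolding drawing_def using embeddingD(1,4) by fast

lemma path_image_drawing: "(i, j) \<in> parcs G \<Longrightarrow> path_image (\<gamma> i j) \<subseteq> drawing G \<phi> \<gamma>"
  unfolding drawing_def by auto

lemma closed_drawing: "closed (drawing G \<phi> \<gamma>)"
  unfolding drawing_def using compact_drawing_part[of "parcs G"] compact_imp_closed by blast

lemma ex_edge: "\<exists>i j. (i, j) \<in> parcs G"
proof -
  obtain i where i: "i \<in> pverts G" by (rule ex_other_vertex[OF pg 3, of "{}"]) auto
  obtain j where j: "j \<in> pverts G" "j \<notin> {i}" by (rule ex_other_vertex[OF pg 3, of "{i}"]) auto
  show ?thesis using three_connected_neighbour[OF pg 3, of i j] i j by auto
qed

text \<open>
  This provides the pole of a stereographic projection. Near an inner point of an edge nothing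
  else is drawn. If the drawing were the whole sphere, the edge would thus contain an open piece of
  the sphere, which invariance of dimension forbids.
\<close>

lemma drawing_proper: "\<exists>N. N \<in> S2 - drawing G \<phi> \<gamma>"
proof (rule ccontr)
  assume "\<not> ?thesis"
  then have full: "S2 \<subseteq> drawing G \<phi> \<gamma>" by blast
  obtain i j where ij: "(i, j) \<in> parcs G" using ex_edge by blast
  let ?g = "\<gamma> i j"
  define R where "R = \<phi> ` pverts G \<union> (\<Union>(k, l)\<in>{(k, l) \<in> parcs G. {k, l} \<noteq> {i, j}}. path_image (\<gamma> k l))"
  have "closed R" unfolding R_def by (intro compact_imp_closed compact_drawing_part) auto
  have mid: "?g (1/2) \<in> path_image ?g - {\<phi> i, \<phi> j}"
    using arc_midpoint[OF embeddingD(3)[OF ij]] embeddingD(5,6)[OF ij] by simp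
  then have xR: "?g (1/2) \<notin> R"
    using embeddingD(8)[OF ij] embeddingD(9)[OF ij] unfolding R_def by fastforce
  have SR: "S2 - R \<subseteq> path_image ?g"
  proof
    fix x assume x: "x \<in> S2 - R"
    then have "x \<in> drawing G \<phi> \<gamma>" "x \<notin> \<phi> ` pverts G" using full unfolding R_def by blast+
    then obtain k l where kl: "(k, l) \<in> parcs G" "x \<in> path_image (\<gamma> k l)"
      unfolding drawing_def by blast
    then have "{k, l} = {i, j}" using x unfolding R_def by blast
    then show "x \<in> path_image ?g" using kl embeddingD(7)[OF ij] by (auto simp: doubleton_eq_iff)
  qed
  have "\<phi> i \<in> S2" using embeddingD(1) ij pair_graph_simple(2)[OF pg] by blast
  then obtain h k where hk: "homeomorphism (S2 - {\<phi> i}) (UNIV :: complex set) h k"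
    using punctured_sphere_homeomorphism by blast
  obtain q where q: "homeomorphism {0..1} (path_image ?g) ?g q"
    using homeomorphism_arc embeddingD(3)[OF ij] by blast
  define U where "U = k -` (- R)"
  have kc: "continuous_on UNIV k" and kim: "range k = S2 - {\<phi> i}" and hk': "\<And>z. h (k z) = z" "\<And>x. x \<in> S2 - {\<phi> i} \<Longrightarrow> k (h x) = x"
    using hk by (auto simp: homeomorphism_def)
  have "open U" unfolding U_def using kc \<open>closed R\<close> by (simp add: continuous_on_open_vimage open_Compl)
  moreover have "h (?g (1/2)) \<in> U"
  proof -
    have "?g (1/2) \<in> S2 - {\<phi> i}" using mid embeddingD(4)[OF ij] by blast
    then show ?thesis using hk'(2) xR by (simp add: U_def)
  qed
  moreover have kU: "k ` U \<subseteq> path_image ?g" using SR kim unfolding U_def by blast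
  moreover have "continuous_on U (q \<circ> k)"
  proof (rule continuous_on_compose)
    show "continuous_on U k" using kc continuous_on_subset by blast
    show "continuous_on (k ` U) q" using q kU by (meson continuous_on_subset homeomorphism_def)
  qed
  moreover have "inj_on (q \<circ> k) U"
  proof (rule comp_inj_on)
    show "inj_on k U" using hk'(1) by (metis inj_onI)
    show "inj_on q (k ` U)" using q kU by (metis homeomorphism_def inj_on_inverseI inj_on_subset)
  qed
  ultimately have "DIM(complex) \<le> DIM(real)"
    by (intro invariance_of_dimension[of U "q \<circ> k"]) auto
  then show False by simp
qed

lemma face_subset: "\<alpha> \<in> faces G \<phi> \<gamma> \<Longrightarrow> \<alpha> \<subseteq> S2 - drawing G \<phi> \<gamma>"
  unfolding faces_def by (rule in_components_subset)

lemma openin_face: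
  assumes "\<alpha> \<in> faces G \<phi> \<gamma>"
  shows "openin (top_of_set S2) \<alpha>"
proof -
  have o: "openin (top_of_set S2) (S2 - drawing G \<phi> \<gamma>)"
    using closed_drawing by (metis Diff_eq open_Compl openin_open_Int)
  have "locally connected (S2 - drawing G \<phi> \<gamma>)"
    by (rule locally_open_subset[OF _ o]) (simp add: locally_connected_sphere)
  then have "openin (top_of_set (S2 - drawing G \<phi> \<gamma>)) \<alpha>"
    using assms openin_components_locally_connected unfolding faces_def by blast
  then show ?thesis using o openin_trans by blast
qed

lemma face_boundary_iff:
  assumes "\<alpha> \<in> faces G \<phi> \<gamma>" "x \<in> drawing G \<phi> \<gamma>"
  shows "x \<in> face_boundary \<alpha> \<longleftrightarrow> x \<in> closure \<alpha>"
proof -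
  have "x \<notin> \<alpha>" "x \<in> S2" using assms face_subset drawing_subset by blast+
  moreover have "\<alpha> \<subseteq> S2" using face_subset[OF assms(1)] by blast
  ultimately show ?thesis
    unfolding face_boundary_def frontier_of_def interior_of_openin[OF openin_face[OF assms(1)]]
    by (simp add: closure_of_subtopology Int_absorb1)
qed

text \<open>
  Seen from another pole, a vertex \<open>M\<close>, which lies on the drawing and hence outside the face, the
  face is a connected open subset of the plane, and such a set remains connected without one of its
  points. Thus no face falls apart when the pole \<open>N\<close> of the projection used later is removed.
\<close>

lemma punctured_face:
  assumes a: "\<alpha> \<in> faces G \<phi> \<gamma>"
  shows "connected (\<alpha> - {N})" "\<alpha> - {N} \<noteq> {}"
proof -
  obtain i j where ij: "(i, j) \<in> parcs G" using ex_edge by blast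
  define M where "M = \<phi> i"
  have iV: "i \<in> pverts G" using ij pair_graph_simple(2)[OF pg] by auto
  have M: "M \<in> S2" "M \<in> drawing G \<phi> \<gamma>" using embeddingD(1) iV by (auto simp: M_def drawing_def)
  obtain h k where hk: "homeomorphism (S2 - {M}) (UNIV :: complex set) h k"
    using punctured_sphere_homeomorphism[OF M(1)] by blast
  have kc: "continuous_on UNIV k" and hc: "continuous_on (S2 - {M}) h" and kim: "range k = S2 - {M}"
    and hk': "\<And>z. h (k z) = z" "\<And>x. x \<in> S2 - {M} \<Longrightarrow> k (h x) = x"
    using hk by (auto simp: homeomorphism_def)
  have sub: "\<alpha> \<subseteq> S2 - {M}" using face_subset[OF a] M(2) by blast
  have cona: "connected \<alpha>" and ne: "\<alpha> \<noteq> {}"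
    using a in_components_connected in_components_nonempty unfolding faces_def by blast+
  have con: "connected (h ` \<alpha>)"
    by (rule connected_continuous_image[OF continuous_on_subset[OF hc sub] cona])
  have img: "k ` (h ` \<alpha> - S) = \<alpha> - k ` S" for S
  proof -
    have "inj k" using hk'(1) by (metis injI)
    then have "k ` (h ` \<alpha> - S) = k ` h ` \<alpha> - k ` S" by (rule image_set_diff)
    also have "k ` h ` \<alpha> = \<alpha>" using hk'(2) sub by (force simp: image_iff)
    finally show ?thesis .
  qed
  have "h ` \<alpha> = k -` \<alpha>"
  proof (intro equalityI subsetI)
    fix z assume "z \<in> h ` \<alpha>"
    then obtain x where "x \<in> \<alpha>" "z = h x" by blast
    moreover from this have "k (h x) = x" using sub by (intro hk'(2)) blast
    ultimately show "z \<in> k -` \<alpha>" by simp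
  next
    fix z assume "z \<in> k -` \<alpha>"
    then show "z \<in> h ` \<alpha>" using hk'(1)[of z] by (simp add: rev_image_eqI)
  qed
  moreover obtain T where "open T" "\<alpha> = S2 \<inter> T" using openin_face[OF a] by (auto simp: openin_open)
  moreover have "k -` (S2 \<inter> T) = k -` T" using kim by auto
  moreover have "open (k -` T)" using kc \<open>open T\<close> by (simp add: continuous_on_open_vimage)
  ultimately have op: "open (h ` \<alpha>)" by simp
  have "\<alpha> - {N} = k ` (h ` \<alpha> - (if N \<in> \<alpha> then {h N} else {}))"
  proof (cases "N \<in> \<alpha>")
    case True
    then have "k (h N) = N" using sub by (intro hk'(2)) blast
    then show ?thesis unfolding img using True by simp
  next
    case False
    then show ?thesis using img[of "{}"] by simp
  qed
  moreover have "connected (h ` \<alpha> - {h N})" by (rule connected_open_delete[OF op con]) simp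
  ultimately have "\<exists>S. connected S \<and> \<alpha> - {N} = k ` S" using con by (auto split: if_splits)
  then show "connected (\<alpha> - {N})"
    using kc connected_continuous_image continuous_on_subset by (metis subset_UNIV)
  show "\<alpha> - {N} \<noteq> {}"
  proof
    assume "\<alpha> - {N} = {}"
    then have "h ` \<alpha> = {h N}" using ne by blast
    then show False using op not_open_singleton[of "h N"] by simp
  qed
qed

lemma ex_plane_graph:
  assumes hk: "homeomorphism (S2 - {N}) (UNIV :: complex set) h k" and N: "N \<notin> drawing G \<phi> \<gamma>"
  shows "\<exists>d. plane_graph (pverts G) (parcs G) (h \<circ> \<phi>) d \<and>
    (\<forall>(i, j)\<in>parcs G. path_image (d i j) = h ` path_image (\<gamma> i j))"
proof -
  note G = pair_graph_simple[OF pg]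
  have hc: "continuous_on (S2 - {N}) h" and hinj: "inj_on h (S2 - {N})"
    using hk by (auto simp: homeomorphism_def intro: inj_on_inverseI[of _ k])
  have dr: "drawing G \<phi> \<gamma> \<subseteq> S2 - {N}" using drawing_subset N by blast
  have hc': "continuous_on (drawing G \<phi> \<gamma>) h" and hinj': "inj_on h (drawing G \<phi> \<gamma>)"
    using hc hinj dr continuous_on_subset inj_on_subset by blast+
  have vdr: "\<phi> ` pverts G \<subseteq> drawing G \<phi> \<gamma>" unfolding drawing_def by auto
  obtain f :: "'a \<Rightarrow> nat" where f: "inj_on f (pverts G)" using finite_imp_inj_to_nat_seg[OF G(1)] by blast
  define d where "d i j = (if f i < f j then h \<circ> \<gamma> i j else reversepath (h \<circ> \<gamma> j i))" for i j
  have f_neq: "f i \<noteq> f j" if "(i, j) \<in> parcs G" for i j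
    using f G(2,3) that by (metis inj_onD mem_Sigma_iff subsetD)
  have arch: "Path_Connected.arc (h \<circ> \<gamma> i j)" if "(i, j) \<in> parcs G" for i j
  proof -
    note a = embeddingD(3)[OF that, unfolded arc_def]
    have "continuous_on (path_image (\<gamma> i j)) h" "inj_on h (path_image (\<gamma> i j))"
      using path_image_drawing[OF that] hc' hinj' continuous_on_subset inj_on_subset by blast+
    then show ?thesis
      using a unfolding arc_def by (auto simp: path_image_def intro!: path_continuous_image comp_inj_on)
  qed
  have im: "path_image (d i j) = h ` path_image (\<gamma> i j)" if "(i, j) \<in> parcs G" for i j
    using embeddingD(7)[OF that] by (auto simp: d_def path_image_compose)
  have Int: "h ` A \<inter> h ` B = h ` (A \<inter> B)" if "A \<subseteq> drawing G \<phi> \<gamma>" "B \<subseteq> drawing G \<phi> \<gamma>" for A B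
    using inj_on_image_Int[OF hinj' that] by simp
  have ends: "pathstart (d i j) = h (\<phi> i)" "pathfinish (d i j) = h (\<phi> j)" if "(i, j) \<in> parcs G" for i j
    using embeddingD(5,6)[OF that] embeddingD(5,6)[OF G(4)[OF that]]
    by (auto simp: d_def pathstart_compose pathfinish_compose)
  have arcd: "Path_Connected.arc (d i j)" if "(i, j) \<in> parcs G" for i j
    using arch[OF that] arch[OF G(4)[OF that]] by (auto simp: d_def arc_reversepath)
  have "plane_graph (pverts G) (parcs G) (h \<circ> \<phi>) d"
  proof
    show "finite (pverts G)" "parcs G \<subseteq> pverts G \<times> pverts G" by (rule G)+
    show "(i, i) \<notin> parcs G" for i by (rule G)
    show "(j, i) \<in> parcs G" if "(i, j) \<in> parcs G" for i j using that by (rule G)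
    show "inj_on (h \<circ> \<phi>) (pverts G)"
      using embeddingD(2) hinj' vdr by (intro comp_inj_on) (auto intro: inj_on_subset)
    show "\<exists>j. (i, j) \<in> parcs G" if "i \<in> pverts G" for i
    proof -
      obtain j where "j \<in> pverts G" "j \<notin> {i}" by (rule ex_other_vertex[OF pg 3, of "{i}"]) auto
      then show ?thesis using three_connected_neighbour[OF pg 3 that, of j] by auto
    qed
    fix i j assume ij: "(i, j) \<in> parcs G"
    show "Path_Connected.arc (d i j)" by (rule arcd[OF ij])
    show "pathstart (d i j) = (h \<circ> \<phi>) i" "pathfinish (d i j) = (h \<circ> \<phi>) j" using ends[OF ij] by auto
    show "d j i = reversepath (d i j)" using f_neq[OF ij] by (auto simp: d_def)
    show "path_image (d i j) \<inter> (h \<circ> \<phi>) ` pverts G = {(h \<circ> \<phi>) i, (h \<circ> \<phi>) j}"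
      using Int[OF path_image_drawing[OF ij] vdr] embeddingD(8)[OF ij] im[OF ij] by (simp add: image_comp)
    have "path_component (drawn_except (pverts G) (parcs G) (h \<circ> \<phi>) d i j) (h (\<phi> j)) (h (\<phi> x))"
      if "(j, x) \<in> (parcs G - {(j, i), (i, j)})\<^sup>*" for x
      using that
    proof (induction rule: rtrancl_induct)
      case base
      have "j \<in> pverts G" using ij G(2) by auto
      then show ?case by (auto simp: drawn_except_def intro!: path_component_refl)
    next
      case (step y z)
      then have yz: "(y, z) \<in> parcs G" "{y, z} \<noteq> {i, j}" by (auto simp: doubleton_eq_iff)
      have "path_component (drawn_except (pverts G) (parcs G) (h \<circ> \<phi>) d i j) (h (\<phi> y)) (h (\<phi> z))"
        unfolding path_component_def using yz ends[OF yz(1)] arc_imp_path[OF arcd[OF yz(1)]]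
        by (intro exI[of _ "d y z"]) (auto simp: drawn_except_def)
      then show ?case by (rule path_component_trans[OF step.IH])
    qed
    then show "path_component (drawn_except (pverts G) (parcs G) (h \<circ> \<phi>) d i j) ((h \<circ> \<phi>) j) ((h \<circ> \<phi>) i)"
      using three_connected_bridgeless[OF pg 3 G(4)[OF ij]] by auto
    fix k l assume kl: "(k, l) \<in> parcs G" and ne: "{i, j} \<noteq> {k, l}"
    show "path_image (d i j) \<inter> path_image (d k l) \<subseteq> (h \<circ> \<phi>) ` pverts G"
      using Int[OF path_image_drawing[OF ij] path_image_drawing[OF kl]] embeddingD(9)[OF ij kl ne] im ij kl by auto
  qed
  then show ?thesis using im by blast
qed

end

text \<open>
  What the geometry needs to know about the embedding. \<open>L i j\<close> is the face to the left of the
  oriented edge \<open>ij\<close>. Then \<open>balanced\<close> expresses that the boundary of a face is a cycle, \<open>exact\<close>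
  that the first cohomology of the sphere with coefficients in the nonzero complex numbers is
  trivial, and \<open>linked\<close> that one can pass between any two faces at a vertex by crossing edges at it.
\<close>

locale face_structure =
  fixes G :: "'a pair_pre_digraph" and \<phi> :: "'a \<Rightarrow> real^3" and \<gamma> :: "'a \<Rightarrow> 'a \<Rightarrow> real \<Rightarrow> real^3"
    and L :: "'a \<Rightarrow> 'a \<Rightarrow> (real^3) set"
  assumes pg: "pair_graph G"
    and has_edge: "i \<in> pverts G \<Longrightarrow> \<exists>j. (i, j) \<in> parcs G"
    and L_face: "(i, j) \<in> parcs G \<Longrightarrow> L i j \<in> faces G \<phi> \<gamma>"
    and dual_pair_iff: "dual_pair G \<phi> \<gamma> \<alpha> \<beta> i j \<longleftrightarrow> (i, j) \<in> parcs G \<and> {\<alpha>, \<beta>} = {L i j, L j i}"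
    and L_neq: "(i, j) \<in> parcs G \<Longrightarrow> L i j \<noteq> L j i"
    and verts_L: "(i, j) \<in> parcs G \<Longrightarrow> {i, j} \<subseteq> face_verts G \<phi> (L i j)"
    and face_is_side: "\<alpha> \<in> faces G \<phi> \<gamma> \<Longrightarrow> \<exists>i j. (i, j) \<in> parcs G \<and> \<alpha> = L i j"
    and balanced: "i \<in> pverts G \<Longrightarrow> \<alpha> \<in> faces G \<phi> \<gamma> \<Longrightarrow>
      card {j. (i, j) \<in> parcs G \<and> L i j = \<alpha>} = card {j. (i, j) \<in> parcs G \<and> L j i = \<alpha>}"
    and linked: "i \<in> pverts G \<Longrightarrow> (\<And>j. (i, j) \<in> parcs G \<Longrightarrow> L i j \<in> P \<longleftrightarrow> L j i \<in> P) \<Longrightarrow>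
      \<alpha> \<in> faces G \<phi> \<gamma> \<Longrightarrow> i \<in> face_verts G \<phi> \<alpha> \<Longrightarrow> \<beta> \<in> faces G \<phi> \<gamma> \<Longrightarrow> i \<in> face_verts G \<phi> \<beta> \<Longrightarrow>
      \<alpha> \<in> P \<longleftrightarrow> \<beta> \<in> P"
    and exact: "(\<And>i j. (i, j) \<in> parcs G \<Longrightarrow> r i j \<noteq> 0) \<Longrightarrow>
      (\<And>i j. (i, j) \<in> parcs G \<Longrightarrow> r j i = 1 / r i j) \<Longrightarrow>
      (\<And>i. i \<in> pverts G \<Longrightarrow> (\<Prod>j | (i, j) \<in> parcs G. r i j) = 1) \<Longrightarrow>
      \<exists>s. (\<forall>\<alpha>\<in>faces G \<phi> \<gamma>. s \<alpha> \<noteq> (0 :: complex)) \<and> (\<forall>(i, j)\<in>parcs G. s (L i j) = r i j * s (L j i))"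

text \<open>
  The stereographic projection \<open>h\<close> from a pole \<open>N\<close> outside the drawing turns the embedding into a plane
  graph. The map \<open>p\<close> takes the faces of the embedding to the components of the complement of the plane
  drawing; it is a bijection, and a point of the drawing is on the boundary of a face if and only if
  its projection is in the closure of the component.
\<close>

theorem ex_face_structure:
  fixes G :: "'a pair_pre_digraph" and \<phi> :: "'a \<Rightarrow> real^3" and \<gamma> :: "'a \<Rightarrow> 'a \<Rightarrow> real \<Rightarrow> real^3"
  assumes pg: "pair_graph G" and 3: "three_connected G" and emb: "sphere_embedding G \<phi> \<gamma>"
  obtains L where "face_structure G \<phi> \<gamma> L"
proof -
  note emb_facts = pg 3 emb
  let ?F = "faces G \<phi> \<gamma>" and ?dr = "drawing G \<phi> \<gamma>"
  obtain N where N: "N \<in> S2" "N \<notin> ?dr" using drawing_proper[OF emb_facts] by blast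
  obtain h k where hk: "homeomorphism (S2 - {N}) (UNIV :: complex set) h k"
    using punctured_sphere_homeomorphism[OF N(1)] by blast
  obtain d where pl: "plane_graph (pverts G) (parcs G) (h \<circ> \<phi>) d"
    and im: "\<And>i j. (i, j) \<in> parcs G \<Longrightarrow> path_image (d i j) = h ` path_image (\<gamma> i j)"
    using ex_plane_graph[OF emb_facts hk N(2)] by blast
  interpret plane_graph "pverts G" "parcs G" "h \<circ> \<phi>" d by (rule pl)
  obtain L W c where "\<And>i j. (i, j) \<in> parcs G \<Longrightarrow> arc_sides (K i j) (d i j) (L i j) (L j i) (W i j) (c i j)"
    by (rule ex_sides) blast
  then interpret sided_plane_graph "pverts G" "parcs G" "h \<circ> \<phi>" d L W c by unfold_locales
  have kc: "continuous_on UNIV k" and hc: "continuous_on (S2 - {N}) h" and kim: "range k = S2 - {N}"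
    and hk': "\<And>z. h (k z) = z" "\<And>x. x \<in> S2 - {N} \<Longrightarrow> k (h x) = x"
    using hk by (auto simp: homeomorphism_def)
  have drN: "?dr \<subseteq> S2 - {N}" using drawing_subset[OF emb_facts] N(2) by blast
  have Ddr: "D = h ` ?dr"
    unfolding D_def drawing_def using im by (auto simp: image_Un image_UN image_comp)
  have notD: "z \<notin> D \<longleftrightarrow> k z \<in> S2 - ?dr" for z
  proof -
    have "z \<in> h ` ?dr \<longleftrightarrow> k z \<in> ?dr" using hk'(1)[of z] hk'(2) drN by (metis image_iff subsetD)
    moreover have "k z \<in> S2" using kim by blast
    ultimately show ?thesis unfolding Ddr by blast
  qed
  define p where "p \<alpha> = h ` (\<alpha> - {N})" for \<alpha>
  have face: "connected \<alpha>" "\<alpha> \<subseteq> S2 - ?dr" if "\<alpha> \<in> ?F" for \<alpha>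
    using that in_components_connected in_components_subset unfolding faces_def by blast+
  have kp: "k ` p \<alpha> = \<alpha> - {N}" if "\<alpha> \<in> ?F" for \<alpha>
    using face(2)[OF that] hk' unfolding p_def by (force simp: image_iff)
  have p_comp: "p \<alpha> \<in> components (- D)" if a: "\<alpha> \<in> ?F" for \<alpha>
  proof (rule in_components_maximal[THEN iffD2], intro conjI allI impI)
    have "p \<alpha> \<noteq> {}" using punctured_face(2)[OF emb_facts a] by (simp add: p_def)
    then show "p \<alpha> \<noteq> {}" .
    show sub: "p \<alpha> \<subseteq> - D"
      using notD kp[OF a] face(2)[OF a] by blast
    have "\<alpha> - {N} \<subseteq> S2 - {N}" using face(2)[OF a] by blast
    then show "connected (p \<alpha>)"
      unfolding p_def using connected_continuous_image[OF continuous_on_subset[OF hc]] punctured_face(1)[OF emb_facts a] by blast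
    fix T assume T: "T \<noteq> {} \<and> p \<alpha> \<subseteq> T \<and> T \<subseteq> - D \<and> connected T"
    have "connected (k ` T)" using connected_continuous_image[OF continuous_on_subset[OF kc]] T by blast
    moreover have "k ` T \<subseteq> S2 - ?dr" using T notD by blast
    moreover have "\<alpha> \<inter> k ` T \<noteq> {}" using \<open>p \<alpha> \<noteq> {}\<close> T kp[OF a] by blast
    ultimately have "k ` T \<subseteq> \<alpha>" using components_maximal a unfolding faces_def by blast
    moreover have "N \<notin> k ` T" using kim by blast
    ultimately have "h ` k ` T \<subseteq> p \<alpha>" unfolding p_def by blast
    moreover have "h ` k ` T = T" by (simp add: image_image hk'(1))
    ultimately have "T \<subseteq> p \<alpha>" by simp
    then show "T = p \<alpha>" using T by (simp add: subset_antisym)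
  qed
  have p_inj: "inj_on p ?F"
  proof (rule inj_onI)
    fix \<alpha> \<beta> assume ab: "\<alpha> \<in> ?F" "\<beta> \<in> ?F" "p \<alpha> = p \<beta>"
    then have "\<alpha> - {N} = \<beta> - {N}" using kp by metis
    then have "\<alpha> \<inter> \<beta> \<noteq> {}" using punctured_face(2)[OF emb_facts ab(1), of N] by blast
    then show "\<alpha> = \<beta>" using ab(1,2) components_nonoverlap unfolding faces_def by blast
  qed
  have p_surj: "A \<in> p ` ?F" if A: "A \<in> components (- D)" for A
  proof -
    obtain z where z: "z \<in> A" using in_components_nonempty[OF A] by blast
    then have kz: "k z \<in> S2 - ?dr" using component_subset[OF A] notD by blast
    define \<alpha> where "\<alpha> = connected_component_set (S2 - ?dr) (k z)"
    have a: "\<alpha> \<in> ?F" unfolding \<alpha>_def faces_def using kz by (rule componentsI)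
    have "k z \<in> \<alpha>" using kz by (simp add: \<alpha>_def connected_component_refl)
    moreover have "k z \<noteq> N" using kim by blast
    ultimately have "z \<in> p \<alpha>" unfolding p_def using hk'(1)[of z] by (metis DiffI image_eqI singletonD)
    then have "A = p \<alpha>" using components_meet[OF A p_comp[OF a] z] by blast
    then show ?thesis using a by blast
  qed
  have clos: "h x \<in> closure (p \<alpha>) \<longleftrightarrow> x \<in> face_boundary \<alpha>" if a: "\<alpha> \<in> ?F" and x: "x \<in> ?dr" for x \<alpha>
  proof -
    have xN: "x \<in> S2 - {N}" using x drN by blast
    have sub: "\<alpha> - {N} \<subseteq> S2 - {N}" using face(2)[OF a] by blast
    have "x \<in> closure \<alpha> \<longleftrightarrow> x \<in> closure (\<alpha> - {N})"
      using closure_Un[of "\<alpha> - {N}" "{N}"] closure_mono[of "\<alpha> - {N}" \<alpha>] closure_mono[of \<alpha> "(\<alpha> - {N}) \<union> {N}"] xN by auto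
    also have "\<dots> \<longleftrightarrow> h x \<in> closure (p \<alpha>)"
    proof
      assume "x \<in> closure (\<alpha> - {N})"
      then show "h x \<in> closure (p \<alpha>)" unfolding p_def by (rule closure_continuous_image[OF hc xN sub])
    next
      assume "h x \<in> closure (p \<alpha>)"
      from closure_continuous_image[OF kc UNIV_I subset_UNIV this]
      show "x \<in> closure (\<alpha> - {N})" using kp[OF a] hk'(2)[OF xN] by simp
    qed
    finally show ?thesis using face_boundary_iff[OF emb_facts a x] by simp
  qed
  have clos_edge: "path_image (d i j) \<subseteq> closure (p \<alpha>) \<longleftrightarrow> path_image (\<gamma> i j) \<subseteq> face_boundary \<alpha>"
    if "\<alpha> \<in> ?F" "(i, j) \<in> parcs G" for \<alpha> i j
  proof -
    have "x \<in> path_image (\<gamma> i j) \<Longrightarrow> h x \<in> closure (p \<alpha>) \<longleftrightarrow> x \<in> face_boundary \<alpha>" for x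
      using clos[OF that(1)] path_image_drawing[OF emb_facts that(2)] by blast
    then show ?thesis unfolding im[OF that(2)] by blast
  qed
  have clos_vert: "i \<in> face_verts G \<phi> \<alpha> \<longleftrightarrow> i \<in> pverts G \<and> (h \<circ> \<phi>) i \<in> closure (p \<alpha>)" if "\<alpha> \<in> ?F" for \<alpha> i
    using clos[OF that, of "\<phi> i"] by (auto simp: face_verts_def drawing_def)
  define q where "q = inv_into ?F p"
  have q: "q A \<in> ?F" "p (q A) = A" if "A \<in> components (- D)" for A
    using p_surj[OF that] by (auto simp: q_def inv_into_into f_inv_into_f)
  have qp: "q (p \<alpha>) = \<alpha>" if "\<alpha> \<in> ?F" for \<alpha> using p_inj that by (simp add: q_def)
  define M where "M i j = q (L i j)" for i j
  have M: "M i j \<in> ?F" "p (M i j) = L i j" if "(i, j) \<in> parcs G" for i j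
    using q[OF L_component[OF that]] by (auto simp: M_def)
  have Meq: "M i j = \<alpha> \<longleftrightarrow> L i j = p \<alpha>" if "(i, j) \<in> parcs G" "\<alpha> \<in> ?F" for i j \<alpha>
    using M[OF that(1)] qp[OF that(2)] by (auto simp: M_def)
  have M_neq: "M i j \<noteq> M j i" if "(i, j) \<in> parcs G" for i j
    using L_neq[OF that] M(2)[OF that] M(2)[OF E_sym[OF that]] by metis
  have "face_structure G \<phi> \<gamma> M"
  proof (rule face_structure.intro)
    show "pair_graph G" by (rule pg)
    show "\<exists>j. (i, j) \<in> parcs G" if "i \<in> pverts G" for i using has_edge[OF that] .
    show "M i j \<in> ?F" if "(i, j) \<in> parcs G" for i j using M(1)[OF that] .
    show "M i j \<noteq> M j i" if "(i, j) \<in> parcs G" for i j using M_neq[OF that] .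
    show "{i, j} \<subseteq> face_verts G \<phi> (M i j)" if ij: "(i, j) \<in> parcs G" for i j
    proof -
      have "{(h \<circ> \<phi>) i, (h \<circ> \<phi>) j} \<subseteq> closure (L i j)"
        using L_closure[OF ij] start_d[OF ij] finish_d[OF ij]
          pathstart_in_path_image[of "d i j"] pathfinish_in_path_image[of "d i j"] by auto
      then show ?thesis using clos_vert[OF M(1)[OF ij]] M(2)[OF ij] E_V[OF ij] by auto
    qed
    show "dual_pair G \<phi> \<gamma> \<alpha> \<beta> i j \<longleftrightarrow> (i, j) \<in> parcs G \<and> {\<alpha>, \<beta>} = {M i j, M j i}" for \<alpha> \<beta> i j
    proof (cases "(i, j) \<in> parcs G")
      case ij: True
      have adj: "\<alpha> = M i j \<or> \<alpha> = M j i"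
        if a: "\<alpha> \<in> ?F" "path_image (\<gamma> i j) \<subseteq> face_boundary \<alpha>" for \<alpha>
      proof -
        have c: "path_image (d i j) \<subseteq> closure (p \<alpha>)" using clos_edge[OF a(1) ij] a(2) by blast
        have "d i j (1/2) \<in> path_image (d i j) - {(h \<circ> \<phi>) i, (h \<circ> \<phi>) j}"
          using arc_midpoint[OF arc_d[OF ij]] start_d[OF ij] finish_d[OF ij] by simp
        then have "p \<alpha> = L i j \<or> p \<alpha> = L j i"
          using component_at_open_edge[OF ij p_comp[OF a(1)]] c by blast
        then show ?thesis using Meq ij E_sym a(1) by metis
      qed
      have bd: "path_image (\<gamma> i j) \<subseteq> face_boundary (M i j)" "path_image (\<gamma> i j) \<subseteq> face_boundary (M j i)"
        using clos_edge[OF M(1)[OF ij] ij] clos_edge[OF M(1)[OF E_sym[OF ij]] ij] M(2) ij E_sym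
          L_closure[OF ij] L_closure[OF E_sym[OF ij]] image_rev[OF ij] by auto
      show ?thesis
        using adj bd M_neq[OF ij] M(1)[OF ij] M(1)[OF E_sym[OF ij]] ij
        unfolding dual_pair_def doubleton_eq_iff by metis
    qed (simp add: dual_pair_def)
    show "\<exists>i j. (i, j) \<in> parcs G \<and> \<alpha> = M i j" if a: "\<alpha> \<in> ?F" for \<alpha>
    proof -
      have "pverts G \<noteq> {}" using ex_edge[OF emb_facts] E_V by blast
      then obtain i j where "(i, j) \<in> parcs G" "p \<alpha> = L i j" using component_is_side[OF p_comp[OF a]] by blast
      then show ?thesis using Meq[OF _ a] by metis
    qed
    show "card {j. (i, j) \<in> parcs G \<and> M i j = \<alpha>} = card {j. (i, j) \<in> parcs G \<and> M j i = \<alpha>}"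
      if "i \<in> pverts G" "\<alpha> \<in> ?F" for i \<alpha>
    proof -
      have "{j. (i, j) \<in> parcs G \<and> M i j = \<alpha>} = {j. (i, j) \<in> parcs G \<and> L i j = p \<alpha>}"
        "{j. (i, j) \<in> parcs G \<and> M j i = \<alpha>} = {j. (i, j) \<in> parcs G \<and> L j i = p \<alpha>}"
        using Meq that(2) E_sym by blast+
      then show ?thesis using sides_balanced[OF that(1) p_comp[OF that(2)]] by simp
    qed
    show "\<alpha> \<in> P \<longleftrightarrow> \<beta> \<in> P"
      if "i \<in> pverts G" "\<And>j. (i, j) \<in> parcs G \<Longrightarrow> M i j \<in> P \<longleftrightarrow> M j i \<in> P"
        "\<alpha> \<in> ?F" "i \<in> face_verts G \<phi> \<alpha>" "\<beta> \<in> ?F" "i \<in> face_verts G \<phi> \<beta>" for i P \<alpha> \<beta>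
    proof -
      have "p \<alpha> \<in> q -` P \<longleftrightarrow> p \<beta> \<in> q -` P"
        by (rule components_at_vertex_linked[OF that(1)])
          (use that clos_vert p_comp in \<open>auto simp: M_def\<close>)
      then show ?thesis using qp that(3,5) by simp
    qed
    show "\<exists>s. (\<forall>\<alpha>\<in>?F. s \<alpha> \<noteq> (0 :: complex)) \<and> (\<forall>(i, j)\<in>parcs G. s (M i j) = r i j * s (M j i))"
      if "\<And>i j. (i, j) \<in> parcs G \<Longrightarrow> r i j \<noteq> 0" "\<And>i j. (i, j) \<in> parcs G \<Longrightarrow> r j i = 1 / r i j"
        "\<And>i. i \<in> pverts G \<Longrightarrow> (\<Prod>j | (i, j) \<in> parcs G. r i j) = 1" for r
    proof (rule exactness[OF that])
      fix s :: "complex set \<Rightarrow> complex"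
      assume s: "\<And>A. A \<in> components (- D) \<Longrightarrow> s A \<noteq> 0"
        "\<And>i j. (i, j) \<in> parcs G \<Longrightarrow> s (L i j) = r i j * s (L j i)"
      show ?thesis
      proof (intro exI[of _ "s \<circ> p"] conjI ballI)
        show "(s \<circ> p) \<alpha> \<noteq> 0" if "\<alpha> \<in> ?F" for \<alpha> using s(1)[OF p_comp[OF that]] by simp
        fix e assume "e \<in> parcs G"
        then obtain i j where e: "e = (i, j)" "(i, j) \<in> parcs G" by (cases e) auto
        then show "case e of (i, j) \<Rightarrow> (s \<circ> p) (M i j) = r i j * (s \<circ> p) (M j i)"
          using s(2)[OF e(2)] M(2)[OF e(2)] M(2)[OF E_sym[OF e(2)]] by simp
      qed
    qed
  qed
  then show thesis by (rule that)
qed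

section \<open>Planes in space\<close>

lemma coplanar_iff_hyperplane:
  fixes S :: "(real^3) set"
  shows "coplanar S \<longleftrightarrow> (\<exists>n c. n \<noteq> 0 \<and> (\<forall>x\<in>S. n \<bullet> x = c))"
proof
  assume "coplanar S"
  then obtain u v w where S: "S \<subseteq> affine hull {u, v, w}" unfolding coplanar_def by blast
  have "aff_dim S \<le> aff_dim {u, v, w}" using aff_dim_subset[OF S] by simp
  also have "\<dots> \<le> int (card {u, v, w}) - 1" by (rule aff_dim_le_card) simp
  also have "\<dots> < DIM(real^3)" using card_insert_le_m1[of 3 "{v, w}" u] by (simp add: card_insert_if)
  finally obtain n c where "n \<noteq> 0" "S \<subseteq> {x. n \<bullet> x = c}"
    using aff_lowdim_subset_hyperplane[of S] by metis
  then show "\<exists>n c. n \<noteq> 0 \<and> (\<forall>x\<in>S. n \<bullet> x = c)" by blast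
next
  assume "\<exists>n c. n \<noteq> 0 \<and> (\<forall>x\<in>S. n \<bullet> x = c)"
  then obtain n :: "real^3" and c where n: "n \<noteq> 0" "S \<subseteq> {x. n \<bullet> x = c}" by blast
  obtain B where B: "affine hull B = affine hull {x. n \<bullet> x = c}" "int (card B) = aff_dim {x. n \<bullet> x = c} + 1"
    using aff_dim_basis_exists by metis
  have "card B = 3" using B(2) n(1) by (simp add: aff_dim_hyperplane)
  then obtain u v w where "B = {u, v, w}" by (metis card_3_iff)
  then show "coplanar S" unfolding coplanar_def using B(1) n(2) hull_subset[of "{x. n \<bullet> x = c}" affine] by blast
qed

text \<open>
  If the points of \<open>S\<close> did not span the plane, they would lie in a second plane together with a point
  \<open>y\<close> off the first one.
\<close>

lemma affine_hull_eq_hyperplane: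
  fixes S :: "(real^3) set"
  assumes n: "n \<noteq> 0" "\<And>x. x \<in> S \<Longrightarrow> n \<bullet> x = c"
    and unique: "\<And>n' c'. (\<And>x. x \<in> S \<Longrightarrow> n' \<bullet> x = c') \<Longrightarrow> \<exists>t. n' = t *\<^sub>R n \<and> c' = t * c"
  shows "affine hull S = {x. n \<bullet> x = c}"
proof -
  have sub: "S \<subseteq> {x. n \<bullet> x = c}" using n(2) by blast
  have "2 \<le> aff_dim S"
  proof (rule ccontr)
    assume "\<not> 2 \<le> aff_dim S"
    define y where "y = ((c + 1) / (n \<bullet> n)) *\<^sub>R n"
    have y: "n \<bullet> y = c + 1" using n(1) by (simp add: y_def)
    have "aff_dim (insert y S) < DIM(real^3)" using \<open>\<not> 2 \<le> aff_dim S\<close> by (simp add: aff_dim_insert)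
    then obtain n' c' where n': "n' \<noteq> 0" "insert y S \<subseteq> {x. n' \<bullet> x = c'}"
      using aff_lowdim_subset_hyperplane by blast
    then obtain t where t: "n' = t *\<^sub>R n" "c' = t * c" using unique[of n' c'] by blast
    have "n' \<bullet> y = c'" using n'(2) by blast
    then have "t * (c + 1) = t * c" using t y by simp
    then show False using n'(1) t by (simp add: algebra_simps)
  qed
  moreover have "aff_dim S \<le> aff_dim {x. n \<bullet> x = c}" by (rule aff_dim_subset[OF sub])
  ultimately have dim: "aff_dim (affine hull S) = aff_dim {x. n \<bullet> x = c}" using n(1) by (simp add: aff_dim_hyperplane)
  have "affine hull S \<subseteq> {x. n \<bullet> x = c}" by (rule hull_minimal[OF sub]) (rule affine_hyperplane)
  moreover have "S \<noteq> {}" using \<open>2 \<le> aff_dim S\<close> by auto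
  ultimately show ?thesis
    by (intro affine_dim_equal dim affine_hyperplane affine_affine_hull) auto
qed

lemma orthogonal_to_both_imp_multiple_cross3:
  assumes "u \<bullet> a = 0" "u \<bullet> b = 0" and nz: "cross3 a b \<noteq> 0"
  shows "u = ((u \<bullet> cross3 a b) / (cross3 a b \<bullet> cross3 a b)) *\<^sub>R cross3 a b"
proof -
  let ?c = "cross3 a b"
  have "cross3 u ?c = 0" using assms by (simp add: Lagrange)
  then have "cross3 ?c (cross3 u ?c) = 0" by (simp add: cross_zero_right)
  moreover have "cross3 ?c (cross3 u ?c) = (?c \<bullet> ?c) *\<^sub>R u - (?c \<bullet> u) *\<^sub>R ?c" by (rule Lagrange)
  ultimately have "(?c \<bullet> ?c) *\<^sub>R u = (?c \<bullet> u) *\<^sub>R ?c" by simp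
  then have "(1 / (?c \<bullet> ?c)) *\<^sub>R (?c \<bullet> ?c) *\<^sub>R u = (1 / (?c \<bullet> ?c)) *\<^sub>R (?c \<bullet> u) *\<^sub>R ?c" by simp
  then show ?thesis using nz by (simp add: inner_commute)
qed


section \<open>Covectors of faces\<close>

text \<open>
  The form common to the self-stresses of the three geometries.
\<close>

definition equilibrium :: "('a \<times> 'a) set \<Rightarrow> ('a \<Rightarrow> real^3) \<Rightarrow> ('a \<Rightarrow> 'a \<Rightarrow> real) \<Rightarrow> bool" where
  "equilibrium E P w \<longleftrightarrow> (\<forall>(i, j)\<in>E. w i j = w j i \<and> w i j \<noteq> 0) \<and>
     (\<forall>i. (\<Sum>j | (i, j) \<in> E. w i j *\<^sub>R cross3 (P i) (P j)) = 0)"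

context face_structure
begin

abbreviation V where "V \<equiv> pverts G"
abbreviation E where "E \<equiv> parcs G"
abbreviation F where "F \<equiv> faces G \<phi> \<gamma>"
abbreviation fv where "fv \<equiv> face_verts G \<phi>"

lemmas E_V = pair_graph_simple(2)[OF pg, THEN subsetD]
lemmas E_sym = pair_graph_simple(4)[OF pg]

lemma E_VD: "(i, j) \<in> E \<Longrightarrow> i \<in> V" "(i, j) \<in> E \<Longrightarrow> j \<in> V"
  using E_V by auto

lemma finite_V: "finite V" by (rule pair_graph_simple(1)[OF pg])

lemma finite_E: "finite E"
  using finite_V pair_graph_simple(2)[OF pg] by (meson finite_SigmaI finite_subset)

lemma finite_nbrs: "finite {j. (i, j) \<in> E}"
  by (rule finite_subset[OF _ finite_V]) (auto dest: E_VD)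

lemma finite_F: "finite F"
proof -
  have "F \<subseteq> (\<lambda>(i, j). L i j) ` E" using face_is_side by force
  then show ?thesis using finite_E finite_subset by blast
qed

lemma fv_L: "(i, j) \<in> E \<Longrightarrow> i \<in> fv (L i j)" "(i, j) \<in> E \<Longrightarrow> j \<in> fv (L i j)"
  "(i, j) \<in> E \<Longrightarrow> i \<in> fv (L j i)" "(i, j) \<in> E \<Longrightarrow> j \<in> fv (L j i)"
  using verts_L E_sym by blast+

lemma fv_V: "i \<in> fv \<alpha> \<Longrightarrow> i \<in> V" by (simp add: face_verts_def)

lemma fv_nonempty: "\<alpha> \<in> F \<Longrightarrow> \<exists>i. i \<in> fv \<alpha>"
  using face_is_side fv_L by metis

lemma dual_edge_iff: "(\<alpha>, \<beta>) \<in> parcs (dual_graph G \<phi> \<gamma>) \<longleftrightarrow> (\<exists>i j. (i, j) \<in> E \<and> \<alpha> = L i j \<and> \<beta> = L j i)"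
proof -
  have "(\<exists>i j. dual_pair G \<phi> \<gamma> \<alpha> \<beta> i j) \<longleftrightarrow> (\<exists>i j. (i, j) \<in> E \<and> \<alpha> = L i j \<and> \<beta> = L j i)"
    unfolding dual_pair_iff doubleton_eq_iff using E_sym by blast
  then show ?thesis by (simp add: dual_graph_def)
qed

lemma dual_pair_cases:
  assumes "dual_pair G \<phi> \<gamma> \<alpha> \<beta> i j"
  shows "(i, j) \<in> E \<and> (\<alpha> = L i j \<and> \<beta> = L j i \<or> \<alpha> = L j i \<and> \<beta> = L i j)"
  using assms unfolding dual_pair_iff doubleton_eq_iff by blast

lemma dual_pair_L: "(i, j) \<in> E \<Longrightarrow> dual_pair G \<phi> \<gamma> (L i j) (L j i) i j"
  unfolding dual_pair_iff by blast

lemma balanced_mset: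
  assumes "i \<in> V"
  shows "image_mset (L i) (mset_set {j. (i, j) \<in> E}) = image_mset (\<lambda>j. L j i) (mset_set {j. (i, j) \<in> E})"
proof (rule multiset_eqI)
  fix \<alpha>
  have count: "count (image_mset f (mset_set {j. (i, j) \<in> E})) \<alpha> = card {j. (i, j) \<in> E \<and> f j = \<alpha>}" for f :: "'a \<Rightarrow> (real^3) set"
  proof -
    have "{x. x \<in># mset_set {j. (i, j) \<in> E} \<and> \<alpha> = f x} = {j. (i, j) \<in> E \<and> f j = \<alpha>}"
      using finite_nbrs by auto
    then show ?thesis unfolding count_image_mset' using finite_nbrs by (simp add: count_mset_set')
  qed
  show "count (image_mset (L i) (mset_set {j. (i, j) \<in> E})) \<alpha> = count (image_mset (\<lambda>j. L j i) (mset_set {j. (i, j) \<in> E})) \<alpha>"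
  proof (cases "\<alpha> \<in> F")
    case True
    then show ?thesis unfolding count by (rule balanced[OF assms])
  next
    case False
    then have "{j. (i, j) \<in> E \<and> L i j = \<alpha>} = {}" "{j. (i, j) \<in> E \<and> L j i = \<alpha>} = {}"
      using L_face E_sym by blast+
    then show ?thesis by (simp only: count)
  qed
qed

lemma balanced_sum:
  assumes "i \<in> V"
  shows "(\<Sum>j | (i, j) \<in> E. m (L i j)) = (\<Sum>j | (i, j) \<in> E. m (L j i))"
proof -
  have "image_mset m (image_mset (L i) (mset_set {j. (i, j) \<in> E})) = image_mset m (image_mset (\<lambda>j. L j i) (mset_set {j. (i, j) \<in> E}))"
    using balanced_mset[OF assms] by simp
  then show ?thesis by (simp add: sum_unfold_sum_mset image_mset.compositionality comp_def)
qed

lemma balanced_prod: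
  assumes "i \<in> V"
  shows "(\<Prod>j | (i, j) \<in> E. m (L i j)) = (\<Prod>j | (i, j) \<in> E. m (L j i))"
proof -
  have "image_mset m (image_mset (L i) (mset_set {j. (i, j) \<in> E})) = image_mset m (image_mset (\<lambda>j. L j i) (mset_set {j. (i, j) \<in> E}))"
    using balanced_mset[OF assms] by simp
  then show ?thesis by (simp add: prod_unfold_prod_mset image_mset.compositionality comp_def)
qed

text \<open>
  The multiplicative statement for \<open>exp \<omega>\<close>, followed by the logarithm of the modulus.
\<close>

lemma additive_exact:
  fixes \<omega> :: "'a \<Rightarrow> 'a \<Rightarrow> real"
  assumes anti: "\<And>i j. (i, j) \<in> E \<Longrightarrow> \<omega> j i = - \<omega> i j"
    and closed: "\<And>i. i \<in> V \<Longrightarrow> (\<Sum>j | (i, j) \<in> E. \<omega> i j) = 0"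
  shows "\<exists>m. \<forall>(i, j)\<in>E. m (L i j) = \<omega> i j + m (L j i)"
proof -
  have "\<exists>s. (\<forall>\<alpha>\<in>F. s \<alpha> \<noteq> (0 :: complex)) \<and> (\<forall>(i, j)\<in>E. s (L i j) = exp (of_real (\<omega> i j)) * s (L j i))"
  proof (rule exact)
    show "exp (of_real (\<omega> j i)) = 1 / exp (of_real (\<omega> i j) :: complex)" if "(i, j) \<in> E" for i j
      using anti[OF that] by (simp add: exp_minus inverse_eq_divide)
    show "(\<Prod>j | (i, j) \<in> E. exp (of_real (\<omega> i j) :: complex)) = 1" if "i \<in> V" for i
      using closed[OF that] by (simp flip: exp_sum[OF finite_nbrs] of_real_sum)
  qed simp
  then obtain s where s: "\<And>\<alpha>. \<alpha> \<in> F \<Longrightarrow> s \<alpha> \<noteq> (0 :: complex)"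
    "\<And>i j. (i, j) \<in> E \<Longrightarrow> s (L i j) = exp (of_real (\<omega> i j)) * s (L j i)" by blast
  have "ln (norm (s (L i j))) = \<omega> i j + ln (norm (s (L j i)))" if "(i, j) \<in> E" for i j
  proof -
    have "norm (s (L i j)) = exp (\<omega> i j) * norm (s (L j i))" using s(2)[OF that] by (simp add: norm_mult)
    moreover have "norm (s (L j i)) > 0" using s(1)[OF L_face[OF E_sym[OF that]]] by simp
    ultimately show ?thesis by (simp add: ln_mult)
  qed
  then show ?thesis by (intro exI[of _ "\<lambda>\<alpha>. ln (norm (s \<alpha>))"]) auto
qed

lemma additive_exact_vec:
  fixes \<omega> :: "'a \<Rightarrow> 'a \<Rightarrow> real^'n"
  assumes anti: "\<And>i j. (i, j) \<in> E \<Longrightarrow> \<omega> j i = - \<omega> i j"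
    and closed: "\<And>i. i \<in> V \<Longrightarrow> (\<Sum>j | (i, j) \<in> E. \<omega> i j) = 0"
  shows "\<exists>m. \<forall>(i, j)\<in>E. m (L i j) = \<omega> i j + m (L j i)"
proof -
  have "\<forall>k. \<exists>m. \<forall>(i, j)\<in>E. m (L i j) = \<omega> i j $ k + m (L j i)"
  proof
    fix k
    show "\<exists>m. \<forall>(i, j)\<in>E. m (L i j) = \<omega> i j $ k + m (L j i)"
    proof (rule additive_exact)
      show "(\<Sum>j | (i, j) \<in> E. \<omega> i j $ k) = 0" if "i \<in> V" for i
        using closed[OF that] by (metis sum_component zero_index)
    qed (simp add: anti)
  qed
  then obtain m where "\<forall>k. \<forall>(i, j)\<in>E. m k (L i j) = \<omega> i j $ k + m k (L j i)"
    by (rule choice[THEN exE])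
  then have m: "\<And>k. \<forall>(i, j)\<in>E. m k (L i j) = \<omega> i j $ k + m k (L j i)" by (rule spec)
  show ?thesis
  proof (intro exI[of _ "\<lambda>\<alpha>. \<chi> k. m k \<alpha>"] ballI)
    fix e assume "e \<in> E"
    then obtain i j where e: "e = (i, j)" "(i, j) \<in> E" by (cases e) auto
    then have "m k (L i j) = \<omega> i j $ k + m k (L j i)" for k using m[of k] by blast
    then show "case e of (i, j) \<Rightarrow> (\<chi> k. m k (L i j)) = \<omega> i j + (\<chi> k. m k (L j i))"
      unfolding e prod.case vec_eq_iff by simp
  qed
qed

text \<open>
  For real coefficients the complex factors \<open>s \<alpha>\<close> are made real by \<open>r\<close>, a map that preserves
  real ratios, including their signs.
\<close>

lemma multiplicative_exact:
  fixes \<rho> :: "'a \<Rightarrow> 'a \<Rightarrow> real"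
  assumes nz: "\<And>i j. (i, j) \<in> E \<Longrightarrow> \<rho> i j \<noteq> 0"
    and anti: "\<And>i j. (i, j) \<in> E \<Longrightarrow> \<rho> j i = 1 / \<rho> i j"
    and closed: "\<And>i. i \<in> V \<Longrightarrow> (\<Prod>j | (i, j) \<in> E. \<rho> i j) = 1"
  shows "\<exists>s. (\<forall>\<alpha>\<in>F. s \<alpha> \<noteq> 0) \<and> (\<forall>(i, j)\<in>E. s (L i j) = \<rho> i j * s (L j i))"
proof -
  have "\<exists>s. (\<forall>\<alpha>\<in>F. s \<alpha> \<noteq> (0 :: complex)) \<and> (\<forall>(i, j)\<in>E. s (L i j) = of_real (\<rho> i j) * s (L j i))"
    using assms by (intro exact) (simp_all flip: of_real_prod)
  then obtain s where s: "\<And>\<alpha>. \<alpha> \<in> F \<Longrightarrow> s \<alpha> \<noteq> (0 :: complex)"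
    "\<And>i j. (i, j) \<in> E \<Longrightarrow> s (L i j) = of_real (\<rho> i j) * s (L j i)" by blast
  \<comment> \<open>the sign tells the two halves of each real line through zero apart\<close>
  define r where "r z = (if Im z > 0 \<or> Im z = 0 \<and> Re z > 0 then norm z else - norm z)" for z
  have r_nz: "r z \<noteq> 0" if "z \<noteq> 0" for z using that by (simp add: r_def)
  have r_mult: "r (of_real t * z) = t * r z" if "t \<noteq> 0" "z \<noteq> 0" for t z
  proof (cases "t > 0")
    case True
    then show ?thesis by (auto simp: r_def norm_mult zero_less_mult_iff)
  next
    case False
    then have "t < 0" using that by simp
    moreover have "Im z = 0 \<Longrightarrow> Re z \<noteq> 0" using that(2) by (auto simp: complex_eq_iff)
    ultimately show ?thesis by (auto simp: r_def norm_mult zero_less_mult_iff)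
  qed
  show ?thesis
  proof (intro exI[of _ "\<lambda>\<alpha>. r (s \<alpha>)"] conjI ballI)
    show "r (s \<alpha>) \<noteq> 0" if "\<alpha> \<in> F" for \<alpha> using r_nz s(1)[OF that] .
    fix e assume "e \<in> E"
    then obtain i j where e: "e = (i, j)" "(i, j) \<in> E" by (cases e) auto
    have "s (L j i) \<noteq> 0" using s(1)[OF L_face[OF E_sym[OF e(2)]]] .
    then show "case e of (i, j) \<Rightarrow> r (s (L i j)) = \<rho> i j * r (s (L j i))"
      using s(2)[OF e(2)] r_mult[OF nz[OF e(2)]] by (simp add: e(1))
  qed
qed

text \<open>
  For the homogeneous coordinates \<open>P\<close> of points of the Euclidean plane, these are affine functions
  whose graphs over the faces fit together along the edges, with a crease at every edge.
\<close>

definition covectors :: "('a \<Rightarrow> real^3) \<Rightarrow> ((real^3) set \<Rightarrow> real^3) \<Rightarrow> bool" where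
  "covectors P M \<longleftrightarrow> (\<forall>(i, j)\<in>E. M (L i j) \<noteq> M (L j i) \<and>
     M (L i j) \<bullet> P i = M (L j i) \<bullet> P i \<and> M (L i j) \<bullet> P j = M (L j i) \<bullet> P j)"

lemma covectorsD:
  assumes "covectors P M" "(i, j) \<in> E"
  shows "M (L i j) \<noteq> M (L j i)" "M (L i j) \<bullet> P i = M (L j i) \<bullet> P i" "M (L i j) \<bullet> P j = M (L j i) \<bullet> P j"
  using assms unfolding covectors_def by blast+

text \<open>
  Weights and covectors determine each other by
  \<open>M (L i j) - M (L j i) = w i j * (P i \<times> P j)\<close>: a vector orthogonal to \<open>P i\<close> and \<open>P j\<close> is a
  multiple of \<open>P i \<times> P j\<close>, and the sum of the left hand sides at \<open>i\<close> vanishes because boundaries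
  are balanced, whereas exactness solves the equation for \<open>M\<close>.
\<close>

theorem equilibrium_iff_covectors:
  assumes indep: "\<And>i j. (i, j) \<in> E \<Longrightarrow> cross3 (P i) (P j) \<noteq> 0"
  shows "(\<exists>w. equilibrium E P w) \<longleftrightarrow> (\<exists>M. covectors P M)"
proof
  assume "\<exists>w. equilibrium E P w"
  then obtain w where w: "\<And>i j. (i, j) \<in> E \<Longrightarrow> w i j = w j i \<and> w i j \<noteq> 0"
    "\<And>i. (\<Sum>j | (i, j) \<in> E. w i j *\<^sub>R cross3 (P i) (P j)) = 0" unfolding equilibrium_def by blast
  have "\<exists>M. \<forall>(i, j)\<in>E. M (L i j) = w i j *\<^sub>R cross3 (P i) (P j) + M (L j i)"
  proof (rule additive_exact_vec)
    show "w j i *\<^sub>R cross3 (P j) (P i) = - (w i j *\<^sub>R cross3 (P i) (P j))" if "(i, j) \<in> E" for i j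
      using w(1)[OF that] cross_skew[of "P i" "P j"] by simp
  qed (rule w(2))
  then obtain M where M: "\<And>i j. (i, j) \<in> E \<Longrightarrow> M (L i j) = w i j *\<^sub>R cross3 (P i) (P j) + M (L j i)" by blast
  have "covectors P M"
    unfolding covectors_def using M w(1) indep by (auto simp: inner_add_left dot_cross_self)
  then show "\<exists>M. covectors P M" by blast
next
  assume "\<exists>M. covectors P M"
  then obtain M where M: "covectors P M" by blast
  define w where "w i j = ((M (L i j) - M (L j i)) \<bullet> cross3 (P i) (P j)) / (cross3 (P i) (P j) \<bullet> cross3 (P i) (P j))" for i j
  have w: "M (L i j) - M (L j i) = w i j *\<^sub>R cross3 (P i) (P j)" if "(i, j) \<in> E" for i j
    unfolding w_def using covectorsD[OF M that] indep[OF that]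
    by (intro orthogonal_to_both_imp_multiple_cross3) (auto simp: inner_diff_left)
  have "w i j = w j i" for i j
    using cross_skew[of "P j" "P i"] by (simp add: w_def algebra_simps)
  moreover have "w i j \<noteq> 0" if "(i, j) \<in> E" for i j
    using w[OF that] covectorsD(1)[OF M that] by auto
  moreover have "(\<Sum>j | (i, j) \<in> E. w i j *\<^sub>R cross3 (P i) (P j)) = 0" for i
  proof (cases "i \<in> V")
    case True
    have "(\<Sum>j | (i, j) \<in> E. w i j *\<^sub>R cross3 (P i) (P j)) = (\<Sum>j | (i, j) \<in> E. M (L i j) - M (L j i))"
      by (rule sum.cong[OF refl]) (use w in auto)
    also have "\<dots> = 0" using balanced_sum[OF True, of M] by (simp add: sum_subtractf)
    finally show ?thesis .
  next
    case False
    then have "{j. (i, j) \<in> E} = {}" using E_VD by blast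
    then show ?thesis by simp
  qed
  ultimately have "equilibrium E P w" unfolding equilibrium_def by blast
  then show "\<exists>w. equilibrium E P w" by blast
qed

text \<open>
  The faces at \<open>i\<close> whose product with \<open>P i\<close> has a given value are closed under crossing edges at
  \<open>i\<close>, so that \<open>linked\<close> applies.
\<close>

lemma covectors_heights:
  assumes M: "covectors P M"
  obtains h where "\<And>\<alpha> i. \<alpha> \<in> F \<Longrightarrow> i \<in> fv \<alpha> \<Longrightarrow> M \<alpha> \<bullet> P i = h i"
proof -
  define h where "h i = M (L i (SOME j. (i, j) \<in> E)) \<bullet> P i" for i
  have "M \<alpha> \<bullet> P i = h i" if a: "\<alpha> \<in> F" "i \<in> fv \<alpha>" for \<alpha> i
  proof -
    define j where "j = (SOME j. (i, j) \<in> E)"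
    have j: "(i, j) \<in> E" unfolding j_def using has_edge[OF fv_V[OF a(2)]] by (rule someI_ex)
    have "\<alpha> \<in> {\<alpha>. M \<alpha> \<bullet> P i = h i} \<longleftrightarrow> L i j \<in> {\<alpha>. M \<alpha> \<bullet> P i = h i}"
      by (rule linked[OF fv_V[OF a(2)]]) (use a j fv_L(1)[OF j] L_face[OF j] covectorsD(2)[OF M] in auto)
    then show ?thesis by (simp add: h_def j_def)
  qed
  then show thesis using that by blast
qed

text \<open>
  Factors \<open>s \<alpha>\<close> are sought for which the vectors \<open>s \<alpha> * m \<alpha>\<close> are covectors. Equal products
  with \<open>P i\<close> prescribe the ratio \<open>\<rho> i j\<close> of the factors of the two faces at \<open>ij\<close>, and by \<open>det\<close> the
  products with \<open>P j\<close> prescribe the same ratio. At a vertex \<open>i\<close> the product of these ratios is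
  trivial, because \<open>\<rho> i j\<close> is the ratio of the numbers \<open>m \<alpha> \<bullet> P i\<close> of the two faces.
\<close>

lemma covectors_of_directions:
  assumes nz: "\<And>\<alpha> i. \<alpha> \<in> F \<Longrightarrow> i \<in> fv \<alpha> \<Longrightarrow> m \<alpha> \<bullet> P i \<noteq> 0"
    and det: "\<And>i j. (i, j) \<in> E \<Longrightarrow>
      (m (L i j) \<bullet> P i) * (m (L j i) \<bullet> P j) = (m (L i j) \<bullet> P j) * (m (L j i) \<bullet> P i)"
    and indep: "\<And>i j c. (i, j) \<in> E \<Longrightarrow> m (L i j) \<noteq> c *\<^sub>R m (L j i)"
  shows "\<exists>M. covectors P M"
proof -
  define \<rho> where "\<rho> i j = (m (L j i) \<bullet> P i) / (m (L i j) \<bullet> P i)" for i j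
  have ne: "m (L i j) \<bullet> P i \<noteq> 0" "m (L j i) \<bullet> P i \<noteq> 0" "m (L i j) \<bullet> P j \<noteq> 0" "m (L j i) \<bullet> P j \<noteq> 0"
    if "(i, j) \<in> E" for i j
    using nz fv_L[OF that] L_face that E_sym by blast+
  have "\<exists>s. (\<forall>\<alpha>\<in>F. s \<alpha> \<noteq> 0) \<and> (\<forall>(i, j)\<in>E. s (L i j) = \<rho> i j * s (L j i))"
  proof (rule multiplicative_exact)
    show "\<rho> i j \<noteq> 0" if "(i, j) \<in> E" for i j using ne[OF that] by (simp add: \<rho>_def)
    show "\<rho> j i = 1 / \<rho> i j" if "(i, j) \<in> E" for i j
      using ne[OF that] det[OF that] by (simp add: \<rho>_def field_simps)
    show "(\<Prod>j | (i, j) \<in> E. \<rho> i j) = 1" if "i \<in> V" for i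
    proof -
      have "(\<Prod>j | (i, j) \<in> E. m (L i j) \<bullet> P i) \<noteq> 0" using finite_nbrs ne by simp
      then show ?thesis unfolding \<rho>_def prod_dividef using balanced_prod[OF that, of "\<lambda>\<alpha>. m \<alpha> \<bullet> P i"] by simp
    qed
  qed
  then obtain s where s: "\<And>\<alpha>. \<alpha> \<in> F \<Longrightarrow> s \<alpha> \<noteq> 0" "\<And>i j. (i, j) \<in> E \<Longrightarrow> s (L i j) = \<rho> i j * s (L j i)" by blast
  have "covectors P (\<lambda>\<alpha>. s \<alpha> *\<^sub>R m \<alpha>)"
    unfolding covectors_def
  proof (intro ballI, clarify, intro conjI)
    fix i j assume ij: "(i, j) \<in> E"
    have sL: "s (L i j) \<noteq> 0" using s(1)[OF L_face[OF ij]] .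
    show "s (L i j) *\<^sub>R m (L i j) \<noteq> s (L j i) *\<^sub>R m (L j i)"
    proof
      assume "s (L i j) *\<^sub>R m (L i j) = s (L j i) *\<^sub>R m (L j i)"
      then have "(1 / s (L i j)) *\<^sub>R s (L i j) *\<^sub>R m (L i j) = (1 / s (L i j)) *\<^sub>R s (L j i) *\<^sub>R m (L j i)" by simp
      then have "m (L i j) = (s (L j i) / s (L i j)) *\<^sub>R m (L j i)" using sL by simp
      then show False using indep[OF ij] by blast
    qed
    show "s (L i j) *\<^sub>R m (L i j) \<bullet> P i = s (L j i) *\<^sub>R m (L j i) \<bullet> P i"
      using s(2)[OF ij] ne[OF ij] by (simp add: \<rho>_def)
    show "s (L i j) *\<^sub>R m (L i j) \<bullet> P j = s (L j i) *\<^sub>R m (L j i) \<bullet> P j"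
    proof -
      have "s (L i j) * (m (L i j) \<bullet> P i) = s (L j i) * (m (L j i) \<bullet> P i)"
        using s(2)[OF ij] ne[OF ij] by (simp add: \<rho>_def)
      with det[OF ij] have "(m (L j i) \<bullet> P i) * (s (L i j) * (m (L i j) \<bullet> P j)) = (m (L j i) \<bullet> P i) * (s (L j i) * (m (L j i) \<bullet> P j))"
        by algebra
      then show ?thesis using ne[OF ij] by simp
    qed
  qed
  then show ?thesis by blast
qed

text \<open>
  The lifted vertices of \<open>\<alpha>\<close> lie in the plane of equation \<open>M \<alpha> \<bullet> x = t\<close>. If neighbouring faces
  had the same plane, the difference of their covectors would vanish on all vertices of one of them.
\<close>

lemma covectors_imp_polyhedral:
  assumes nondeg: "\<And>\<alpha> n. \<alpha> \<in> F \<Longrightarrow> (\<And>i. i \<in> fv \<alpha> \<Longrightarrow> n \<bullet> P i = 0) \<Longrightarrow> n = 0"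
    and M: "covectors P M" and t: "t \<noteq> 0"
    and q: "\<And>\<alpha> i. \<alpha> \<in> F \<Longrightarrow> i \<in> fv \<alpha> \<Longrightarrow> q i = a i *\<^sub>R P i \<and> a i \<noteq> 0 \<and> M \<alpha> \<bullet> q i = t"
  shows "polyhedral G \<phi> \<gamma> q" "\<And>\<alpha>. \<alpha> \<in> F \<Longrightarrow> face_plane G \<phi> q \<alpha> \<subseteq> {x. M \<alpha> \<bullet> x = t}"
proof -
  show plane: "face_plane G \<phi> q \<alpha> \<subseteq> {x. M \<alpha> \<bullet> x = t}" if "\<alpha> \<in> F" for \<alpha>
    unfolding face_plane_def
  proof (rule hull_minimal)
    show "q ` fv \<alpha> \<subseteq> {x. M \<alpha> \<bullet> x = t}" using q[OF that] by blast
  qed (rule affine_hyperplane)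
  show "polyhedral G \<phi> \<gamma> q"
    unfolding polyhedral_def
  proof (intro conjI ballI)
    fix \<alpha> assume a: "\<alpha> \<in> F"
    then have "M \<alpha> \<noteq> 0" using q t fv_nonempty by fastforce
    moreover have "\<forall>x\<in>q ` fv \<alpha>. M \<alpha> \<bullet> x = t" using q[OF a] by blast
    ultimately show "coplanar (q ` fv \<alpha>)"
      unfolding coplanar_iff_hyperplane by blast
  next
    fix e assume "e \<in> parcs (dual_graph G \<phi> \<gamma>)"
    then obtain i j where e: "e = (L i j, L j i)" and ij: "(i, j) \<in> E"
      by (cases e) (auto simp: dual_edge_iff)
    have F: "L i j \<in> F" "L j i \<in> F" using L_face ij E_sym by auto
    show "case e of (\<alpha>, \<beta>) \<Rightarrow> face_plane G \<phi> q \<alpha> \<noteq> face_plane G \<phi> q \<beta>"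
      unfolding e prod.case
    proof
      assume eq: "face_plane G \<phi> q (L i j) = face_plane G \<phi> q (L j i)"
      have "(M (L i j) - M (L j i)) \<bullet> P k = 0" if k: "k \<in> fv (L i j)" for k
      proof -
        have "q k \<in> face_plane G \<phi> q (L i j)" using k by (simp add: face_plane_def hull_inc)
        then have "M (L j i) \<bullet> q k = t" using eq plane[OF F(2)] by blast
        then show ?thesis using q[OF F(1) k] by (auto simp: inner_diff_left)
      qed
      then show False using nondeg[OF F(1), of "M (L i j) - M (L j i)"] covectorsD(1)[OF M ij] by auto
    qed
  qed
qed

text \<open>
  Since the vectors \<open>P i\<close> of a face span the space, the plane of its lifted vertices does not
  contain the origin. The covector is the left hand side of its unique equation
  \<open>M \<alpha> \<bullet> x = 1\<close>.
\<close>

lemma polyhedral_imp_covectors: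
  assumes nondeg: "\<And>\<alpha> n. \<alpha> \<in> F \<Longrightarrow> (\<And>i. i \<in> fv \<alpha> \<Longrightarrow> n \<bullet> P i = 0) \<Longrightarrow> n = 0"
    and poly: "polyhedral G \<phi> \<gamma> q"
    and q: "\<And>i. i \<in> V \<Longrightarrow> q i = a i *\<^sub>R P i \<and> a i \<noteq> 0"
  shows "\<exists>M. covectors P M"
proof -
  have nq: "n = 0" if "\<alpha> \<in> F" "\<And>i. i \<in> fv \<alpha> \<Longrightarrow> n \<bullet> q i = 0" for n \<alpha>
    by (rule nondeg[OF that(1)]) (use that(2) q fv_V in fastforce)
  have "\<exists>n. \<forall>i\<in>fv \<alpha>. n \<bullet> q i = 1" if a: "\<alpha> \<in> F" for \<alpha>
  proof -
    have "coplanar (q ` fv \<alpha>)" using poly a unfolding polyhedral_def by blast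
    then obtain n c where n: "n \<noteq> 0" "\<forall>x\<in>q ` fv \<alpha>. n \<bullet> x = c" unfolding coplanar_iff_hyperplane by blast
    have "c \<noteq> 0" using nq[OF a, of n] n by auto
    then show ?thesis using n(2) by (intro exI[of _ "(1 / c) *\<^sub>R n"]) auto
  qed
  then obtain M where M: "\<And>\<alpha> i. \<alpha> \<in> F \<Longrightarrow> i \<in> fv \<alpha> \<Longrightarrow> M \<alpha> \<bullet> q i = 1" by metis
  have plane: "face_plane G \<phi> q \<alpha> = {x. M \<alpha> \<bullet> x = 1}" if a: "\<alpha> \<in> F" for \<alpha>
    unfolding face_plane_def
  proof (rule affine_hull_eq_hyperplane)
    show "M \<alpha> \<noteq> 0" using M[OF a] fv_nonempty[OF a] by force
    show "M \<alpha> \<bullet> x = 1" if "x \<in> q ` fv \<alpha>" for x using M[OF a] that by auto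
    fix n' c' assume n': "\<And>x. x \<in> q ` fv \<alpha> \<Longrightarrow> n' \<bullet> x = c'"
    have "n' - c' *\<^sub>R M \<alpha> = 0" by (rule nq[OF a]) (use n' M[OF a] in \<open>simp add: inner_diff_left\<close>)
    then show "\<exists>t. n' = t *\<^sub>R M \<alpha> \<and> c' = t * 1" by auto
  qed
  have "covectors P M"
    unfolding covectors_def
  proof (intro ballI, clarify)
    fix i j assume ij: "(i, j) \<in> E"
    have F: "L i j \<in> F" "L j i \<in> F" using L_face ij E_sym by auto
    have "face_plane G \<phi> q (L i j) \<noteq> face_plane G \<phi> q (L j i)"
      using poly ij dual_edge_iff unfolding polyhedral_def by blast
    then have "M (L i j) \<noteq> M (L j i)" using plane F by auto
    moreover have "M (L i j) \<bullet> P k = M (L j i) \<bullet> P k" if "k \<in> fv (L i j)" "k \<in> fv (L j i)" for k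
      using M[OF F(1) that(1)] M[OF F(2) that(2)] q[OF fv_V[OF that(1)]]
      by (metis inner_scaleR_right mult_cancel_left)
    ultimately show "M (L i j) \<noteq> M (L j i) \<and> M (L i j) \<bullet> P i = M (L j i) \<bullet> P i \<and> M (L i j) \<bullet> P j = M (L j i) \<bullet> P j"
      using fv_L[OF ij] by blast
  qed
  then show ?thesis by blast
qed

end

section \<open>Perpendicular geodesics\<close>

text \<open>
  The scalar product of the sphere is \<open>flip 1 x \<bullet> y\<close>, that of the hyperbolic plane is
  \<open>flip (- 1) x \<bullet> y\<close>. Geodesics of both planes are handled together by means of the parameter
  \<open>e\<close>.
\<close>

definition flip :: "real \<Rightarrow> real^3 \<Rightarrow> real^3" where
  "flip e x = vector [e * x $ 1, x $ 2, x $ 3]"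

lemma flip_nth [simp]: "flip e x $ 1 = e * x $ 1" "flip e x $ 2 = x $ 2" "flip e x $ 3 = x $ 3"
  by (simp_all add: flip_def)

lemma inner_real3: "x \<bullet> y = x $ 1 * y $ 1 + x $ 2 * y $ 2 + x $ 3 * y $ 3" for x y :: "real^3"
  by (simp add: inner_vec_def sum_3)

lemma real3_eq_iff: "x = y \<longleftrightarrow> x $ 1 = y $ 1 \<and> x $ 2 = y $ 2 \<and> x $ 3 = y $ 3" for x y :: "real^3"
  by (simp add: vec_eq_iff forall_3)

lemma mink_flip: "mink x y = flip (- 1) x \<bullet> y"
  by (simp add: mink_def inner_real3)

lemma inner_flip: "x \<bullet> y = flip 1 x \<bullet> y"
  by (simp add: inner_real3)

lemma flip_inner_commute: "flip e x \<bullet> y = x \<bullet> flip e y"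
  by (simp add: inner_real3)

lemma flip_flip: "e * e = 1 \<Longrightarrow> flip e (flip e x) = x"
  by (simp add: real3_eq_iff flip: mult.assoc)

lemma flip_lin: "flip e (s *\<^sub>R x + t *\<^sub>R y) = s *\<^sub>R flip e x + t *\<^sub>R flip e y"
  by (simp add: real3_eq_iff algebra_simps)

lemma cross3_flip:
  assumes "e * e = 1"
  shows "cross3 (flip e a) (flip e b) = e *\<^sub>R flip e (cross3 a b)"
proof -
  have ee: "e * (e * t) = t" for t using assms by (simp flip: mult.assoc)
  then show ?thesis
    unfolding real3_eq_iff cross_components vector_scaleR_component flip_nth real_scaleR_def
    by (simp add: algebra_simps ee)
qed

lemma in_span_pair: "z \<in> span {x, y} \<longleftrightarrow> (\<exists>s t. z = s *\<^sub>R x + t *\<^sub>R y)" for x y :: "'b::real_vector"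
proof -
  have "z \<in> span {x, y} \<longleftrightarrow> (\<exists>s t. z - s *\<^sub>R x = t *\<^sub>R y)"
    unfolding span_insert[of x "{y}"] span_singleton by blast
  moreover have "z - s *\<^sub>R x = t *\<^sub>R y \<longleftrightarrow> z = s *\<^sub>R x + t *\<^sub>R y" for s t
    by (metis add_diff_cancel_left' diff_add_cancel add.commute)
  ultimately show ?thesis by simp
qed

lemma orthogonal_to_cross3_in_span:
  assumes "cross3 x y \<noteq> 0" "w \<bullet> cross3 x y = 0"
  shows "w \<in> span {x, y}"
proof -
  let ?n = "cross3 x y"
  let ?w = "cross3 ?n w"
  have "cross3 ?w ?n = (?w \<bullet> y) *\<^sub>R x - (?w \<bullet> x) *\<^sub>R y" by (rule Lagrange)
  moreover have "cross3 ?w ?n = (?n \<bullet> ?n) *\<^sub>R w"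
    using assms(2) Lagrange[of ?n ?n w] cross_skew[of ?w ?n] by (simp add: inner_commute)
  ultimately have "(?n \<bullet> ?n) *\<^sub>R w \<in> span {x, y}" by (simp add: span_base span_diff span_scale)
  then have "(1 / (?n \<bullet> ?n)) *\<^sub>R (?n \<bullet> ?n) *\<^sub>R w \<in> span {x, y}" by (rule span_scale)
  then show ?thesis using assms(1) by simp
qed

text \<open>
  The kernel of the cross product with \<open>x\<close> is the line of \<open>x\<close>, which the plane orthogonal to \<open>n\<close>
  avoids.
\<close>

lemma cross3_tangent_eq_0_iff:
  assumes "n \<bullet> x \<noteq> 0" "n \<bullet> w = 0"
  shows "cross3 x w = 0 \<longleftrightarrow> w = 0"
proof
  assume "cross3 x w = 0"
  then have "cross3 n (cross3 x w) = 0" by (simp add: cross_zero_right)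
  then have "(n \<bullet> x) *\<^sub>R w = 0" using assms(2) by (simp add: Lagrange)
  then show "w = 0" using assms(1) by simp
qed (simp add: cross_zero_right)

text \<open>
  The planes of the two geodesics have the bases \<open>z\<close>, \<open>u\<close> and \<open>z\<close>, \<open>v\<close>, where \<open>z\<close> is the common
  point and \<open>u\<close>, \<open>v\<close> are the tangent vectors. In these bases the determinant of scalar products
  \<open>B x y = flip e x \<bullet> y\<close> is \<open>B z z * B u v - B z v * B u z = 0\<close>; a change of
  bases multiplies it by nonzero factors.
\<close>

lemma perp_geodesics_imp_det:
  assumes perp: "perp_geodesics (\<lambda>x y. flip e x \<bullet> y) X x y a b" and X: "\<And>z. z \<in> X \<Longrightarrow> flip e z \<bullet> z \<noteq> 0"
  shows "(flip e x \<bullet> a) * (flip e y \<bullet> b) = (flip e x \<bullet> b) * (flip e y \<bullet> a)"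
proof -
  obtain z u v where z: "z \<in> X" "z \<in> span {x, y}" "z \<in> span {a, b}"
    and u: "u \<in> span {x, y}" "u \<noteq> 0" "flip e z \<bullet> u = 0"
    and v: "v \<in> span {a, b}" "v \<noteq> 0" "flip e z \<bullet> v = 0" and uv: "flip e u \<bullet> v = 0"
    using perp unfolding perp_geodesics_def by auto
  have zz: "flip e z \<bullet> z \<noteq> 0" using X z(1) .
  obtain z1 z2 u1 u2 where zx: "z = z1 *\<^sub>R x + z2 *\<^sub>R y" and ux: "u = u1 *\<^sub>R x + u2 *\<^sub>R y"
    using z(2) u(1) unfolding in_span_pair by blast
  obtain z3 z4 v1 v2 where za: "z = z3 *\<^sub>R a + z4 *\<^sub>R b" and va: "v = v1 *\<^sub>R a + v2 *\<^sub>R b"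
    using z(3) v(1) unfolding in_span_pair by blast
  have indep: "s1 * t2 - s2 * t1 \<noteq> 0"
    if "z = s1 *\<^sub>R c + s2 *\<^sub>R d" "w = t1 *\<^sub>R c + t2 *\<^sub>R d" "w \<noteq> 0" "flip e z \<bullet> w = 0" for s1 s2 t1 t2 c d w
  proof
    assume 0: "s1 * t2 - s2 * t1 = 0"
    have "t2 *\<^sub>R z - s2 *\<^sub>R w = (s1 * t2 - s2 * t1) *\<^sub>R c" "s1 *\<^sub>R w - t1 *\<^sub>R z = (s1 * t2 - s2 * t1) *\<^sub>R d"
      unfolding that(1,2) by (simp_all add: algebra_simps)
    then have "t2 *\<^sub>R z = s2 *\<^sub>R w" "t1 *\<^sub>R z = s1 *\<^sub>R w" using 0 by simp_all
    then have "flip e z \<bullet> (t2 *\<^sub>R z) = flip e z \<bullet> (s2 *\<^sub>R w)" "flip e z \<bullet> (t1 *\<^sub>R z) = flip e z \<bullet> (s1 *\<^sub>R w)" by simp_all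
    then have "t2 = 0" "t1 = 0" using that(4) zz by simp_all
    then show False using that(2,3) by simp
  qed
  define p q r s where "p = flip e x \<bullet> a" "q = flip e x \<bullet> b" "r = flip e y \<bullet> a" "s = flip e y \<bullet> b"
  have form: "flip e (s1 *\<^sub>R x + s2 *\<^sub>R y) \<bullet> (t1 *\<^sub>R a + t2 *\<^sub>R b) = s1 * t1 * p + s1 * t2 * q + s2 * t1 * r + s2 * t2 * s"
    for s1 s2 t1 t2
    by (simp add: p_q_r_s_def flip_lin inner_add_left inner_add_right algebra_simps)
  have zv: "z1 * v1 * p + z1 * v2 * q + z2 * v1 * r + z2 * v2 * s = 0"
    using v(3) form[of z1 z2 v1 v2] zx va by simp
  have uv': "u1 * v1 * p + u1 * v2 * q + u2 * v1 * r + u2 * v2 * s = 0"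
    using uv form[of u1 u2 v1 v2] ux va by simp
  have "(z1 * z3 * p + z1 * z4 * q + z2 * z3 * r + z2 * z4 * s) * (u1 * v1 * p + u1 * v2 * q + u2 * v1 * r + u2 * v2 * s)
      - (z1 * v1 * p + z1 * v2 * q + z2 * v1 * r + z2 * v2 * s) * (u1 * z3 * p + u1 * z4 * q + u2 * z3 * r + u2 * z4 * s)
     = (z1 * u2 - z2 * u1) * (z3 * v2 - z4 * v1) * (p * s - q * r)"
    by algebra
  then have "(z1 * u2 - z2 * u1) * (z3 * v2 - z4 * v1) * (p * s - q * r) = 0"
    unfolding zv uv' by simp
  then have "p * s - q * r = 0" using indep[OF zx ux u(2,3)] indep[OF za va v(2,3)] by simp
  then show ?thesis by (simp add: p_q_r_s_def)
qed

lemma det_normals: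
  assumes "e * e = 1"
  shows "flip e (cross3 x y) \<bullet> cross3 a b = e * ((flip e x \<bullet> a) * (flip e y \<bullet> b) - (flip e x \<bullet> b) * (flip e y \<bullet> a))"
proof -
  have "e *\<^sub>R e *\<^sub>R flip e (cross3 x y) = flip e (cross3 x y)" using assms by simp
  then have "flip e (cross3 x y) = e *\<^sub>R cross3 (flip e x) (flip e y)" unfolding cross3_flip[OF assms] by simp
  then show ?thesis by (simp add: dot_cross)
qed

text \<open>
  A vector that is tangent to one of the geodesics at the common point \<open>z\<close> is, up to \<open>flip e\<close>, the
  Euclidean normal vector of the plane of the other.
\<close>

lemma perp_geodesicsI:
  assumes e: "e * e = 1" and ne: "cross3 x y \<noteq> 0" "cross3 a b \<noteq> 0"
    and z: "z \<in> X" "z \<bullet> cross3 x y = 0" "z \<bullet> cross3 a b = 0"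
    and det: "flip e (cross3 x y) \<bullet> cross3 a b = 0"
  shows "perp_geodesics (\<lambda>x y. flip e x \<bullet> y) X x y a b"
  unfolding perp_geodesics_def
proof (intro exI conjI)
  let ?n = "cross3 x y" and ?m = "cross3 a b"
  show "z \<in> X \<inter> span {x, y} \<inter> span {a, b}"
    using z orthogonal_to_cross3_in_span ne by blast
  show "flip e ?m \<in> span {x, y}"
    by (rule orthogonal_to_cross3_in_span[OF ne(1)]) (metis det flip_inner_commute inner_commute)
  show "flip e ?n \<in> span {a, b}"
    by (rule orthogonal_to_cross3_in_span[OF ne(2)]) (rule det)
  show "flip e ?m \<noteq> 0" "flip e ?n \<noteq> 0"
    using ne flip_flip[OF e] by (metis flip_inner_commute inner_eq_zero_iff inner_zero_left)+
  show "flip e z \<bullet> flip e ?m = 0" "flip e z \<bullet> flip e ?n = 0"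
    using z e by (simp_all add: flip_inner_commute flip_flip)
  show "flip e (flip e ?m) \<bullet> flip e ?n = 0"
    using det e by (simp add: flip_flip inner_commute)
qed

section \<open>Distances and directions on the sphere\<close>

lemma S2_iff: "x \<in> S2 \<longleftrightarrow> x \<bullet> x = 1" for x :: "real^3"
  by (simp add: norm_eq_1)

lemma sphere_inner_bounds:
  assumes "x \<in> S2" "y \<in> S2" "x \<noteq> y" "x \<noteq> - y"
  shows "- 1 < x \<bullet> y" "x \<bullet> y < 1"
proof -
  have "0 < (x - y) \<bullet> (x - y)" "0 < (x + y) \<bullet> (x + y)" using assms by (auto simp: add_eq_0_iff2)
  moreover have "x \<bullet> x = 1" "y \<bullet> y = 1" using assms S2_iff by auto
  ultimately show "- 1 < x \<bullet> y" "x \<bullet> y < 1"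
    by (auto simp: inner_diff_left inner_diff_right inner_add_left inner_add_right inner_commute)
qed

lemma sphere_cross_nonzero:
  assumes "x \<in> S2" "y \<in> S2" "x \<noteq> y" "x \<noteq> - y"
  shows "cross3 x y \<noteq> 0"
proof
  assume "cross3 x y = 0"
  then have "(x \<bullet> y)\<^sup>2 = 1" using norm_cross_dot[of x y] assms(1,2) by simp
  then show False using sphere_inner_bounds[OF assms] by (simp add: power2_eq_1_iff)
qed

lemma dir_S:
  assumes "x \<in> S2" "y \<in> S2" "x \<noteq> y" "x \<noteq> - y"
  shows "0 < dist_S x y" "0 < sin (dist_S x y)" "dir_S x y = (1 / sin (dist_S x y)) *\<^sub>R (y - (x \<bullet> y) *\<^sub>R x)"
proof -
  note b = sphere_inner_bounds[OF assms]
  have c: "cos (dist_S x y) = x \<bullet> y" using b by (simp add: dist_S_def)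
  show "0 < dist_S x y" using b arccos_lt_bounded[of "x \<bullet> y"] by (simp add: dist_S_def)
  have "sin (dist_S x y) = sqrt (1 - (x \<bullet> y)\<^sup>2)" using b by (simp add: dist_S_def sin_arccos_abs)
  moreover have "(x \<bullet> y)\<^sup>2 < 1" using b by (simp add: abs_square_less_1)
  ultimately have s: "0 < sin (dist_S x y)" "(sin (dist_S x y))\<^sup>2 = 1 - (x \<bullet> y)\<^sup>2" by auto
  show "0 < sin (dist_S x y)" by (rule s)
  show "dir_S x y = (1 / sin (dist_S x y)) *\<^sub>R (y - (x \<bullet> y) *\<^sub>R x)"
    unfolding dir_S_def
  proof (rule the_equality)
    let ?e = "(1 / sin (dist_S x y)) *\<^sub>R (y - (x \<bullet> y) *\<^sub>R x)"
    have xx: "x \<bullet> x = 1" "y \<bullet> y = 1" using assms S2_iff by auto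
    have xe: "x \<bullet> ?e = 0" using xx by (simp add: inner_diff_right)
    have "(y - (x \<bullet> y) *\<^sub>R x) \<bullet> (y - (x \<bullet> y) *\<^sub>R x) = 1 - (x \<bullet> y)\<^sup>2"
      using xx by (simp add: inner_diff_right inner_diff_left inner_commute power2_eq_square)
    then have "?e \<bullet> ?e = (1 / sin (dist_S x y)) * ((1 / sin (dist_S x y)) * (sin (dist_S x y))\<^sup>2)"
      unfolding inner_scaleR_left inner_scaleR_right s(2) by simp
    also have "\<dots> = 1" using s(1) by (simp add: power2_eq_square)
    finally have ee: "?e \<bullet> ?e = 1" .
    have "y = cos (dist_S x y) *\<^sub>R x + sin (dist_S x y) *\<^sub>R ?e" using s(1) c by simp
    then show "x \<bullet> ?e = 0 \<and> ?e \<bullet> ?e = 1 \<and> y = cos (dist_S x y) *\<^sub>R x + sin (dist_S x y) *\<^sub>R ?e"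
      using xe ee by blast
    fix e assume "x \<bullet> e = 0 \<and> e \<bullet> e = 1 \<and> y = cos (dist_S x y) *\<^sub>R x + sin (dist_S x y) *\<^sub>R e"
    then have "y - (x \<bullet> y) *\<^sub>R x = sin (dist_S x y) *\<^sub>R e" using c by (metis add_diff_cancel_left')
    then show "e = ?e" using s(1) by simp
  qed
qed

section \<open>Distances and directions in the hyperbolic plane\<close>

lemma mink_commute: "mink x y = mink y x" by (simp add: mink_def algebra_simps)

text \<open>
  The reversed Cauchy-Schwarz inequality for time-like vectors.
\<close>

lemma mink_H2_less:
  assumes "x \<in> H2" "y \<in> H2" "x \<noteq> y"
  shows "mink x y < - 1"
proof -
  define s where "s = 1 + x $ 2 * y $ 2 + x $ 3 * y $ 3"
  have x: "(x $ 1)\<^sup>2 = 1 + (x $ 2)\<^sup>2 + (x $ 3)\<^sup>2" "x $ 1 > 0" and y: "(y $ 1)\<^sup>2 = 1 + (y $ 2)\<^sup>2 + (y $ 3)\<^sup>2" "y $ 1 > 0"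
    using assms by (auto simp: H2_def mink_def power2_eq_square)
  have "(x $ 1 * y $ 1)\<^sup>2 = (1 + (x $ 2)\<^sup>2 + (x $ 3)\<^sup>2) * (1 + (y $ 2)\<^sup>2 + (y $ 3)\<^sup>2)"
    using x y by (simp add: power_mult_distrib)
  also have "\<dots> = s\<^sup>2 + ((x $ 2 - y $ 2)\<^sup>2 + (x $ 3 - y $ 3)\<^sup>2 + (x $ 2 * y $ 3 - x $ 3 * y $ 2)\<^sup>2)"
    unfolding s_def by algebra
  finally have eq: "(x $ 1 * y $ 1)\<^sup>2 = s\<^sup>2 + ((x $ 2 - y $ 2)\<^sup>2 + (x $ 3 - y $ 3)\<^sup>2 + (x $ 2 * y $ 3 - x $ 3 * y $ 2)\<^sup>2)" .
  have "x $ 2 \<noteq> y $ 2 \<or> x $ 3 \<noteq> y $ 3"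
  proof (rule ccontr)
    assume "\<not> ?thesis"
    then have c: "x $ 2 = y $ 2" "x $ 3 = y $ 3" by auto
    then have "(x $ 1)\<^sup>2 = (y $ 1)\<^sup>2" using x y by simp
    then have "x $ 1 = y $ 1" using power2_eq_imp_eq[of "x $ 1" "y $ 1"] x(2) y(2) by linarith
    then show False using c assms(3) by (simp add: real3_eq_iff)
  qed
  then have "0 < (x $ 2 - y $ 2)\<^sup>2 \<or> 0 < (x $ 3 - y $ 3)\<^sup>2" by (metis right_minus_eq zero_less_power2)
  then have "0 < (x $ 2 - y $ 2)\<^sup>2 + (x $ 3 - y $ 3)\<^sup>2 + (x $ 2 * y $ 3 - x $ 3 * y $ 2)\<^sup>2"
    using zero_le_power2[of "x $ 2 - y $ 2"] zero_le_power2[of "x $ 3 - y $ 3"] zero_le_power2[of "x $ 2 * y $ 3 - x $ 3 * y $ 2"]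
    by linarith
  then have "s\<^sup>2 < (x $ 1 * y $ 1)\<^sup>2" unfolding eq by simp
  then have "s < x $ 1 * y $ 1" using mult_pos_pos[OF x(2) y(2)] power2_less_imp_less[of s "x $ 1 * y $ 1"] by linarith
  then show ?thesis by (simp add: mink_def s_def)
qed

lemma mink_H2_le: "x \<in> H2 \<Longrightarrow> y \<in> H2 \<Longrightarrow> mink x y \<le> - 1"
  using mink_H2_less[of x y] by (cases "x = y") (auto simp: H2_def)

lemma mink_scaleR: "mink (c *\<^sub>R x) y = c * mink x y" "mink x (c *\<^sub>R y) = c * mink x y"
  by (simp_all add: mink_def algebra_simps)

lemma normalize_timelike:
  assumes "mink n n < 0" "n $ 1 > 0"
  shows "(1 / sqrt (- mink n n)) *\<^sub>R n \<in> H2"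
proof -
  have "0 < sqrt (- mink n n)" "sqrt (- mink n n) * sqrt (- mink n n) = - mink n n" using assms(1) by auto
  then show ?thesis using assms by (simp add: H2_def mink_scaleR field_simps)
qed

lemma mink_future_neg:
  assumes "mink n n < 0" "n $ 1 > 0" "x \<in> H2"
  shows "mink n x < 0"
proof -
  have "mink ((1 / sqrt (- mink n n)) *\<^sub>R n) x \<le> - 1"
    by (rule mink_H2_le[OF normalize_timelike[OF assms(1,2)] assms(3)])
  then have "mink n x / sqrt (- mink n n) < 0" by (simp add: mink_scaleR)
  then show ?thesis using assms(1) by (simp add: divide_less_0_iff)
qed

lemma timelike_orthogonal_spacelike:
  assumes "mink n n < 0" "mink n x = 0" "x \<noteq> 0"
  shows "mink x x > 0"
proof -
  have n: "(n $ 2)\<^sup>2 + (n $ 3)\<^sup>2 < (n $ 1)\<^sup>2" using assms(1) by (simp add: mink_def power2_eq_square)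
  have o: "n $ 1 * x $ 1 = n $ 2 * x $ 2 + n $ 3 * x $ 3" using assms(2) by (simp add: mink_def)
  have n1: "0 < (n $ 1)\<^sup>2" using n zero_le_power2[of "n $ 2"] zero_le_power2[of "n $ 3"] by linarith
  have "0 < (x $ 2)\<^sup>2 + (x $ 3)\<^sup>2"
  proof (rule ccontr)
    assume "\<not> ?thesis"
    then have "x $ 2 = 0" "x $ 3 = 0" by (auto simp: sum_power2_gt_zero_iff)
    then show False using o n1 assms(3) by (auto simp: real3_eq_iff)
  qed
  have "(n $ 1)\<^sup>2 * (x $ 1)\<^sup>2 = (n $ 2 * x $ 2 + n $ 3 * x $ 3)\<^sup>2" using o by (simp flip: power_mult_distrib)
  also have "\<dots> \<le> ((n $ 2)\<^sup>2 + (n $ 3)\<^sup>2) * ((x $ 2)\<^sup>2 + (x $ 3)\<^sup>2)"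
  proof -
    have "((n $ 2)\<^sup>2 + (n $ 3)\<^sup>2) * ((x $ 2)\<^sup>2 + (x $ 3)\<^sup>2) = (n $ 2 * x $ 2 + n $ 3 * x $ 3)\<^sup>2 + (n $ 2 * x $ 3 - n $ 3 * x $ 2)\<^sup>2"
      by algebra
    then show ?thesis by simp
  qed
  also have "\<dots> < (n $ 1)\<^sup>2 * ((x $ 2)\<^sup>2 + (x $ 3)\<^sup>2)"
    using n \<open>0 < (x $ 2)\<^sup>2 + (x $ 3)\<^sup>2\<close> by (rule mult_strict_right_mono)
  finally have "(x $ 1)\<^sup>2 < (x $ 2)\<^sup>2 + (x $ 3)\<^sup>2" using n1 by simp
  then show ?thesis by (simp add: mink_def power2_eq_square)
qed

lemma hyperbolic_cross_nonzero:
  assumes "x \<in> H2" "y \<in> H2" "x \<noteq> y"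
  shows "cross3 x y \<noteq> 0" "mink (cross3 x y) (cross3 x y) > 0"
proof -
  have "mink (cross3 x y) (cross3 x y) = (mink x y)\<^sup>2 - mink x x * mink y y"
    unfolding mink_flip by (subst det_normals) (simp_all add: mink_commute[unfolded mink_flip] power2_eq_square)
  also have "\<dots> = (mink x y)\<^sup>2 - 1" using assms by (simp add: H2_def)
  also have "\<dots> > 0"
  proof -
    have "1 < (- mink x y)\<^sup>2" using mink_H2_less[OF assms] by (intro one_less_power) auto
    then show ?thesis by simp
  qed
  finally show "mink (cross3 x y) (cross3 x y) > 0" .
  then show "cross3 x y \<noteq> 0" by (auto simp: mink_def)
qed

lemma dir_H:
  assumes "x \<in> H2" "y \<in> H2" "x \<noteq> y"
  shows "0 < dist_H x y" "0 < sinh (dist_H x y)" "dir_H x y = (1 / sinh (dist_H x y)) *\<^sub>R (y + mink x y *\<^sub>R x)"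
proof -
  have b: "1 < - mink x y" using mink_H2_less[OF assms] by simp
  have c: "cosh (dist_H x y) = - mink x y" using b by (simp add: dist_H_def)
  show d: "0 < dist_H x y" using b by (simp add: dist_H_def)
  show s: "0 < sinh (dist_H x y)" using d by simp
  have s2: "(sinh (dist_H x y))\<^sup>2 = (mink x y)\<^sup>2 - 1" using sinh_square_eq[of "dist_H x y"] c by simp
  show "dir_H x y = (1 / sinh (dist_H x y)) *\<^sub>R (y + mink x y *\<^sub>R x)"
    unfolding dir_H_def
  proof (rule the_equality)
    let ?f = "y + mink x y *\<^sub>R x"
    let ?e = "(1 / sinh (dist_H x y)) *\<^sub>R ?f"
    have xx: "mink x x = -1" "mink y y = -1" using assms by (auto simp: H2_def)
    have add: "mink u (v + w) = mink u v + mink u w" "mink (v + w) u = mink v u + mink w u" for u v w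
      by (simp_all add: mink_def algebra_simps)
    have xe: "mink x ?e = 0" using xx by (simp add: mink_scaleR add)
    have "mink ?f ?f = (mink x y)\<^sup>2 - 1"
      using xx by (simp add: mink_scaleR add mink_commute power2_eq_square)
    then have "mink ?e ?e = (1 / sinh (dist_H x y)) * ((1 / sinh (dist_H x y)) * (sinh (dist_H x y))\<^sup>2)"
      unfolding mink_scaleR s2 by simp
    moreover have "sinh (dist_H x y) \<noteq> 0" using s by linarith
    then have "(1 / sinh (dist_H x y)) * ((1 / sinh (dist_H x y)) * (sinh (dist_H x y))\<^sup>2) = 1"
      unfolding power2_eq_square by (simp del: sinh_real_zero_iff)
    ultimately have ee: "mink ?e ?e = 1" by (rule trans)
    have "y = cosh (dist_H x y) *\<^sub>R x + sinh (dist_H x y) *\<^sub>R ?e" using s c by simp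
    then show "mink x ?e = 0 \<and> mink ?e ?e = 1 \<and> y = cosh (dist_H x y) *\<^sub>R x + sinh (dist_H x y) *\<^sub>R ?e"
      using xe ee by blast
    fix e assume "mink x e = 0 \<and> mink e e = 1 \<and> y = cosh (dist_H x y) *\<^sub>R x + sinh (dist_H x y) *\<^sub>R e"
    then have "y = - mink x y *\<^sub>R x + sinh (dist_H x y) *\<^sub>R e" using c by simp
    then have "y + mink x y *\<^sub>R x = - mink x y *\<^sub>R x + sinh (dist_H x y) *\<^sub>R e + mink x y *\<^sub>R x" by simp
    then have "?f = sinh (dist_H x y) *\<^sub>R e" by simp
    then show "e = ?e" using s by simp
  qed
qed

section \<open>Homogeneous coordinates of the Euclidean plane\<close>

definition homog :: "real^2 \<Rightarrow> real^3" where
  "homog x = vector [x $ 1, x $ 2, 1]"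

lemma homog_nth [simp]: "homog x $ 1 = x $ 1" "homog x $ 2 = x $ 2" "homog x $ 3 = 1"
  by (simp_all add: homog_def)

lemma real2_eq_iff: "x = y \<longleftrightarrow> x $ 1 = y $ 1 \<and> x $ 2 = y $ 2" for x y :: "real^2"
  by (simp add: vec_eq_iff forall_2)

lemma inner_real2: "x \<bullet> y = x $ 1 * y $ 1 + x $ 2 * y $ 2" for x y :: "real^2"
  by (simp add: inner_vec_def sum_2)

lemma inner_homog: "n \<bullet> homog x = pr_perp n \<bullet> x + n $ 3"
  by (simp add: inner_real3 inner_real2 pr_perp_def)

lemma pr_perp_nth [simp]: "pr_perp x $ 1 = x $ 1" "pr_perp x $ 2 = x $ 2"
  by (simp_all add: pr_perp_def)

section \<open>The three conditions in terms of covectors\<close>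

context face_structure
begin

text \<open>
  \<open>T i j\<close> is the vector at \<open>P i\<close> in the direction of \<open>P j\<close>: it differs from \<open>P j\<close> by a multiple of
  \<open>P i\<close> and lies in the tangent plane, the one orthogonal to \<open>n i\<close>. The factor \<open>f i j\<close> accounts for
  the length of the edge. On the tangent plane the cross product with \<open>P i\<close> is injective, so
  nothing is lost when it is applied to the equation of the stress at \<open>i\<close>.
\<close>

lemma stress_iff_equilibrium:
  assumes T: "\<And>i j. (i, j) \<in> E \<Longrightarrow> \<exists>c. T i j = P j - c *\<^sub>R P i" "\<And>i j. (i, j) \<in> E \<Longrightarrow> n i \<bullet> T i j = 0"
    and n: "\<And>i. i \<in> V \<Longrightarrow> n i \<bullet> P i \<noteq> 0"
    and f: "\<And>i j. (i, j) \<in> E \<Longrightarrow> f i j \<noteq> 0 \<and> f i j = (f j i :: real)"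
  shows "(\<exists>w. symmetric_weights G w \<and> nonzero_on_edges G w \<and>
            (\<forall>i\<in>V. (\<Sum>j | (i, j) \<in> E. (w i j * f i j) *\<^sub>R T i j) = 0)) \<longleftrightarrow> (\<exists>w. equilibrium E P w)"
proof -
  have key: "(\<Sum>j | (i, j) \<in> E. k j *\<^sub>R T i j) = 0 \<longleftrightarrow> (\<Sum>j | (i, j) \<in> E. k j *\<^sub>R cross3 (P i) (P j)) = 0"
    if "i \<in> V" for i k
  proof -
    have "cross3 (P i) (\<Sum>j | (i, j) \<in> E. k j *\<^sub>R T i j) = (\<Sum>j | (i, j) \<in> E. k j *\<^sub>R cross3 (P i) (T i j))"
      using finite_nbrs[of i]
      by (induction rule: finite_induct) (simp_all add: cross_zero_right cross_add_right cross_mult_right)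
    also have "\<dots> = (\<Sum>j | (i, j) \<in> E. k j *\<^sub>R cross3 (P i) (P j))"
    proof (rule sum.cong[OF refl])
      fix j assume "j \<in> {j. (i, j) \<in> E}"
      then obtain c where "T i j = P j - c *\<^sub>R P i" using T(1) by blast
      then show "k j *\<^sub>R cross3 (P i) (T i j) = k j *\<^sub>R cross3 (P i) (P j)"
        by (simp add: Cross3.right_diff_distrib cross_mult_right cross_refl)
    qed
    finally have cr: "cross3 (P i) (\<Sum>j | (i, j) \<in> E. k j *\<^sub>R T i j) = (\<Sum>j | (i, j) \<in> E. k j *\<^sub>R cross3 (P i) (P j))" .
    have "n i \<bullet> (\<Sum>j | (i, j) \<in> E. k j *\<^sub>R T i j) = 0"
      unfolding inner_sum_right by (rule sum.neutral) (use T(2) in auto)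
    from cross3_tangent_eq_0_iff[OF n[OF that] this] show ?thesis unfolding cr by simp
  qed
  have out: "(\<Sum>j | (i, j) \<in> E. k j *\<^sub>R cross3 (P i) (P j)) = 0" if "i \<notin> V" for i k
  proof -
    have "{j. (i, j) \<in> E} = {}" using that E_VD by blast
    then show ?thesis by simp
  qed
  show ?thesis
  proof
    assume "\<exists>w. symmetric_weights G w \<and> nonzero_on_edges G w \<and>
            (\<forall>i\<in>V. (\<Sum>j | (i, j) \<in> E. (w i j * f i j) *\<^sub>R T i j) = 0)"
    then obtain w where w: "\<And>i j. (i, j) \<in> E \<Longrightarrow> w i j = w j i" "\<And>i j. (i, j) \<in> E \<Longrightarrow> w i j \<noteq> 0"
      "\<And>i. i \<in> V \<Longrightarrow> (\<Sum>j | (i, j) \<in> E. (w i j * f i j) *\<^sub>R T i j) = 0"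
      unfolding symmetric_weights_def nonzero_on_edges_def by blast
    have "equilibrium E P (\<lambda>i j. w i j * f i j)"
      unfolding equilibrium_def
    proof (intro conjI allI ballI)
      fix e assume "e \<in> E"
      then obtain i j where e: "e = (i, j)" "(i, j) \<in> E" by (cases e) auto
      show "case e of (i, j) \<Rightarrow> w i j * f i j = w j i * f j i \<and> w i j * f i j \<noteq> 0"
        using w(1,2)[OF e(2)] f[OF e(2)] by (simp add: e(1))
    next
      fix i
      show "(\<Sum>j | (i, j) \<in> E. (w i j * f i j) *\<^sub>R cross3 (P i) (P j)) = 0"
        using w(3)[of i] key[of i "\<lambda>j. w i j * f i j"] out[of i "\<lambda>j. w i j * f i j"] by blast
    qed
    then show "\<exists>w. equilibrium E P w" by blast
  next
    assume "\<exists>w. equilibrium E P w"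
    then obtain w where w: "\<And>i j. (i, j) \<in> E \<Longrightarrow> w i j = w j i \<and> w i j \<noteq> 0"
      "\<And>i. (\<Sum>j | (i, j) \<in> E. w i j *\<^sub>R cross3 (P i) (P j)) = 0"
      unfolding equilibrium_def by blast
    have "(\<Sum>j | (i, j) \<in> E. (w i j / f i j * f i j) *\<^sub>R T i j) = 0" if "i \<in> V" for i
    proof -
      have "(\<Sum>j | (i, j) \<in> E. (w i j / f i j * f i j) *\<^sub>R T i j) = (\<Sum>j | (i, j) \<in> E. w i j *\<^sub>R T i j)"
      proof (rule sum.cong[OF refl])
        fix j assume "j \<in> {j. (i, j) \<in> E}"
        then have "f i j \<noteq> 0" using f[of i j] by simp
        then show "(w i j / f i j * f i j) *\<^sub>R T i j = w i j *\<^sub>R T i j" by simp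
      qed
      then show ?thesis using key[OF that, of "w i"] w(2) by simp
    qed
    moreover have "symmetric_weights G (\<lambda>i j. w i j / f i j)" "nonzero_on_edges G (\<lambda>i j. w i j / f i j)"
      using w(1) f unfolding symmetric_weights_def nonzero_on_edges_def by fastforce+
    ultimately show "\<exists>w. symmetric_weights G w \<and> nonzero_on_edges G w \<and>
            (\<forall>i\<in>V. (\<Sum>j | (i, j) \<in> E. (w i j * f i j) *\<^sub>R T i j) = 0)" by blast
  qed
qed

lemma vertex_in_face: "i \<in> V \<Longrightarrow> \<exists>\<alpha>\<in>F. i \<in> fv \<alpha>"
  using has_edge L_face fv_L(1) by blast

lemma covectors_shift: "covectors P M \<Longrightarrow> covectors P (\<lambda>\<alpha>. M \<alpha> + c)"
  unfolding covectors_def by (simp add: inner_add_left)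

text \<open>
  Proportional covectors of neighbouring faces would be equal, since they have the same nonzero
  product with \<open>P i\<close>.
\<close>

lemma covectors_not_parallel:
  assumes M: "covectors P M" "(i, j) \<in> E" and h: "M (L i j) \<bullet> P i \<noteq> 0"
  shows "M (L i j) \<noteq> c *\<^sub>R M (L j i)"
proof
  assume eq: "M (L i j) = c *\<^sub>R M (L j i)"
  then have "M (L i j) \<bullet> P i = c * (M (L j i) \<bullet> P i)" by simp
  then have "c = 1" using covectorsD(2)[OF M] h by simp
  then show False using eq covectorsD(1)[OF M] by simp
qed

lemma nondegenerate_of_not_on_geodesic:
  assumes "\<not> on_geodesic X (p ` fv \<alpha>)" "\<And>i. i \<in> V \<Longrightarrow> p i \<in> X" "\<And>i. i \<in> fv \<alpha> \<Longrightarrow> n \<bullet> p i = 0"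
  shows "n = 0"
proof (rule ccontr)
  assume n: "n \<noteq> 0"
  have "subspace {x. n \<bullet> x = 0}" "dim {x. n \<bullet> x = 0} = 2"
    using n by (simp_all add: subspace_hyperplane dim_hyperplane)
  moreover have "p ` fv \<alpha> \<subseteq> X \<inter> {x. n \<bullet> x = 0}" using assms(2,3) fv_V by blast
  ultimately show False using assms(1) unfolding on_geodesic_def by blast
qed

text \<open>
  Finitely many planes do not cover the space.
\<close>

lemma ex_generic_vector:
  assumes "\<And>i. i \<in> V \<Longrightarrow> p i \<noteq> (0 :: real^3)"
  shows "\<exists>c. \<forall>i\<in>V. c \<bullet> p i \<noteq> t i"
proof -
  have "negligible (\<Union>((\<lambda>i. {c. p i \<bullet> c = t i}) ` V))"
    using finite_V assms by (intro negligible_Union) (auto intro: negligible_hyperplane)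
  then have "(\<Union>((\<lambda>i. {c. p i \<bullet> c = t i}) ` V)) \<noteq> UNIV" using non_negligible_UNIV by metis
  then show ?thesis by (auto simp: inner_commute)
qed

subsection \<open>The sphere\<close>

context
  fixes p :: "'a \<Rightarrow> real^3"
  assumes fr: "framework_S G p" and ng: "\<And>\<alpha>. \<alpha> \<in> F \<Longrightarrow> \<not> on_geodesic S2 (p ` fv \<alpha>)"
begin

lemma S_p: "i \<in> V \<Longrightarrow> p i \<in> S2"
  using fr unfolding framework_S_def by blast

lemma S_edge: "(i, j) \<in> E \<Longrightarrow> p i \<in> S2" "(i, j) \<in> E \<Longrightarrow> p j \<in> S2" "(i, j) \<in> E \<Longrightarrow> p i \<noteq> p j" "(i, j) \<in> E \<Longrightarrow> p i \<noteq> - p j"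
  using fr E_VD unfolding framework_S_def by blast+

lemma S_cross: "(i, j) \<in> E \<Longrightarrow> cross3 (p i) (p j) \<noteq> 0"
  using sphere_cross_nonzero S_edge by blast

lemma S_nondeg: "\<alpha> \<in> F \<Longrightarrow> (\<And>i. i \<in> fv \<alpha> \<Longrightarrow> n \<bullet> p i = 0) \<Longrightarrow> n = 0"
  using nondegenerate_of_not_on_geodesic[OF ng S_p] by blast

lemma S_stress_iff: "(\<exists>w. self_stress_S G p w \<and> nonzero_on_edges G w) \<longleftrightarrow> (\<exists>M. covectors p M)"
proof -
  define f where "f i j = dist_S (p i) (p j) / sin (dist_S (p i) (p j))" for i j
  define T where "T i j = p j - (p i \<bullet> p j) *\<^sub>R p i" for i j
  have sum: "(\<Sum>j | (i, j) \<in> E. (w i j * dist_S (p i) (p j)) *\<^sub>R dir_S (p i) (p j)) = (\<Sum>j | (i, j) \<in> E. (w i j * f i j) *\<^sub>R T i j)" for w i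
  proof (rule sum.cong[OF refl])
    fix j assume "j \<in> {j. (i, j) \<in> E}"
    then have "(i, j) \<in> E" by simp
    from dir_S(3)[OF S_edge[OF this]]
    show "(w i j * dist_S (p i) (p j)) *\<^sub>R dir_S (p i) (p j) = (w i j * f i j) *\<^sub>R T i j"
      by (simp add: f_def T_def)
  qed
  have "(\<exists>w. symmetric_weights G w \<and> nonzero_on_edges G w \<and>
            (\<forall>i\<in>V. (\<Sum>j | (i, j) \<in> E. (w i j * f i j) *\<^sub>R T i j) = 0)) \<longleftrightarrow> (\<exists>w. equilibrium E p w)"
  proof (rule stress_iff_equilibrium)
    fix i j assume ij: "(i, j) \<in> E"
    show "\<exists>c. T i j = p j - c *\<^sub>R p i" by (auto simp: T_def)
    show "p i \<bullet> T i j = 0" using S2_iff[THEN iffD1, OF S_edge(1)[OF ij]] by (simp add: T_def inner_diff_right)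
    show "f i j \<noteq> 0 \<and> f i j = f j i" using dir_S(1,2)[OF S_edge[OF ij]] by (simp add: f_def dist_S_def inner_commute)
  next
    show "p i \<bullet> p i \<noteq> 0" if "i \<in> V" for i using S2_iff[THEN iffD1, OF S_p[OF that]] by simp
  qed
  then show ?thesis
    using equilibrium_iff_covectors[of p, OF S_cross] unfolding self_stress_S_def sum by blast
qed

text \<open>
  A constant vector can be added to all covectors, and a generic one makes all heights nonzero.
\<close>

lemma S_heights_nonzero:
  assumes "covectors p M"
  obtains M' h where "covectors p M'" "\<And>i. i \<in> V \<Longrightarrow> h i \<noteq> 0" "\<And>\<alpha> i. \<alpha> \<in> F \<Longrightarrow> i \<in> fv \<alpha> \<Longrightarrow> M' \<alpha> \<bullet> p i = h i"
proof -
  obtain h where h: "\<And>\<alpha> i. \<alpha> \<in> F \<Longrightarrow> i \<in> fv \<alpha> \<Longrightarrow> M \<alpha> \<bullet> p i = h i" using covectors_heights[OF assms] by blast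
  have "p i \<noteq> 0" if "i \<in> V" for i using S_p[OF that] by auto
  then obtain c where c: "\<And>i. i \<in> V \<Longrightarrow> c \<bullet> p i \<noteq> - h i" using ex_generic_vector[of p "\<lambda>i. - h i"] by blast
  show thesis
  proof (rule that)
    show "covectors p (\<lambda>\<alpha>. M \<alpha> + c)" by (rule covectors_shift[OF assms])
    show "h i + c \<bullet> p i \<noteq> 0" if "i \<in> V" for i using c[OF that] by linarith
    show "(M \<alpha> + c) \<bullet> p i = h i + c \<bullet> p i" if "\<alpha> \<in> F" "i \<in> fv \<alpha>" for \<alpha> i
      using h[OF that] by (simp add: inner_add_left)
  qed
qed

lemma S_lift_iff: "(\<exists>M. covectors p M) \<longleftrightarrow> (\<exists>q. polyhedral_lift_S G \<phi> \<gamma> p q)"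
proof
  assume "\<exists>M. covectors p M"
  then obtain M h where M: "covectors p M" and h: "\<And>i. i \<in> V \<Longrightarrow> h i \<noteq> 0" "\<And>\<alpha> i. \<alpha> \<in> F \<Longrightarrow> i \<in> fv \<alpha> \<Longrightarrow> M \<alpha> \<bullet> p i = h i"
    using S_heights_nonzero by metis
  define q where "q i = (1 / h i) *\<^sub>R p i" for i
  have "polyhedral G \<phi> \<gamma> q"
    by (rule covectors_imp_polyhedral(1)[OF S_nondeg M, where t = 1 and q = q and a = "\<lambda>i. 1 / h i"])
      (use h fv_V in \<open>auto simp: q_def\<close>)
  moreover have "\<forall>i\<in>V. \<exists>a. a \<noteq> 0 \<and> q i = a *\<^sub>R p i"
    using h(1) by (auto simp: q_def intro!: exI[of _ "1 / h _"])
  ultimately show "\<exists>q. polyhedral_lift_S G \<phi> \<gamma> p q" unfolding polyhedral_lift_S_def by blast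
next
  assume "\<exists>q. polyhedral_lift_S G \<phi> \<gamma> p q"
  then obtain q where q: "polyhedral G \<phi> \<gamma> q" "\<forall>i\<in>V. \<exists>a. a \<noteq> 0 \<and> q i = a *\<^sub>R p i"
    unfolding polyhedral_lift_S_def by blast
  from q(2) obtain a where a: "\<And>i. i \<in> V \<Longrightarrow> a i \<noteq> 0 \<and> q i = a i *\<^sub>R p i" by metis
  show "\<exists>M. covectors p M"
    by (rule polyhedral_imp_covectors[OF _ q(1), where a = a]) (use S_nondeg a in blast)+
qed

lemma S_reciprocal_iff: "(\<exists>M. covectors p M) \<longleftrightarrow> (\<exists>m. reciprocal_S G \<phi> \<gamma> p m)"
proof
  assume "\<exists>M. covectors p M"
  then obtain M h where M: "covectors p M" and h: "\<And>i. i \<in> V \<Longrightarrow> h i \<noteq> 0" "\<And>\<alpha> i. \<alpha> \<in> F \<Longrightarrow> i \<in> fv \<alpha> \<Longrightarrow> M \<alpha> \<bullet> p i = h i"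
    using S_heights_nonzero by metis
  define m where "m \<alpha> = (1 / norm (M \<alpha>)) *\<^sub>R M \<alpha>" for \<alpha>
  have M0: "M \<alpha> \<noteq> 0" if "\<alpha> \<in> F" for \<alpha> using fv_nonempty[OF that] h fv_V that by force
  have mS: "m \<alpha> \<in> S2" if "\<alpha> \<in> F" for \<alpha> using M0[OF that] by (simp add: m_def)
  have mp: "m \<alpha> \<bullet> p i = h i / norm (M \<alpha>)" if "\<alpha> \<in> F" "i \<in> fv \<alpha>" for \<alpha> i using h(2)[OF that] by (simp add: m_def)
  have mneq: "m (L i j) \<noteq> c *\<^sub>R m (L j i)" if ij: "(i, j) \<in> E" for i j c
  proof
    assume "m (L i j) = c *\<^sub>R m (L j i)"
    then have "norm (M (L i j)) *\<^sub>R m (L i j) = norm (M (L i j)) *\<^sub>R c *\<^sub>R m (L j i)" by simp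
    then have "M (L i j) = (norm (M (L i j)) * c / norm (M (L j i))) *\<^sub>R M (L j i)"
      using M0[OF L_face[OF ij]] by (simp add: m_def)
    moreover have "M (L i j) \<bullet> p i \<noteq> 0" using h E_VD(1)[OF ij] L_face[OF ij] fv_L(1)[OF ij] by simp
    ultimately show False using covectors_not_parallel[OF M ij] by blast
  qed
  have "perp_geodesics (\<bullet>) S2 (p i) (p j) (m \<alpha>) (m \<beta>)" if "dual_pair G \<phi> \<gamma> \<alpha> \<beta> i j" for \<alpha> \<beta> i j
  proof -
    have ij: "(i, j) \<in> E" and ab: "\<alpha> = L i j \<and> \<beta> = L j i \<or> \<alpha> = L j i \<and> \<beta> = L i j" using dual_pair_cases[OF that] by auto
    have ab': "\<alpha> \<in> F" "\<beta> \<in> F" "i \<in> fv \<alpha>" "i \<in> fv \<beta>" "j \<in> fv \<alpha>" "j \<in> fv \<beta>"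
      using ab L_face ij E_sym fv_L[OF ij] by auto
    have "m \<alpha> \<noteq> c *\<^sub>R m \<beta>" for c using mneq ij E_sym ab by metis
    from this[of 1] this[of "-1"] have "m \<alpha> \<noteq> m \<beta>" "m \<alpha> \<noteq> - m \<beta>" by auto
    then have c: "cross3 (m \<alpha>) (m \<beta>) \<noteq> 0" using sphere_cross_nonzero mS ab' by blast
    let ?n = "cross3 (p i) (p j)" and ?k = "cross3 (m \<alpha>) (m \<beta>)"
    have det: "?n \<bullet> ?k = 0"
      unfolding dot_cross using mp ab' by (simp add: inner_commute)
    \<comment> \<open>the common point \<open>z\<close> is on the common line of the planes with the normal vectors \<open>?n\<close> and \<open>?k\<close>\<close>
    have "norm (cross3 ?n ?k) = norm ?n * norm ?k"
    proof -
      have "(norm (cross3 ?n ?k))\<^sup>2 = (norm ?n * norm ?k)\<^sup>2" using norm_cross_dot[of ?n ?k] det by simp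
      then show ?thesis by (simp add: power2_eq_iff_nonneg)
    qed
    then have z0: "cross3 ?n ?k \<noteq> 0" using S_cross[OF ij] c by auto
    define z where "z = (1 / norm (cross3 ?n ?k)) *\<^sub>R cross3 ?n ?k"
    have "perp_geodesics (\<lambda>x y. flip 1 x \<bullet> y) S2 (p i) (p j) (m \<alpha>) (m \<beta>)"
    proof (rule perp_geodesicsI[of 1])
      show "z \<in> S2" using z0 by (simp add: z_def)
      show "z \<bullet> ?n = 0" "z \<bullet> ?k = 0" by (simp_all add: z_def dot_cross_self)
      show "flip 1 ?n \<bullet> ?k = 0" using det by (simp flip: inner_flip)
    qed (use S_cross[OF ij] c in auto)
    then show ?thesis by (simp flip: inner_flip)
  qed
  moreover have "framework_S (dual_graph G \<phi> \<gamma>) m"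
    unfolding framework_S_def
  proof (intro conjI ballI)
    show "m \<alpha> \<in> S2" if "\<alpha> \<in> pverts (dual_graph G \<phi> \<gamma>)" for \<alpha> using mS that by (simp add: dual_graph_def)
    fix e assume "e \<in> parcs (dual_graph G \<phi> \<gamma>)"
    then obtain i j where "e = (L i j, L j i)" "(i, j) \<in> E" by (cases e) (auto simp: dual_edge_iff)
    then show "case e of (\<alpha>, \<beta>) \<Rightarrow> m \<alpha> \<noteq> m \<beta> \<and> m \<alpha> \<noteq> - m \<beta>" using mneq[of i j 1] mneq[of i j "-1"] by simp
  qed
  moreover have "dist_S (m \<alpha>) (p i) \<noteq> pi / 2" if a: "\<alpha> \<in> F" "i \<in> fv \<alpha>" for \<alpha> i
  proof
    assume "dist_S (m \<alpha>) (p i) = pi / 2"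
    moreover have "\<bar>m \<alpha> \<bullet> p i\<bar> \<le> 1"
      using Cauchy_Schwarz_ineq2[of "m \<alpha>" "p i"] mS[OF a(1)] S_p[OF fv_V[OF a(2)]] by simp
    ultimately have "m \<alpha> \<bullet> p i = 0" unfolding dist_S_def by (metis cos_arccos_abs cos_pi_half)
    then show False using mp[OF a] h(1)[OF fv_V[OF a(2)]] M0[OF a(1)] by simp
  qed
  ultimately show "\<exists>m. reciprocal_S G \<phi> \<gamma> p m" unfolding reciprocal_S_def by blast
next
  assume "\<exists>m. reciprocal_S G \<phi> \<gamma> p m"
  then obtain m where fm: "framework_S (dual_graph G \<phi> \<gamma>) m"
    and perp: "\<And>\<alpha> \<beta> i j. dual_pair G \<phi> \<gamma> \<alpha> \<beta> i j \<Longrightarrow> perp_geodesics (\<bullet>) S2 (p i) (p j) (m \<alpha>) (m \<beta>)"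
    and dist: "\<And>\<alpha> i. \<alpha> \<in> F \<Longrightarrow> i \<in> fv \<alpha> \<Longrightarrow> dist_S (m \<alpha>) (p i) \<noteq> pi / 2" unfolding reciprocal_S_def by blast
  show "\<exists>M. covectors p M"
  proof (rule covectors_of_directions)
    show "m \<alpha> \<bullet> p i \<noteq> 0" if "\<alpha> \<in> F" "i \<in> fv \<alpha>" for \<alpha> i using dist[OF that] by (auto simp: dist_S_def)
    fix i j assume ij: "(i, j) \<in> E"
    have mS: "m (L i j) \<in> S2" "m (L j i) \<in> S2"
      using fm L_face[OF ij] L_face[OF E_sym[OF ij]] unfolding framework_S_def dual_graph_def by auto
    have "perp_geodesics (\<lambda>x y. flip 1 x \<bullet> y) S2 (p i) (p j) (m (L i j)) (m (L j i))"
      using perp[OF dual_pair_L[OF ij]] by (simp flip: inner_flip)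
    then have "(p i \<bullet> m (L i j)) * (p j \<bullet> m (L j i)) = (p i \<bullet> m (L j i)) * (p j \<bullet> m (L i j))"
      unfolding inner_flip[of "p i"] inner_flip[of "p j"]
      by (rule perp_geodesics_imp_det) (simp flip: inner_flip, use norm_zero in force)
    then show "(m (L i j) \<bullet> p i) * (m (L j i) \<bullet> p j) = (m (L i j) \<bullet> p j) * (m (L j i) \<bullet> p i)"
      by (simp add: inner_commute mult.commute)
    have ne: "m (L i j) \<noteq> m (L j i)" "m (L i j) \<noteq> - m (L j i)"
      using fm ij dual_edge_iff unfolding framework_S_def by blast+
    show "m (L i j) \<noteq> c *\<^sub>R m (L j i)" for c
    proof
      assume eq: "m (L i j) = c *\<^sub>R m (L j i)"
      then have "norm (m (L i j)) = \<bar>c\<bar> * norm (m (L j i))" by simp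
      then have "\<bar>c\<bar> = 1" using mS by simp
      then have "c = 1 \<or> c = - 1" by auto
      then show False using eq ne by auto
    qed
  qed
qed

end

subsection \<open>The hyperbolic plane\<close>

context
  fixes p :: "'a \<Rightarrow> real^3"
  assumes fr: "framework_H G p" and ng: "\<And>\<alpha>. \<alpha> \<in> F \<Longrightarrow> \<not> on_geodesic H2 (p ` fv \<alpha>)"
begin

lemma H_p: "i \<in> V \<Longrightarrow> p i \<in> H2"
  using fr unfolding framework_H_def by blast

lemma H_edge: "(i, j) \<in> E \<Longrightarrow> p i \<in> H2" "(i, j) \<in> E \<Longrightarrow> p j \<in> H2" "(i, j) \<in> E \<Longrightarrow> p i \<noteq> p j"
  using fr E_VD unfolding framework_H_def by blast+

lemma H_cross: "(i, j) \<in> E \<Longrightarrow> cross3 (p i) (p j) \<noteq> 0"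
  using hyperbolic_cross_nonzero H_edge by blast

lemma H_nondeg: "\<alpha> \<in> F \<Longrightarrow> (\<And>i. i \<in> fv \<alpha> \<Longrightarrow> n \<bullet> p i = 0) \<Longrightarrow> n = 0"
  using nondegenerate_of_not_on_geodesic[OF ng H_p] by blast

lemma H_stress_iff: "(\<exists>w. self_stress_H G p w \<and> nonzero_on_edges G w) \<longleftrightarrow> (\<exists>M. covectors p M)"
proof -
  define f where "f i j = dist_H (p i) (p j) / sinh (dist_H (p i) (p j))" for i j
  define T where "T i j = p j + mink (p i) (p j) *\<^sub>R p i" for i j
  have sum: "(\<Sum>j | (i, j) \<in> E. (w i j * dist_H (p i) (p j)) *\<^sub>R dir_H (p i) (p j)) = (\<Sum>j | (i, j) \<in> E. (w i j * f i j) *\<^sub>R T i j)" for w i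
  proof (rule sum.cong[OF refl])
    fix j assume "j \<in> {j. (i, j) \<in> E}"
    then have "(i, j) \<in> E" by simp
    from dir_H(3)[OF H_edge[OF this]]
    show "(w i j * dist_H (p i) (p j)) *\<^sub>R dir_H (p i) (p j) = (w i j * f i j) *\<^sub>R T i j"
      by (simp add: f_def T_def)
  qed
  have "(\<exists>w. symmetric_weights G w \<and> nonzero_on_edges G w \<and>
            (\<forall>i\<in>V. (\<Sum>j | (i, j) \<in> E. (w i j * f i j) *\<^sub>R T i j) = 0)) \<longleftrightarrow> (\<exists>w. equilibrium E p w)"
  proof (rule stress_iff_equilibrium[where n = "\<lambda>i. flip (- 1) (p i)"])
    fix i j assume ij: "(i, j) \<in> E"
    show "\<exists>c. T i j = p j - c *\<^sub>R p i" by (auto simp: T_def intro!: exI[of _ "- mink (p i) (p j)"])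
    have "mink (p i) (p i) = - 1" using H_edge(1)[OF ij] by (simp add: H2_def)
    then show "flip (- 1) (p i) \<bullet> T i j = 0" unfolding T_def inner_add_right inner_scaleR_right mink_flip[symmetric] by simp
    show "f i j \<noteq> 0 \<and> f i j = f j i"
      using dir_H(1,2)[OF H_edge[OF ij]] mink_commute[of "p i" "p j"] by (simp add: f_def dist_H_def)
  next
    show "flip (- 1) (p i) \<bullet> p i \<noteq> 0" if "i \<in> V" for i
      using H_p[OF that] by (simp add: H2_def flip: mink_flip)
  qed
  then show ?thesis
    using equilibrium_iff_covectors[of p, OF H_cross] unfolding self_stress_H_def sum by blast
qed

text \<open>
  Here the constant vector that is added to the covectors is time-like and so long that all of
  them become time-like as well, which is possible for finitely many faces.
\<close>

lemma H_timelike: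
  assumes "covectors p M"
  obtains N h where "covectors p (\<lambda>\<alpha>. flip (- 1) (N \<alpha>))" "\<And>\<alpha>. \<alpha> \<in> F \<Longrightarrow> mink (N \<alpha>) (N \<alpha>) < 0 \<and> N \<alpha> $ 1 > 0"
    "\<And>i. i \<in> V \<Longrightarrow> h i < 0" "\<And>\<alpha> i. \<alpha> \<in> F \<Longrightarrow> i \<in> fv \<alpha> \<Longrightarrow> mink (N \<alpha>) (p i) = h i"
proof -
  define t where "t = 1 + (\<Sum>\<alpha>\<in>F. \<bar>M \<alpha> $ 1\<bar> + \<bar>M \<alpha> $ 2\<bar> + \<bar>M \<alpha> $ 3\<bar>)"
  define N where "N \<alpha> = flip (- 1) (M \<alpha> + vector [- t, 0, 0])" for \<alpha>
  have flipN: "flip (- 1) (N \<alpha>) = M \<alpha> + vector [- t, 0, 0]" for \<alpha> by (simp add: N_def flip_flip)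
  have cov: "covectors p (\<lambda>\<alpha>. flip (- 1) (N \<alpha>))" unfolding flipN by (rule covectors_shift[OF assms])
  have time: "mink (N \<alpha>) (N \<alpha>) < 0 \<and> N \<alpha> $ 1 > 0" if "\<alpha> \<in> F" for \<alpha>
  proof -
    have "\<bar>M \<alpha> $ 1\<bar> + \<bar>M \<alpha> $ 2\<bar> + \<bar>M \<alpha> $ 3\<bar> \<le> (\<Sum>\<alpha>\<in>F. \<bar>M \<alpha> $ 1\<bar> + \<bar>M \<alpha> $ 2\<bar> + \<bar>M \<alpha> $ 3\<bar>)"
      by (rule member_le_sum[OF that _ finite_F]) simp
    then have lt: "\<bar>M \<alpha> $ 2\<bar> + \<bar>M \<alpha> $ 3\<bar> < t - M \<alpha> $ 1" unfolding t_def by linarith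
    have "(M \<alpha> $ 2)\<^sup>2 + (M \<alpha> $ 3)\<^sup>2 \<le> (\<bar>M \<alpha> $ 2\<bar> + \<bar>M \<alpha> $ 3\<bar>)\<^sup>2" by (simp add: power2_sum)
    also have "\<dots> < (t - M \<alpha> $ 1)\<^sup>2" using lt by (intro power_strict_mono) auto
    finally have "(M \<alpha> $ 2)\<^sup>2 + (M \<alpha> $ 3)\<^sup>2 < (t - M \<alpha> $ 1)\<^sup>2" .
    then show ?thesis using lt by (simp add: N_def mink_def power2_eq_square algebra_simps)
  qed
  obtain h where h: "\<And>\<alpha> i. \<alpha> \<in> F \<Longrightarrow> i \<in> fv \<alpha> \<Longrightarrow> flip (- 1) (N \<alpha>) \<bullet> p i = h i" using covectors_heights[OF cov] by blast
  show thesis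
  proof (rule that[OF cov time])
    show m: "mink (N \<alpha>) (p i) = h i" if "\<alpha> \<in> F" "i \<in> fv \<alpha>" for \<alpha> i using h[OF that] by (simp add: mink_flip)
    show "h i < 0" if i: "i \<in> V" for i
    proof -
      obtain \<alpha> where a: "\<alpha> \<in> F" "i \<in> fv \<alpha>" using vertex_in_face[OF i] by blast
      show ?thesis using mink_future_neg[of "N \<alpha>" "p i"] time[OF a(1)] H_p[OF i] m[OF a] by simp
    qed
  qed
qed

lemma H_lift_iff: "(\<exists>M. covectors p M) \<longleftrightarrow> (\<exists>q. polyhedral_lift_H G \<phi> \<gamma> p q)"
proof
  assume "\<exists>M. covectors p M"
  then obtain N h where cov: "covectors p (\<lambda>\<alpha>. flip (- 1) (N \<alpha>))" and N: "\<And>\<alpha>. \<alpha> \<in> F \<Longrightarrow> mink (N \<alpha>) (N \<alpha>) < 0 \<and> N \<alpha> $ 1 > 0"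
    and h: "\<And>i. i \<in> V \<Longrightarrow> h i < 0" "\<And>\<alpha> i. \<alpha> \<in> F \<Longrightarrow> i \<in> fv \<alpha> \<Longrightarrow> mink (N \<alpha>) (p i) = h i"
    using H_timelike by metis
  define q where "q i = (- 1 / h i) *\<^sub>R p i" for i
  have q: "q i = (- 1 / h i) *\<^sub>R p i \<and> - 1 / h i \<noteq> 0 \<and> flip (- 1) (N \<alpha>) \<bullet> q i = - 1" if "\<alpha> \<in> F" "i \<in> fv \<alpha>" for \<alpha> i
    using h(1)[OF fv_V[OF that(2)]] h(2)[OF that] by (simp add: q_def mink_scaleR flip: mink_flip)
  have poly: "polyhedral G \<phi> \<gamma> q"
    by (rule covectors_imp_polyhedral(1)[OF H_nondeg cov _ q]) auto
  have "space_like (face_plane G \<phi> q \<alpha>)" if a: "\<alpha> \<in> F" for \<alpha>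
    unfolding space_like_def
  proof (intro ballI impI)
    have sub: "face_plane G \<phi> q \<alpha> \<subseteq> {x. flip (- 1) (N \<alpha>) \<bullet> x = - 1}"
      by (rule covectors_imp_polyhedral(2)[OF H_nondeg cov _ q a]) auto
    fix x y assume xy: "x \<in> face_plane G \<phi> q \<alpha>" "y \<in> face_plane G \<phi> q \<alpha>" "x \<noteq> y"
    then have "flip (- 1) (N \<alpha>) \<bullet> x = - 1" "flip (- 1) (N \<alpha>) \<bullet> y = - 1" using sub by blast+
    then have "flip (- 1) (N \<alpha>) \<bullet> (x - y) = 0" by (simp add: inner_diff_right)
    then show "mink (x - y) (x - y) > 0"
      using timelike_orthogonal_spacelike[of "N \<alpha>" "x - y"] N[OF a] xy(3) by (simp add: mink_flip)
  qed
  moreover have "\<exists>a. a > 0 \<and> q i = a *\<^sub>R p i" if "i \<in> V" for i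
    using h(1)[OF that] by (intro exI[of _ "- 1 / h i"]) (simp add: q_def divide_pos_neg)
  ultimately show "\<exists>q. polyhedral_lift_H G \<phi> \<gamma> p q" using poly unfolding polyhedral_lift_H_def by blast
next
  assume "\<exists>q. polyhedral_lift_H G \<phi> \<gamma> p q"
  then obtain q where q: "polyhedral G \<phi> \<gamma> q" "\<forall>i\<in>V. \<exists>a. a > 0 \<and> q i = a *\<^sub>R p i"
    unfolding polyhedral_lift_H_def by blast
  from q(2) obtain a where "\<And>i. i \<in> V \<Longrightarrow> a i > 0 \<and> q i = a i *\<^sub>R p i" by metis
  then have a: "\<And>i. i \<in> V \<Longrightarrow> a i \<noteq> 0 \<and> q i = a i *\<^sub>R p i" by (metis less_irrefl)
  show "\<exists>M. covectors p M"
    by (rule polyhedral_imp_covectors[OF _ q(1), where a = a]) (use H_nondeg a in blast)+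
qed

lemma H_reciprocal_iff: "(\<exists>M. covectors p M) \<longleftrightarrow> (\<exists>m. reciprocal_H G \<phi> \<gamma> p m)"
proof
  assume "\<exists>M. covectors p M"
  then obtain N h where cov: "covectors p (\<lambda>\<alpha>. flip (- 1) (N \<alpha>))" and N: "\<And>\<alpha>. \<alpha> \<in> F \<Longrightarrow> mink (N \<alpha>) (N \<alpha>) < 0 \<and> N \<alpha> $ 1 > 0"
    and h: "\<And>i. i \<in> V \<Longrightarrow> h i < 0" "\<And>\<alpha> i. \<alpha> \<in> F \<Longrightarrow> i \<in> fv \<alpha> \<Longrightarrow> mink (N \<alpha>) (p i) = h i"
    using H_timelike by metis
  define m where "m \<alpha> = (1 / sqrt (- mink (N \<alpha>) (N \<alpha>))) *\<^sub>R N \<alpha>" for \<alpha>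
  have mH: "m \<alpha> \<in> H2" if "\<alpha> \<in> F" for \<alpha>
    unfolding m_def using normalize_timelike N[OF that] by blast
  have pos: "sqrt (- mink (N \<alpha>) (N \<alpha>)) > 0" if "\<alpha> \<in> F" for \<alpha> using N[OF that] by simp
  have mp: "mink (m \<alpha>) (p i) = h i / sqrt (- mink (N \<alpha>) (N \<alpha>))" if "\<alpha> \<in> F" "i \<in> fv \<alpha>" for \<alpha> i
    using h(2)[OF that] by (simp add: m_def mink_scaleR)
  have mneq: "m (L i j) \<noteq> m (L j i)" if ij: "(i, j) \<in> E" for i j
  proof
    define s where "s \<alpha> = sqrt (- mink (N \<alpha>) (N \<alpha>))" for \<alpha>
    have s: "s (L i j) > 0" using pos[OF L_face[OF ij]] by (simp add: s_def)
    assume "m (L i j) = m (L j i)"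
    then have "s (L i j) *\<^sub>R m (L i j) = s (L i j) *\<^sub>R m (L j i)" by simp
    then have "N (L i j) = (s (L i j) / s (L j i)) *\<^sub>R N (L j i)"
      using s by (simp add: m_def flip: s_def)
    then have "flip (- 1) (N (L i j)) = (s (L i j) / s (L j i)) *\<^sub>R flip (- 1) (N (L j i))"
      by (simp add: real3_eq_iff)
    moreover have "flip (- 1) (N (L i j)) \<bullet> p i \<noteq> 0"
      using h(1)[OF E_VD(1)[OF ij]] h(2)[OF L_face[OF ij] fv_L(1)[OF ij]] by (simp add: mink_flip)
    ultimately show False using covectors_not_parallel[OF cov ij] by blast
  qed
  have "perp_geodesics mink H2 (p i) (p j) (m \<alpha>) (m \<beta>)" if "dual_pair G \<phi> \<gamma> \<alpha> \<beta> i j" for \<alpha> \<beta> i j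
  proof -
    have ij: "(i, j) \<in> E" and ab: "\<alpha> = L i j \<and> \<beta> = L j i \<or> \<alpha> = L j i \<and> \<beta> = L i j" using dual_pair_cases[OF that] by auto
    have ab': "\<alpha> \<in> F" "\<beta> \<in> F" "i \<in> fv \<alpha>" "i \<in> fv \<beta>" "j \<in> fv \<alpha>" "j \<in> fv \<beta>"
      using ab L_face ij E_sym fv_L[OF ij] by auto
    have "m \<alpha> \<noteq> m \<beta>" using mneq ij E_sym ab by metis
    note c = hyperbolic_cross_nonzero[OF mH[OF ab'(1)] mH[OF ab'(2)] this]
    note d = hyperbolic_cross_nonzero[OF H_edge[OF ij]]
    let ?n = "cross3 (p i) (p j)" and ?k = "cross3 (m \<alpha>) (m \<beta>)"
    have det: "mink ?n ?k = 0"
      unfolding mink_flip by (subst det_normals) (use mp ab' in \<open>simp_all add: mink_commute[of "p _"] flip: mink_flip\<close>)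
    \<comment> \<open>the planes have space-like normal vectors, so their common line is time-like\<close>
    define y where "y = cross3 ?n ?k"
    have "mink y y = - 1 * (mink ?n ?n * mink ?k ?k - mink ?n ?k * mink ?k ?n)"
      unfolding y_def mink_flip by (rule det_normals) simp
    then have "mink y y = - (mink ?n ?n * mink ?k ?k)" using det by simp
    then have yy: "mink y y < 0" using c(2) d(2) by simp
    have "y $ 1 \<noteq> 0"
    proof
      assume "y $ 1 = 0"
      then have "mink y y = y $ 2 * y $ 2 + y $ 3 * y $ 3" by (simp add: mink_def)
      then show False using yy by (metis add_nonneg_nonneg not_less zero_le_square)
    qed
    define z where "z = (1 / sqrt (- mink y y)) *\<^sub>R (sgn (y $ 1) *\<^sub>R y)"
    have sg: "sgn (y $ 1) * sgn (y $ 1) = 1" using \<open>y $ 1 \<noteq> 0\<close> by (simp add: sgn_if)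
    then have "mink (sgn (y $ 1) *\<^sub>R y) (sgn (y $ 1) *\<^sub>R y) = mink y y" by (simp add: mink_scaleR flip: mult.assoc)
    moreover have "(sgn (y $ 1) *\<^sub>R y) $ 1 > 0" using \<open>y $ 1 \<noteq> 0\<close> by (simp add: sgn_if)
    ultimately have zH: "z \<in> H2" unfolding z_def using normalize_timelike[of "sgn (y $ 1) *\<^sub>R y"] yy by simp
    have "perp_geodesics (\<lambda>x y. flip (- 1) x \<bullet> y) H2 (p i) (p j) (m \<alpha>) (m \<beta>)"
    proof (rule perp_geodesicsI[of "- 1", OF _ d(1) c(1) zH])
      show "z \<bullet> ?n = 0" "z \<bullet> ?k = 0" by (simp_all add: z_def y_def dot_cross_self)
      show "flip (- 1) ?n \<bullet> ?k = 0" using det by (simp add: mink_flip)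
    qed simp
    then show ?thesis by (simp flip: mink_flip)
  qed
  moreover have "framework_H (dual_graph G \<phi> \<gamma>) m"
    unfolding framework_H_def
  proof (intro conjI ballI)
    show "m \<alpha> \<in> H2" if "\<alpha> \<in> pverts (dual_graph G \<phi> \<gamma>)" for \<alpha> using mH that by (simp add: dual_graph_def)
    fix e assume "e \<in> parcs (dual_graph G \<phi> \<gamma>)"
    then obtain i j where "e = (L i j, L j i)" "(i, j) \<in> E" by (cases e) (auto simp: dual_edge_iff)
    then show "case e of (\<alpha>, \<beta>) \<Rightarrow> m \<alpha> \<noteq> m \<beta>" using mneq by simp
  qed
  ultimately show "\<exists>m. reciprocal_H G \<phi> \<gamma> p m" unfolding reciprocal_H_def by blast
next
  assume "\<exists>m. reciprocal_H G \<phi> \<gamma> p m"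
  then obtain m where fm: "framework_H (dual_graph G \<phi> \<gamma>) m"
    and perp: "\<And>\<alpha> \<beta> i j. dual_pair G \<phi> \<gamma> \<alpha> \<beta> i j \<Longrightarrow> perp_geodesics mink H2 (p i) (p j) (m \<alpha>) (m \<beta>)"
    unfolding reciprocal_H_def by blast
  have mH: "m \<alpha> \<in> H2" if "\<alpha> \<in> F" for \<alpha>
    using fm that unfolding framework_H_def dual_graph_def by auto
  show "\<exists>M. covectors p M"
  proof (rule covectors_of_directions)
    show "flip (- 1) (m \<alpha>) \<bullet> p i \<noteq> 0" if "\<alpha> \<in> F" "i \<in> fv \<alpha>" for \<alpha> i
      using mink_H2_le[OF mH[OF that(1)] H_p[OF fv_V[OF that(2)]]] by (simp add: mink_flip)
    fix i j assume ij: "(i, j) \<in> E"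
    have "perp_geodesics (\<lambda>x y. flip (- 1) x \<bullet> y) H2 (p i) (p j) (m (L i j)) (m (L j i))"
      using perp[OF dual_pair_L[OF ij]] by (simp flip: mink_flip)
    then have "mink (p i) (m (L i j)) * mink (p j) (m (L j i)) = mink (p i) (m (L j i)) * mink (p j) (m (L i j))"
      unfolding mink_flip by (rule perp_geodesics_imp_det) (simp add: H2_def flip: mink_flip)
    then show "(flip (- 1) (m (L i j)) \<bullet> p i) * (flip (- 1) (m (L j i)) \<bullet> p j) =
        (flip (- 1) (m (L i j)) \<bullet> p j) * (flip (- 1) (m (L j i)) \<bullet> p i)"
      unfolding mink_flip[symmetric] by (simp add: mink_commute[of "m _"] mult.commute)
    have ne: "m (L i j) \<noteq> m (L j i)"
      using fm ij dual_edge_iff unfolding framework_H_def by blast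
    show "flip (- 1) (m (L i j)) \<noteq> c *\<^sub>R flip (- 1) (m (L j i))" for c
    proof
      assume "flip (- 1) (m (L i j)) = c *\<^sub>R flip (- 1) (m (L j i))"
      then have eq: "m (L i j) = c *\<^sub>R m (L j i)" by (simp add: real3_eq_iff)
      have H: "m (L i j) \<in> H2" "m (L j i) \<in> H2" using mH L_face ij E_sym by auto
      then have "c * c = 1" unfolding eq by (simp add: H2_def mink_scaleR)
      moreover have "c > 0" using H unfolding eq by (simp add: H2_def zero_less_mult_iff)
      ultimately have "c = 1" by (metis mult_cancel_left2 mult_less_cancel_left_pos less_irrefl linorder_neqE_linordered_idom mult.right_neutral mult_strict_mono' order_less_imp_le zero_less_one)
      then show False using eq ne by simp
    qed
  qed
qed

end

subsection \<open>The Euclidean plane\<close>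

context
  fixes p :: "'a \<Rightarrow> real^2"
  assumes fr: "framework_E G p" and nc: "\<And>\<alpha>. \<alpha> \<in> F \<Longrightarrow> \<not> collinear (p ` fv \<alpha>)"
begin

lemma E_neq: "(i, j) \<in> E \<Longrightarrow> p i \<noteq> p j"
  using fr unfolding framework_E_def by blast

lemma E_cross: "(i, j) \<in> E \<Longrightarrow> cross3 (homog (p i)) (homog (p j)) \<noteq> 0"
  using E_neq[of i j] by (auto simp: real3_eq_iff real2_eq_iff cross_components)

lemma E_affine_nondeg:
  assumes "\<alpha> \<in> F" "\<And>i. i \<in> fv \<alpha> \<Longrightarrow> u \<bullet> p i = c"
  shows "u = 0"
proof (rule ccontr)
  assume u: "u \<noteq> 0"
  have "aff_dim (p ` fv \<alpha>) \<le> aff_dim {x. u \<bullet> x = c}" by (rule aff_dim_subset) (use assms(2) in auto)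
  also have "\<dots> = 1" using u by (simp add: aff_dim_hyperplane)
  finally show False using nc[OF assms(1)] by (simp add: collinear_aff_dim)
qed

lemma E_nondeg:
  assumes a: "\<alpha> \<in> F" and n: "\<And>i. i \<in> fv \<alpha> \<Longrightarrow> n \<bullet> homog (p i) = 0"
  shows "n = 0"
proof -
  have "pr_perp n = 0" by (rule E_affine_nondeg[OF a, of _ "- n $ 3"]) (use n in \<open>simp add: inner_homog eq_neg_iff_add_eq_0\<close>)
  moreover obtain i where "i \<in> fv \<alpha>" using fv_nonempty[OF a] by blast
  then have "pr_perp n \<bullet> p i + n $ 3 = 0" using n[of i] by (simp add: inner_homog)
  ultimately have "pr_perp n = 0" "n $ 3 = 0" by simp_all
  then show ?thesis by (simp add: real3_eq_iff real2_eq_iff)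
qed

lemma E_stress_iff: "(\<exists>w. self_stress_E G p w \<and> nonzero_on_edges G w) \<longleftrightarrow> (\<exists>M. covectors (\<lambda>i. homog (p i)) M)"
proof -
  have sum: "(\<Sum>j | (i, j) \<in> E. w i j *\<^sub>R (p j - p i)) = 0 \<longleftrightarrow>
      (\<Sum>j | (i, j) \<in> E. (w i j * 1) *\<^sub>R (homog (p j) - homog (p i))) = 0" for w i
    by (simp add: real3_eq_iff real2_eq_iff)
  have "(\<exists>w. symmetric_weights G w \<and> nonzero_on_edges G w \<and>
            (\<forall>i\<in>V. (\<Sum>j | (i, j) \<in> E. (w i j * 1) *\<^sub>R (homog (p j) - homog (p i))) = 0)) \<longleftrightarrow> (\<exists>w. equilibrium E (\<lambda>i. homog (p i)) w)"
    by (rule stress_iff_equilibrium[where n = "\<lambda>i. vector [0, 0, 1]"])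
      (auto simp: inner_real3 intro!: exI[of _ 1])
  then show ?thesis
    using equilibrium_iff_covectors[of "\<lambda>i. homog (p i)", OF E_cross] unfolding self_stress_E_def sum by blast
qed

text \<open>
  \<open>M \<alpha> \<bullet> homog x\<close> is the height at \<open>x\<close> of the plane of \<open>\<alpha>\<close>, so this plane has the normal vector
  \<open>(- M \<alpha> $ 1, - M \<alpha> $ 2, 1)\<close>.
\<close>

lemma E_lift_iff: "(\<exists>M. covectors (\<lambda>i. homog (p i)) M) \<longleftrightarrow> (\<exists>q. polyhedral_lift_E G \<phi> \<gamma> p q)"
proof
  assume "\<exists>M. covectors (\<lambda>i. homog (p i)) M"
  then obtain M where M: "covectors (\<lambda>i. homog (p i)) M" by blast
  obtain h where h: "\<And>\<alpha> i. \<alpha> \<in> F \<Longrightarrow> i \<in> fv \<alpha> \<Longrightarrow> M \<alpha> \<bullet> homog (p i) = h i" using covectors_heights[OF M] by blast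
  define q :: "'a \<Rightarrow> real^3" where "q i = vector [p i $ 1, p i $ 2, h i]" for i
  define n :: "(real^3) set \<Rightarrow> real^3" where "n \<alpha> = vector [- M \<alpha> $ 1, - M \<alpha> $ 2, 1]" for \<alpha>
  have n0: "n \<alpha> \<noteq> 0" for \<alpha> by (simp add: n_def real3_eq_iff)
  have nq: "n \<alpha> \<bullet> q i = M \<alpha> $ 3" if "\<alpha> \<in> F" "i \<in> fv \<alpha>" for \<alpha> i
    using h[OF that] by (simp add: n_def q_def inner_real3)
  have "polyhedral G \<phi> \<gamma> q"
    unfolding polyhedral_def
  proof (intro conjI ballI)
    show "coplanar (q ` fv \<alpha>)" if "\<alpha> \<in> F" for \<alpha>
      unfolding coplanar_iff_hyperplane using n0 nq[OF that] by blast
    fix e assume "e \<in> parcs (dual_graph G \<phi> \<gamma>)"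
    then obtain i j where e: "e = (L i j, L j i)" and ij: "(i, j) \<in> E"
      by (cases e) (auto simp: dual_edge_iff)
    have F: "L i j \<in> F" "L j i \<in> F" using L_face ij E_sym by auto
    have "face_plane G \<phi> q (L i j) \<noteq> face_plane G \<phi> q (L j i)"
    proof
      assume eq: "face_plane G \<phi> q (L i j) = face_plane G \<phi> q (L j i)"
      have "q ` fv (L j i) \<subseteq> {x. n (L j i) \<bullet> x = M (L j i) $ 3}" using nq[OF F(2)] by auto
      then have sub: "face_plane G \<phi> q (L j i) \<subseteq> {x. n (L j i) \<bullet> x = M (L j i) $ 3}"
        unfolding face_plane_def by (rule hull_minimal) (rule affine_hyperplane)
      have "(M (L i j) - M (L j i)) \<bullet> homog (p k) = 0" if k: "k \<in> fv (L i j)" for k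
      proof -
        have "q k \<in> face_plane G \<phi> q (L i j)" using k by (simp add: face_plane_def hull_inc)
        then have "n (L j i) \<bullet> q k = M (L j i) $ 3" using eq sub by blast
        then have "M (L j i) \<bullet> homog (p k) = h k" by (simp add: n_def q_def inner_real3)
        then show ?thesis using h[OF F(1) k] by (simp add: inner_diff_left)
      qed
      then show False using E_nondeg[OF F(1), of "M (L i j) - M (L j i)"] covectorsD(1)[OF M ij] by auto
    qed
    then show "case e of (\<alpha>, \<beta>) \<Rightarrow> face_plane G \<phi> q \<alpha> \<noteq> face_plane G \<phi> q \<beta>" by (simp add: e)
  qed
  moreover have "pr_perp (q i) = p i" for i by (simp add: q_def real2_eq_iff)
  ultimately show "\<exists>q. polyhedral_lift_E G \<phi> \<gamma> p q" unfolding polyhedral_lift_E_def by blast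
next
  assume "\<exists>q. polyhedral_lift_E G \<phi> \<gamma> p q"
  then obtain q where poly: "polyhedral G \<phi> \<gamma> q" and pq: "\<And>i. i \<in> V \<Longrightarrow> pr_perp (q i) = p i"
    unfolding polyhedral_lift_E_def by blast
  have nq: "n \<bullet> q i = pr_perp n \<bullet> p i + n $ 3 * q i $ 3" if "i \<in> V" for n i
    unfolding pq[OF that, symmetric] by (simp add: inner_real3 inner_real2)
  have "\<exists>m. \<forall>i\<in>fv \<alpha>. m \<bullet> homog (p i) = q i $ 3" if a: "\<alpha> \<in> F" for \<alpha>
  proof -
    have "coplanar (q ` fv \<alpha>)" using poly a unfolding polyhedral_def by blast
    then obtain n c where n: "n \<noteq> 0" "\<And>i. i \<in> fv \<alpha> \<Longrightarrow> n \<bullet> q i = c" unfolding coplanar_iff_hyperplane by auto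
    have n3: "n $ 3 \<noteq> 0"
    proof
      assume n3: "n $ 3 = 0"
      then have "pr_perp n = 0" using E_affine_nondeg[OF a, of "pr_perp n" c] n(2) nq fv_V by simp
      then show False using n(1) n3 by (simp add: real3_eq_iff real2_eq_iff)
    qed
    define m :: "real^3" where "m = vector [- n $ 1 / n $ 3, - n $ 2 / n $ 3, c / n $ 3]"
    have "m \<bullet> homog (p i) = q i $ 3" if i: "i \<in> fv \<alpha>" for i
    proof -
      have "n $ 1 * p i $ 1 + n $ 2 * p i $ 2 + n $ 3 * q i $ 3 = c"
        using n(2)[OF i] nq[OF fv_V[OF i], of n] by (simp add: inner_real2)
      then show ?thesis using n3 by (simp add: m_def inner_real3 field_simps)
    qed
    then show ?thesis by blast
  qed
  then obtain M where M: "\<And>\<alpha> i. \<alpha> \<in> F \<Longrightarrow> i \<in> fv \<alpha> \<Longrightarrow> M \<alpha> \<bullet> homog (p i) = q i $ 3" by metis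
  have plane: "face_plane G \<phi> q \<alpha> = {x. vector [- M \<alpha> $ 1, - M \<alpha> $ 2, 1] \<bullet> x = M \<alpha> $ 3}" if a: "\<alpha> \<in> F" for \<alpha>
    unfolding face_plane_def
  proof (rule affine_hull_eq_hyperplane)
    let ?n = "vector [- M \<alpha> $ 1, - M \<alpha> $ 2, 1] :: real^3"
    show "?n \<noteq> 0" by (simp add: real3_eq_iff)
    have n: "?n \<bullet> q i = M \<alpha> $ 3" if "i \<in> fv \<alpha>" for i
      using M[OF a that] nq[OF fv_V[OF that], of ?n] by (simp add: inner_real3 inner_real2)
    then show "?n \<bullet> x = M \<alpha> $ 3" if "x \<in> q ` fv \<alpha>" for x using that by auto
    fix n' c' assume n': "\<And>x. x \<in> q ` fv \<alpha> \<Longrightarrow> n' \<bullet> x = c'"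
    let ?u = "n' - n' $ 3 *\<^sub>R ?n"
    have u: "?u \<bullet> q i = c' - n' $ 3 * M \<alpha> $ 3" if "i \<in> fv \<alpha>" for i
      using n'[of "q i"] n[OF that] that by (simp add: inner_diff_left)
    have u3: "?u $ 3 = 0" by simp
    have "pr_perp ?u = 0"
      by (rule E_affine_nondeg[OF a, of _ "c' - n' $ 3 * M \<alpha> $ 3"]) (use u nq[of _ ?u] fv_V u3 in simp)
    then have "?u = 0" using u3 by (simp add: real3_eq_iff real2_eq_iff)
    moreover obtain i where "i \<in> fv \<alpha>" using fv_nonempty[OF a] by blast
    ultimately have "c' = n' $ 3 * M \<alpha> $ 3" using u by force
    with \<open>?u = 0\<close> show "\<exists>t. n' = t *\<^sub>R ?n \<and> c' = t * M \<alpha> $ 3" by (intro exI[of _ "n' $ 3"]) simp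
  qed
  have "covectors (\<lambda>i. homog (p i)) M"
    unfolding covectors_def
  proof (intro ballI, clarify)
    fix i j assume ij: "(i, j) \<in> E"
    have F: "L i j \<in> F" "L j i \<in> F" using L_face ij E_sym by auto
    have "face_plane G \<phi> q (L i j) \<noteq> face_plane G \<phi> q (L j i)"
      using poly ij dual_edge_iff unfolding polyhedral_def by blast
    then have "M (L i j) \<noteq> M (L j i)" using plane F by auto
    then show "M (L i j) \<noteq> M (L j i) \<and> M (L i j) \<bullet> homog (p i) = M (L j i) \<bullet> homog (p i) \<and> M (L i j) \<bullet> homog (p j) = M (L j i) \<bullet> homog (p j)"
      using fv_L[OF ij] M F by simp
  qed
  then show "\<exists>M. covectors (\<lambda>i. homog (p i)) M" by blast
qed

text \<open>
  A reciprocal diagram prescribes the gradients \<open>m \<alpha>\<close> of the affine functions that the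
  covectors describe. Their constant terms \<open>c \<alpha>\<close> are found by exactness, since the change of
  \<open>c\<close> that is required across the edge \<open>ij\<close> is minus the product of \<open>p i\<close> with the change of \<open>m\<close>.
\<close>

lemma E_reciprocal_iff: "(\<exists>M. covectors (\<lambda>i. homog (p i)) M) \<longleftrightarrow> (\<exists>m. reciprocal_E G \<phi> \<gamma> p m)"
proof
  assume "\<exists>M. covectors (\<lambda>i. homog (p i)) M"
  then obtain M where M: "covectors (\<lambda>i. homog (p i)) M" by blast
  let ?m = "\<lambda>\<alpha>. pr_perp (M \<alpha>)"
  have sum: "(?m (L i j) - ?m (L j i)) \<bullet> p k = M (L j i) $ 3 - M (L i j) $ 3" if "(i, j) \<in> E" "k = i \<or> k = j" for i j k
    using covectorsD(2,3)[OF M that(1)] that(2) by (auto simp: inner_homog inner_diff_left)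
  have orth: "(?m (L i j) - ?m (L j i)) \<bullet> (p j - p i) = 0" if "(i, j) \<in> E" for i j
    using sum[OF that, of i] sum[OF that, of j] by (simp add: inner_diff_right)
  have neq: "?m (L i j) \<noteq> ?m (L j i)" if "(i, j) \<in> E" for i j
  proof
    assume eq: "?m (L i j) = ?m (L j i)"
    then have "M (L j i) $ 3 = M (L i j) $ 3" using sum[OF that, of i] by simp
    then have "M (L i j) = M (L j i)" using eq by (simp add: real3_eq_iff real2_eq_iff)
    then show False using covectorsD(1)[OF M that] by simp
  qed
  have "framework_E (dual_graph G \<phi> \<gamma>) ?m"
    unfolding framework_E_def using neq by (auto simp: dual_edge_iff)
  moreover have "orthogonal (?m \<beta> - ?m \<alpha>) (p j - p i)" if "dual_pair G \<phi> \<gamma> \<alpha> \<beta> i j" for \<alpha> \<beta> i j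
    using dual_pair_cases[OF that] orth[of i j] by (auto simp: orthogonal_def inner_diff_left)
  ultimately show "\<exists>m. reciprocal_E G \<phi> \<gamma> p m" unfolding reciprocal_E_def by blast
next
  assume "\<exists>m. reciprocal_E G \<phi> \<gamma> p m"
  then obtain m where fm: "framework_E (dual_graph G \<phi> \<gamma>) m"
    and perp: "\<And>\<alpha> \<beta> i j. dual_pair G \<phi> \<gamma> \<alpha> \<beta> i j \<Longrightarrow> orthogonal (m \<beta> - m \<alpha>) (p j - p i)"
    unfolding reciprocal_E_def by blast
  have orth: "(m (L i j) - m (L j i)) \<bullet> p j = (m (L i j) - m (L j i)) \<bullet> p i" if "(i, j) \<in> E" for i j
    using perp[OF dual_pair_L[OF that]] by (simp add: orthogonal_def inner_diff_left inner_diff_right)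
  have neq: "m (L i j) \<noteq> m (L j i)" if "(i, j) \<in> E" for i j
    using fm that dual_edge_iff unfolding framework_E_def by blast
  have "\<exists>c. \<forall>(i, j)\<in>E. c (L i j) = - ((m (L i j) - m (L j i)) \<bullet> p i) + c (L j i)"
  proof (rule additive_exact)
    show "- ((m (L j i) - m (L i j)) \<bullet> p j) = - (- ((m (L i j) - m (L j i)) \<bullet> p i))" if "(i, j) \<in> E" for i j
      using orth[OF that] by (simp add: inner_diff_left)
    show "(\<Sum>j | (i, j) \<in> E. - ((m (L i j) - m (L j i)) \<bullet> p i)) = 0" if "i \<in> V" for i
      using balanced_sum[OF that, of "\<lambda>\<alpha>. m \<alpha> \<bullet> p i"] by (simp add: inner_diff_left sum_subtractf)
  qed
  then obtain c where c: "\<And>i j. (i, j) \<in> E \<Longrightarrow> c (L i j) = - ((m (L i j) - m (L j i)) \<bullet> p i) + c (L j i)" by blast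
  define M :: "(real^3) set \<Rightarrow> real^3" where "M \<alpha> = vector [m \<alpha> $ 1, m \<alpha> $ 2, c \<alpha>]" for \<alpha>
  have Mh: "M \<alpha> \<bullet> homog x = m \<alpha> \<bullet> x + c \<alpha>" for \<alpha> x by (simp add: M_def inner_real3 inner_real2)
  have "covectors (\<lambda>i. homog (p i)) M"
    unfolding covectors_def Mh
  proof (intro ballI, clarify, intro conjI)
    fix i j assume ij: "(i, j) \<in> E"
    show "M (L i j) \<noteq> M (L j i)" using neq[OF ij] by (auto simp: M_def real3_eq_iff real2_eq_iff)
    show "m (L i j) \<bullet> p i + c (L i j) = m (L j i) \<bullet> p i + c (L j i)" using c[OF ij] by (simp add: inner_diff_left)
    show "m (L i j) \<bullet> p j + c (L i j) = m (L j i) \<bullet> p j + c (L j i)" using c[OF ij] orth[OF ij] by (simp add: inner_diff_left)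
  qed
  then show "\<exists>M. covectors (\<lambda>i. homog (p i)) M" by blast
qed

end

end

theorem theoremD:
  fixes G :: "'a pair_pre_digraph"
    and \<phi> :: "'a \<Rightarrow> real^3"
    and \<gamma> :: "'a \<Rightarrow> 'a \<Rightarrow> real \<Rightarrow> real^3"
  assumes "pair_graph G"
    and "three_connected G"
    and "sphere_embedding G \<phi> \<gamma>"
  shows
    "(\<forall>p :: 'a \<Rightarrow> real^2.
        framework_E G p \<and> (\<forall>\<alpha>\<in>faces G \<phi> \<gamma>. \<not> collinear (p ` face_verts G \<phi> \<alpha>)) \<longrightarrow>
        ((\<exists>w. self_stress_E G p w \<and> nonzero_on_edges G w) \<longleftrightarrow> (\<exists>m. reciprocal_E G \<phi> \<gamma> p m)) \<and>
        ((\<exists>m. reciprocal_E G \<phi> \<gamma> p m) \<longleftrightarrow> (\<exists>q. polyhedral_lift_E G \<phi> \<gamma> p q))) \<and>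
     (\<forall>p :: 'a \<Rightarrow> real^3.
        framework_S G p \<and> (\<forall>\<alpha>\<in>faces G \<phi> \<gamma>. \<not> on_geodesic S2 (p ` face_verts G \<phi> \<alpha>)) \<longrightarrow>
        ((\<exists>w. self_stress_S G p w \<and> nonzero_on_edges G w) \<longleftrightarrow> (\<exists>m. reciprocal_S G \<phi> \<gamma> p m)) \<and>
        ((\<exists>m. reciprocal_S G \<phi> \<gamma> p m) \<longleftrightarrow> (\<exists>q. polyhedral_lift_S G \<phi> \<gamma> p q))) \<and>
     (\<forall>p :: 'a \<Rightarrow> real^3.
        framework_H G p \<and> (\<forall>\<alpha>\<in>faces G \<phi> \<gamma>. \<not> on_geodesic H2 (p ` face_verts G \<phi> \<alpha>)) \<longrightarrow>
        ((\<exists>w. self_stress_H G p w \<and> nonzero_on_edges G w) \<longleftrightarrow> (\<exists>m. reciprocal_H G \<phi> \<gamma> p m)) \<and>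
        ((\<exists>m. reciprocal_H G \<phi> \<gamma> p m) \<longleftrightarrow> (\<exists>q. polyhedral_lift_H G \<phi> \<gamma> p q)))"
proof -
  obtain L where "face_structure G \<phi> \<gamma> L"
    using ex_face_structure[OF assms] .
  then interpret face_structure G \<phi> \<gamma> L .
  show ?thesis
  proof (intro conjI allI impI; elim conjE)
    fix p assume "framework_E G p" "\<forall>\<alpha>\<in>faces G \<phi> \<gamma>. \<not> collinear (p ` face_verts G \<phi> \<alpha>)"
    then show "(\<exists>w. self_stress_E G p w \<and> nonzero_on_edges G w) \<longleftrightarrow> (\<exists>m. reciprocal_E G \<phi> \<gamma> p m)"
      "(\<exists>m. reciprocal_E G \<phi> \<gamma> p m) \<longleftrightarrow> (\<exists>q. polyhedral_lift_E G \<phi> \<gamma> p q)"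
      using E_stress_iff E_reciprocal_iff E_lift_iff by blast+
  next
    fix p assume "framework_S G p" "\<forall>\<alpha>\<in>faces G \<phi> \<gamma>. \<not> on_geodesic S2 (p ` face_verts G \<phi> \<alpha>)"
    then show "(\<exists>w. self_stress_S G p w \<and> nonzero_on_edges G w) \<longleftrightarrow> (\<exists>m. reciprocal_S G \<phi> \<gamma> p m)"
      "(\<exists>m. reciprocal_S G \<phi> \<gamma> p m) \<longleftrightarrow> (\<exists>q. polyhedral_lift_S G \<phi> \<gamma> p q)"
      using S_stress_iff S_reciprocal_iff S_lift_iff by blast+
  next
    fix p assume "framework_H G p" "\<forall>\<alpha>\<in>faces G \<phi> \<gamma>. \<not> on_geodesic H2 (p ` face_verts G \<phi> \<alpha>)"
    then show "(\<exists>w. self_stress_H G p w \<and> nonzero_on_edges G w) \<longleftrightarrow> (\<exists>m. reciprocal_H G \<phi> \<gamma> p m)"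
      "(\<exists>m. reciprocal_H G \<phi> \<gamma> p m) \<longleftrightarrow> (\<exists>q. polyhedral_lift_H G \<phi> \<gamma> p q)"
      using H_stress_iff H_reciprocal_iff H_lift_iff by blast+
  qed
qed

end
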